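(* Assume the weight functions $\hat w^{(n)}:\mathbb R^{d_Z}\to\mathbb R$ are estimated on a data set $\mathbf A$ independent of $(\mathbf X^{(n)},\mathbf Y^{(n)},\mathbf Z^{(n)})$, and that there exists $C>0$ such that $|\hat w^{(n)}(z)|\le C$ for all $n\in\mathbb N$ and $z\in\mathbb R^{d_Z}$. Define $\bar\sigma_n^2=\bar\sigma_{n,P}^2=\mathbb E_P[\hat w^{(n)}(Z)^2\epsilon_P^2\xi_P^2\mid\mathbf A]$. 1. Let $P\in\mathcal P_0$. Assume $A_fA_g=o_P(n^{-1})$, $B_f=o_P(1)$, $B_g=o_P(1)$, that there exists $\eta>0$ with $\mathbb E_P[|\epsilon_P\xi_P|^{2+\eta}]<\infty$, and that $P$-almost surely there exists $c>0$ with $\inf_{n\in\mathbb N}\bar\sigma_n^2\ge c$. Then $\sup_{t\in\mathbb R}|\mathbb P_P(T^{(n)}\le t)-\Phi(t)|\to0$. 2. Let $\mathcal P\subset\mathcal P_0$. Assume $A_fA_g=o_{\mathcal P}(n^{-1})$, $B_f=o_{\mathcal P}(1)$, $B_g=o_{\mathcal P}(1)$, that there exists $\eta>0$ with $\sup_{P\in\mathcal P}\mathbb E_P[|\epsilon_P\xi_P|^{2+\eta}]<\infty$, and that there exists $c>0$ such that for all $P\in\mathcal P$, $P$-almost surely $\inf_{n\in\mathbb N}\bar\sigma_n^2\ge c$. Then $\sup_{P\in\mathcal P}\sup_{t\in\mathbb R}|\mathbb P_P(T^{(n)}\le t)-\Phi(t)|\to0$.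
   Context: Let $X,Y$ be real-valued random variables and $Z$ a random vector in $\mathbb R^{d_Z}$. $\mathcal E_0$ is the set of distributions of $(X,Y,Z)$ absolutely continuous with respect to Lebesgue measure, $\mathcal P_0\subseteq\mathcal E_0$ those under which $X$ and $Y$ are conditionally independent given $Z$. For $P\in\mathcal E_0$: $f_P(z)=\mathbb E_P[X\mid Z=z]$, $g_P(z)=\mathbb E_P[Y\mid Z=z]$, $\epsilon_P=X-f_P(Z)$, $\xi_P=Y-g_P(Z)$, $u_P(z)=\mathbb E_P[\epsilon_P^2\mid Z=z]$, $v_P(z)=\mathbb E_P[\xi_P^2\mid Z=z]$. Data $(x_i,y_i,z_i)$, $i=1,\dots,n$, are i.i.d. copies of $(X,Y,Z)$ forming $(\mathbf X^{(n)},\mathbf Y^{(n)},\mathbf Z^{(n)})$; $\hat f$ is obtained by regressing $\mathbf X^{(n)}$ on $\mathbf Z^{(n)}$ and $\hat g$ by regressing $\mathbf Y^{(n)}$ on $\mathbf Z^{(n)}$. $A_f=\frac1n\sum_i(f_P(z_i)-\hat f(z_i))^2$, $A_g=\frac1n\sum_i(g_P(z_i)-\hat g(z_i))^2$, $B_f=\frac1n\sum_i(f_P(z_i)-\hat f(z_i))^2v_P(z_i)$, $B_g=\frac1n\sum_i(g_P(z_i)-\hat g(z_i))^2u_P(z_i)$. With $R_i^{(n)}=(x_i-\hat f(z_i))(y_i-\hat g(z_i))\hat w^{(n)}(z_i)$, the statistic is $T^{(n)}=\tau_N^{(n)}/\tau_D^{(n)}$, $\tau_N^{(n)}=\frac1{\sqrt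 n}\sum_iR_i^{(n)}$, $\tau_D^{(n)}=\big(\frac1n\sum_i(R_i^{(n)})^2-(\frac1n\sum_rR_r^{(n)})^2\big)^{1/2}$. $\Phi$ is the standard normal distribution function. For a family $\mathcal P$, $V_n=o_{\mathcal P}(W_n)$ means $\sup_{P\in\mathcal P}\mathbb P_P(|V_n/W_n|>\delta)\to0$ for all $\delta>0$; $o_P$ is the case $\mathcal P=\{P\}$. *)

theory Defs
  imports "HOL-Probability.Probability"
begin

text \<open>Observations (X,Y,Z) with Z in R^{d_Z}, modelled by a euclidean space type 'z.\<close>
type_synonym 'z obs = "real \<times> real \<times> 'z"

definition Xc :: "'z obs \<Rightarrow> real" where "Xc \<omega> = fst \<omega>"
definition Yc :: "'z obs \<Rightarrow> real" where "Yc \<omega> = fst (snd \<omega>)"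
definition Zc :: "'z obs \<Rightarrow> 'z" where "Zc \<omega> = snd (snd \<omega>)"

definition sigZ :: "('z::euclidean_space) obs measure \<Rightarrow> 'z obs measure" where
  "sigZ P = vimage_algebra (space P) Zc borel"

definition in_E0 :: "('z::euclidean_space) obs measure \<Rightarrow> bool" where
  "in_E0 P \<longleftrightarrow> prob_space P \<and> sets P = sets lborel \<and> absolutely_continuous lborel P"

definition in_P0 :: "('z::euclidean_space) obs measure \<Rightarrow> bool" where
  "in_P0 P \<longleftrightarrow> in_E0 P \<and>
     (\<forall>A\<in>sets (borel :: real measure). \<forall>B\<in>sets (borel :: real measure).
        AE \<omega> in P. real_cond_exp P (sigZ P) (\<lambda>\<omega>. indicator A (Xc \<omega>) * indicator B (Yc \<omega>)) \<omega>
                 = real_cond_exp P (sigZ P) (\<lambda>\<omega>. indicator A (Xc \<omega>)) \<omega>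
                   * real_cond_exp P (sigZ P) (\<lambda>\<omega>. indicator B (Yc \<omega>)) \<omega>)"

definition cond_mean_version :: "('z::euclidean_space) obs measure \<Rightarrow> ('z obs \<Rightarrow> real) \<Rightarrow> ('z \<Rightarrow> real) \<Rightarrow> bool" where
  "cond_mean_version P h \<phi> \<longleftrightarrow> integrable P h \<and> \<phi> \<in> borel_measurable borel \<and>
     (AE \<omega> in P. real_cond_exp P (sigZ P) h \<omega> = \<phi> (Zc \<omega>))"

definition cond_mean_version_nn :: "('z::euclidean_space) obs measure \<Rightarrow> ('z obs \<Rightarrow> ennreal) \<Rightarrow> ('z \<Rightarrow> ennreal) \<Rightarrow> bool" where
  "cond_mean_version_nn P h \<phi> \<longleftrightarrow> \<phi> \<in> borel_measurable borel \<and>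
     (AE \<omega> in P. nn_cond_exp P (sigZ P) h \<omega> = \<phi> (Zc \<omega>))"

definition sampleM :: "'z obs measure \<Rightarrow> nat \<Rightarrow> (nat \<Rightarrow> 'z obs) measure" where
  "sampleM P n = PiM {..<n} (\<lambda>_. P)"

definition XZdata :: "nat \<Rightarrow> (nat \<Rightarrow> 'z obs) \<Rightarrow> (nat \<Rightarrow> real \<times> 'z)" where
  "XZdata n \<omega> = (\<lambda>i\<in>{..<n}. (Xc (\<omega> i), Zc (\<omega> i)))"
definition YZdata :: "nat \<Rightarrow> (nat \<Rightarrow> 'z obs) \<Rightarrow> (nat \<Rightarrow> real \<times> 'z)" where
  "YZdata n \<omega> = (\<lambda>i\<in>{..<n}. (Yc (\<omega> i), Zc (\<omega> i)))"

text \<open>A regression procedure: for each n a map from data to the fitted function.\<close>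
type_synonym 'z regr = "nat \<Rightarrow> (nat \<Rightarrow> real \<times> 'z) \<Rightarrow> 'z \<Rightarrow> real"

definition regr_measurable :: "('z::euclidean_space) regr \<Rightarrow> bool" where
  "regr_measurable fh \<longleftrightarrow> (\<forall>n. (\<lambda>(d, z). fh n d z) \<in>
       borel_measurable (PiM {..<n} (\<lambda>_. (borel :: (real \<times> 'z) measure)) \<Otimes>\<^sub>M borel))"

definition Aerr :: "('z \<Rightarrow> real) \<Rightarrow> ('z \<Rightarrow> real) \<Rightarrow> nat \<Rightarrow> (nat \<Rightarrow> 'z obs) \<Rightarrow> real" where
  "Aerr f fhat n \<omega> = (\<Sum>i<n. (f (Zc (\<omega> i)) - fhat (Zc (\<omega> i)))\<^sup>2) / real n"

definition Berr :: "('z \<Rightarrow> real) \<Rightarrow> ('z \<Rightarrow> real) \<Rightarrow> ('z \<Rightarrow> ennreal) \<Rightarrow> nat \<Rightarrow> (nat \<Rightarrow> 'z obs) \<Rightarrow> ennreal" where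
  "Berr f fhat v n \<omega> = (\<Sum>i<n. ennreal ((f (Zc (\<omega> i)) - fhat (Zc (\<omega> i)))\<^sup>2) * v (Zc (\<omega> i))) / of_nat n"

definition Rres :: "'z regr \<Rightarrow> 'z regr \<Rightarrow> (nat \<Rightarrow> 'a \<Rightarrow> 'z \<Rightarrow> real) \<Rightarrow> nat
    \<Rightarrow> (nat \<Rightarrow> 'z obs) \<Rightarrow> 'a \<Rightarrow> nat \<Rightarrow> real" where
  "Rres fh gh w n \<omega> a i =
     (Xc (\<omega> i) - fh n (XZdata n \<omega>) (Zc (\<omega> i))) * (Yc (\<omega> i) - gh n (YZdata n \<omega>) (Zc (\<omega> i)))
       * w n a (Zc (\<omega> i))"

definition tauN :: "'z regr \<Rightarrow> 'z regr \<Rightarrow> (nat \<Rightarrow> 'a \<Rightarrow> 'z \<Rightarrow> real) \<Rightarrow> nat \<Rightarrow> (nat \<Rightarrow> 'z obs) \<Rightarrow> 'a \<Rightarrow> real" where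
  "tauN fh gh w n \<omega> a = (\<Sum>i<n. Rres fh gh w n \<omega> a i) / sqrt (real n)"

definition tauD :: "'z regr \<Rightarrow> 'z regr \<Rightarrow> (nat \<Rightarrow> 'a \<Rightarrow> 'z \<Rightarrow> real) \<Rightarrow> nat \<Rightarrow> (nat \<Rightarrow> 'z obs) \<Rightarrow> 'a \<Rightarrow> real" where
  "tauD fh gh w n \<omega> a = sqrt ((\<Sum>i<n. (Rres fh gh w n \<omega> a i)\<^sup>2) / real n
                              - ((\<Sum>r<n. Rres fh gh w n \<omega> a r) / real n)\<^sup>2)"

definition Tstat :: "'z regr \<Rightarrow> 'z regr \<Rightarrow> (nat \<Rightarrow> 'a \<Rightarrow> 'z \<Rightarrow> real) \<Rightarrow> nat \<Rightarrow> (nat \<Rightarrow> 'z obs) \<Rightarrow> 'a \<Rightarrow> real" where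
  "Tstat fh gh w n \<omega> a = tauN fh gh w n \<omega> a / tauD fh gh w n \<omega> a"

text \<open>P_P(T^(n) <= t), where the probability is over the sample and the independent data set A ~ Q.\<close>
definition probT :: "'z obs measure \<Rightarrow> 'a measure \<Rightarrow> 'z regr \<Rightarrow> 'z regr \<Rightarrow> (nat \<Rightarrow> 'a \<Rightarrow> 'z \<Rightarrow> real)
    \<Rightarrow> nat \<Rightarrow> real \<Rightarrow> real" where
  "probT P Q fh gh w n t = measure (sampleM P n \<Otimes>\<^sub>M Q)
     {(\<omega>, a) \<in> space (sampleM P n \<Otimes>\<^sub>M Q). Tstat fh gh w n \<omega> a \<le> t}"

text \<open>sigma_bar_n^2 = E_P[w^(n)(Z)^2 eps_P^2 xi_P^2 | A], as a function of the realisation a of A.\<close>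
definition sigma_bar2 :: "'z obs measure \<Rightarrow> ('z \<Rightarrow> real) \<Rightarrow> ('z \<Rightarrow> real) \<Rightarrow> (nat \<Rightarrow> 'a \<Rightarrow> 'z \<Rightarrow> real)
    \<Rightarrow> nat \<Rightarrow> 'a \<Rightarrow> ennreal" where
  "sigma_bar2 P f g w n a = (\<integral>\<^sup>+ \<omega>. ennreal ((w n a (Zc \<omega>))\<^sup>2 * (Xc \<omega> - f (Zc \<omega>))\<^sup>2 * (Yc \<omega> - g (Zc \<omega>))\<^sup>2) \<partial>P)"

definition moment_epsxi :: "'z obs measure \<Rightarrow> ('z \<Rightarrow> real) \<Rightarrow> ('z \<Rightarrow> real) \<Rightarrow> real \<Rightarrow> ennreal" where
  "moment_epsxi P f g \<eta> = (\<integral>\<^sup>+ \<omega>. ennreal (\<bar>(Xc \<omega> - f (Zc \<omega>)) * (Yc \<omega> - g (Zc \<omega>))\<bar> powr (2 + \<eta>)) \<partial>P)"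

definition Phi :: "real \<Rightarrow> real" where
  "Phi t = measure (density lborel std_normal_density) {..t}"

end

theory Submission
  imports Defs
begin

text \<open>With \<open>\<epsilon> = X - f(Z)\<close>, \<open>\<xi> = Y - g(Z)\<close> and the regression errors \<open>a = f - f_hat\<close>, \<open>b = g - g_hat\<close>, the products split as
  \<open>R = w \<epsilon> \<xi> + w a b + w b \<epsilon> + w a \<xi>\<close>. For a fixed realisation of the auxiliary data the first term is an i.i.d. sum, and a central
  limit theorem that is uniform over all laws with bounded moments of order \<open>2 + \<eta>\<close> applies after
  rescaling \<open>w\<close> to unit variance, which does not change the statistic. The second is controlled by Cauchy-Schwarz and
  \<open>A_f A_g = o(1/n)\<close>. By conditional independence \<open>\<xi>\<close> has conditional mean 0 and
  conditional variance \<open>v(Z)\<close> given \<open>(X, Z)\<close>, so that a conditional Chebyshev inequality on the event \<open>B_f \<le> \<delta>\<close>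
  controls the last term, and symmetrically the third. All bounds are uniform in the auxiliary data, which are integrated out at the end;
  the realisations with small \<open>\<sigma>\<close> only contribute their probability.\<close>

section \<open>Conditional independence and residuals\<close>

text \<open>The moment assumption concerns only the product \<epsilon>\<xi>: neither residual is
  assumed square integrable, and \<open>u\<close> and \<open>v\<close> may take the value infinity.
  Conditional variances are therefore handled by integrals in \<open>ennreal\<close>, and signed
  products are integrated only where the product itself is integrable. A second obstacle is that
  f_hat is evaluated on the sample on which it was fitted. The weight of the i-th \<xi> depends on
  all pairs (X_j, Z_j), including j = i, so centring given Z alone is too weak. Conditional
  independence, given for indicators only, has to be extended to arbitrary functions of (X, Z) and
  of (Y, Z). Both halves of the theorem rest on one estimate whose sample size and error level
  depend only on \<eta>, the moment bound, the weight bound \<open>C\<close>, the variance bound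
  \<open>c\<close> and \<epsilon>, not on the law, the regressions or the weight. The uniform half
  has one \<open>c\<close> for all laws. The pointwise half has a \<open>c\<close> that varies with
  the auxiliary data; it is replaced by 1/(k+1) outside a set of small probability.\<close>

lemma finite_measure_eqI_rectangles:
  assumes sets: "sets M = sets (A \<Otimes>\<^sub>M B)" "sets N = sets (A \<Otimes>\<^sub>M B)"
    and fin: "emeasure M (space M) \<noteq> \<infinity>"
    and eq: "\<And>a b. a \<in> sets A \<Longrightarrow> b \<in> sets B \<Longrightarrow> emeasure M (a \<times> b) = emeasure N (a \<times> b)"
  shows "M = N"
proof (rule measure_eqI_generator_eq[OF Int_stable_pair_measure_generator[of A B]])
  show "{a \<times> b |a b. a \<in> sets A \<and> b \<in> sets B} \<subseteq> Pow (space A \<times> space B)"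
    using sets.space_closed[of A] sets.space_closed[of B] by auto
  show "range (\<lambda>_::nat. space A \<times> space B) \<subseteq> {a \<times> b |a b. a \<in> sets A \<and> b \<in> sets B}"
    by auto
  have "space M = space A \<times> space B"
    using sets_eq_imp_space_eq[OF sets(1)] by (simp add: space_pair_measure)
  then show "emeasure M (space A \<times> space B) \<noteq> \<infinity>" for i :: nat using fin by simp
  show "sets M = sigma_sets (space A \<times> space B) {a \<times> b |a b. a \<in> sets A \<and> b \<in> sets B}"
    "sets N = sigma_sets (space A \<times> space B) {a \<times> b |a b. a \<in> sets A \<and> b \<in> sets B}"
    unfolding sets by (rule sets_pair_measure)+
qed (use eq in blast, rule UN_constant_eq, auto)

text \<open>\<open>X\<close> and \<open>Y\<close> are kept abstract rather than tied to the
  coordinates, so that every result can be applied again with the two exchanged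
  (\<open>cond_indep_given_commute\<close>). The terms carrying \<epsilon> and \<xi> are then
  covered by the same lemmas.\<close>

locale cond_indep_given = prob_space M for M :: "'a measure" +
  fixes X Y :: "'a \<Rightarrow> real" and Z :: "'a \<Rightarrow> 'z::euclidean_space" and F :: "'a measure"
  assumes X [measurable]: "X \<in> borel_measurable M"
    and Y [measurable]: "Y \<in> borel_measurable M"
    and Z [measurable]: "Z \<in> borel_measurable M"
    and F_def: "F = vimage_algebra (space M) Z borel"
    and cond_indep: "\<And>A B. A \<in> sets borel \<Longrightarrow> B \<in> sets borel \<Longrightarrow>
        AE \<omega> in M. real_cond_exp M F (\<lambda>\<omega>. indicator A (X \<omega>) * indicator B (Y \<omega>)) \<omega>
          = real_cond_exp M F (\<lambda>\<omega>. indicator A (X \<omega>)) \<omega> * real_cond_exp M F (\<lambda>\<omega>. indicator B (Y \<omega>)) \<omega>"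
begin

lemma subalgebra_F: "subalgebra M F"
proof -
  have "sets (vimage_algebra (space M) Z borel) \<subseteq> sets M"
    by (rule measurable_iff_sets[THEN iffD1, OF Z, THEN conjunct2])
  then show ?thesis unfolding F_def subalgebra_def by simp
qed

sublocale finite_measure_subalgebra M F
  by unfold_locales (rule subalgebra_F)

lemma Z_measurable_F [measurable]: "Z \<in> borel_measurable F"
  unfolding F_def by (rule measurable_vimage_algebra1) auto

text \<open>\<open>real_cond_exp\<close> is a difference of two \<open>enn2real\<close> values. For
  a function with values in [0,1] the negative part vanishes and the conditional expectation is at
  most 1, so the passage through \<open>enn2real\<close> loses nothing.\<close>

lemma nn_cond_exp_eq_real:
  assumes [measurable]: "h \<in> borel_measurable M" and h: "\<And>\<omega>. 0 \<le> h \<omega>" "\<And>\<omega>. h \<omega> \<le> 1"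
  shows "AE \<omega> in M. nn_cond_exp M F (\<lambda>\<omega>. ennreal (h \<omega>)) \<omega> = ennreal (real_cond_exp M F h \<omega>)"
proof -
  have 1: "AE \<omega> in M. nn_cond_exp M F (\<lambda>\<omega>. ennreal (h \<omega>)) \<omega> \<le> nn_cond_exp M F (\<lambda>_. 1) \<omega>"
    by (rule nn_cond_exp_mono) (use h in \<open>auto simp: ennreal_le_1\<close>)
  have 2: "AE \<omega> in M. 1 = nn_cond_exp M F (\<lambda>_. 1) \<omega>" by (rule nn_cond_exp_F_meas) auto
  have 3: "AE \<omega> in M. 0 = nn_cond_exp M F (\<lambda>_. 0) \<omega>" by (rule nn_cond_exp_F_meas) auto
  have z: "(\<lambda>\<omega>. ennreal (- h \<omega>)) = (\<lambda>_. 0)" using h by (auto simp: ennreal_neg)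
  show ?thesis unfolding real_cond_exp_def z
    using 1 2 3
  proof eventually_elim
    case (elim \<omega>)
    then have "nn_cond_exp M F (\<lambda>\<omega>. ennreal (h \<omega>)) \<omega> \<le> 1" by simp
    then have "nn_cond_exp M F (\<lambda>\<omega>. ennreal (h \<omega>)) \<omega> < top"
      using ennreal_one_less_top by (rule le_less_trans)
    then show ?case by (simp add: elim(3)[symmetric])
  qed
qed

lemma nn_cond_indep:
  assumes [measurable]: "A \<in> sets borel" "B \<in> sets borel"
  shows "AE \<omega> in M. nn_cond_exp M F (\<lambda>\<omega>. indicator A (X \<omega>) * indicator B (Y \<omega>)) \<omega>
     = nn_cond_exp M F (\<lambda>\<omega>. indicator A (X \<omega>)) \<omega> * nn_cond_exp M F (\<lambda>\<omega>. indicator B (Y \<omega>)) \<omega>"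
proof -
  have e: "(\<lambda>\<omega>. indicator A (X \<omega>) * indicator B (Y \<omega>) :: ennreal) = (\<lambda>\<omega>. ennreal (indicator A (X \<omega>) * indicator B (Y \<omega>)))"
    "(\<lambda>\<omega>. indicator A (X \<omega>) :: ennreal) = (\<lambda>\<omega>. ennreal (indicator A (X \<omega>)))"
    "(\<lambda>\<omega>. indicator B (Y \<omega>) :: ennreal) = (\<lambda>\<omega>. ennreal (indicator B (Y \<omega>)))"
    by (auto simp: indicator_def)
  have p: "AE \<omega> in M. 0 \<le> real_cond_exp M F (\<lambda>\<omega>. indicator A (X \<omega>)) \<omega>"
    by (rule real_cond_exp_pos) auto
  have "AE \<omega> in M. nn_cond_exp M F (\<lambda>\<omega>. ennreal (indicator A (X \<omega>) * indicator B (Y \<omega>))) \<omega>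
      = ennreal (real_cond_exp M F (\<lambda>\<omega>. indicator A (X \<omega>) * indicator B (Y \<omega>)) \<omega>)"
    by (rule nn_cond_exp_eq_real) (auto simp: indicator_def)
  moreover have "AE \<omega> in M. nn_cond_exp M F (\<lambda>\<omega>. ennreal (indicator A (X \<omega>))) \<omega>
      = ennreal (real_cond_exp M F (\<lambda>\<omega>. indicator A (X \<omega>)) \<omega>)"
    by (rule nn_cond_exp_eq_real) (auto simp: indicator_def)
  moreover have "AE \<omega> in M. nn_cond_exp M F (\<lambda>\<omega>. ennreal (indicator B (Y \<omega>))) \<omega>
      = ennreal (real_cond_exp M F (\<lambda>\<omega>. indicator B (Y \<omega>)) \<omega>)"
    by (rule nn_cond_exp_eq_real) (auto simp: indicator_def)
  ultimately show ?thesis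
    unfolding e using cond_indep[OF assms] p
    by eventually_elim (simp add: ennreal_mult')
qed

text \<open>Both sides are measures in \<open>G\<close> and the left one is finite, so rectangles
  suffice; there the assumed factorisation applies once the Z-measurable factors are moved through
  the conditional expectations. In effect the conditional law of Y given (X, Z) depends on Z alone.
  The indicator of \<open>D\<close> prepares rectangles in (Y, Z) for the next extension.\<close>

lemma nn_integral_XZ_indicator_Y:
  assumes G [measurable]: "G \<in> sets (borel \<Otimes>\<^sub>M borel)" and [measurable]: "B \<in> sets borel" "D \<in> sets borel"
  shows "(\<integral>\<^sup>+\<omega>. indicator G (X \<omega>, Z \<omega>) * (indicator B (Y \<omega>) * indicator D (Z \<omega>)) \<partial>M)
       = (\<integral>\<^sup>+\<omega>. indicator G (X \<omega>, Z \<omega>) * (nn_cond_exp M F (\<lambda>\<omega>. indicator B (Y \<omega>)) \<omega> * indicator D (Z \<omega>)) \<partial>M)"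
proof -
  let ?pB = "nn_cond_exp M F (\<lambda>\<omega>. indicator B (Y \<omega>))"
  define \<mu>1 where "\<mu>1 = distr (density M (\<lambda>\<omega>. indicator B (Y \<omega>) * indicator D (Z \<omega>))) (borel \<Otimes>\<^sub>M borel) (\<lambda>\<omega>. (X \<omega>, Z \<omega>))"
  define \<mu>2 where "\<mu>2 = distr (density M (\<lambda>\<omega>. ?pB \<omega> * indicator D (Z \<omega>))) (borel \<Otimes>\<^sub>M borel) (\<lambda>\<omega>. (X \<omega>, Z \<omega>))"
  have mu1: "emeasure \<mu>1 H = (\<integral>\<^sup>+\<omega>. indicator H (X \<omega>, Z \<omega>) * (indicator B (Y \<omega>) * indicator D (Z \<omega>)) \<partial>M)"
    if [measurable]: "H \<in> sets (borel \<Otimes>\<^sub>M borel)" for H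
  proof -
    have "emeasure \<mu>1 H = (\<integral>\<^sup>+ x. indicator H x \<partial>\<mu>1)" using that by (simp add: \<mu>1_def)
    also have "\<dots> = (\<integral>\<^sup>+\<omega>. indicator H (X \<omega>, Z \<omega>) * (indicator B (Y \<omega>) * indicator D (Z \<omega>)) \<partial>M)"
      unfolding \<mu>1_def by (subst nn_integral_distr) (auto simp: nn_integral_density mult_ac)
    finally show ?thesis .
  qed
  have mu2: "emeasure \<mu>2 H = (\<integral>\<^sup>+\<omega>. indicator H (X \<omega>, Z \<omega>) * (?pB \<omega> * indicator D (Z \<omega>)) \<partial>M)"
    if [measurable]: "H \<in> sets (borel \<Otimes>\<^sub>M borel)" for H
  proof -
    have "emeasure \<mu>2 H = (\<integral>\<^sup>+ x. indicator H x \<partial>\<mu>2)" using that by (simp add: \<mu>2_def)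
    also have "\<dots> = (\<integral>\<^sup>+\<omega>. indicator H (X \<omega>, Z \<omega>) * (?pB \<omega> * indicator D (Z \<omega>)) \<partial>M)"
      unfolding \<mu>2_def by (subst nn_integral_distr) (auto simp: nn_integral_density mult_ac)
    finally show ?thesis .
  qed
  have "\<mu>1 = \<mu>2"
  proof (rule finite_measure_eqI_rectangles)
    show "sets \<mu>1 = sets (borel \<Otimes>\<^sub>M borel)" "sets \<mu>2 = sets (borel \<Otimes>\<^sub>M borel)"
      by (simp_all add: \<mu>1_def \<mu>2_def)
    have "space \<mu>1 \<in> sets (borel \<Otimes>\<^sub>M borel)" by (simp add: \<mu>1_def)
    then have "emeasure \<mu>1 (space \<mu>1) \<le> (\<integral>\<^sup>+\<omega>. 1 \<partial>M)"
      by (subst mu1) (auto intro!: nn_integral_mono simp: indicator_def simp del: nn_integral_const)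
    then show "emeasure \<mu>1 (space \<mu>1) \<noteq> \<infinity>" by (auto simp: emeasure_space_1 top_unique)
    fix A :: "real set" and E :: "'z set" assume [measurable]: "A \<in> sets borel" "E \<in> sets borel"
    have "emeasure \<mu>1 (A \<times> E) = (\<integral>\<^sup>+\<omega>. indicator (E \<inter> D) (Z \<omega>) * (indicator A (X \<omega>) * indicator B (Y \<omega>)) \<partial>M)"
      by (subst mu1) (auto intro!: nn_integral_cong simp: indicator_def)
    also have "\<dots> = (\<integral>\<^sup>+\<omega>. indicator (E \<inter> D) (Z \<omega>) * nn_cond_exp M F (\<lambda>\<omega>. indicator A (X \<omega>) * indicator B (Y \<omega>)) \<omega> \<partial>M)"
      by (rule nn_cond_exp_intg[symmetric]) auto
    also have "\<dots> = (\<integral>\<^sup>+\<omega>. indicator (E \<inter> D) (Z \<omega>) * (nn_cond_exp M F (\<lambda>\<omega>. indicator A (X \<omega>)) \<omega> * ?pB \<omega>) \<partial>M)"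
      by (rule nn_integral_cong_AE) (use nn_cond_indep[of A B] in auto)
    also have "\<dots> = (\<integral>\<^sup>+\<omega>. (indicator (E \<inter> D) (Z \<omega>) * ?pB \<omega>) * nn_cond_exp M F (\<lambda>\<omega>. indicator A (X \<omega>)) \<omega> \<partial>M)"
      by (simp add: mult_ac)
    also have "\<dots> = (\<integral>\<^sup>+\<omega>. (indicator (E \<inter> D) (Z \<omega>) * ?pB \<omega>) * indicator A (X \<omega>) \<partial>M)"
      by (rule nn_cond_exp_intg) auto
    also have "\<dots> = emeasure \<mu>2 (A \<times> E)"
      by (subst mu2) (auto intro!: nn_integral_cong simp: indicator_def)
    finally show "emeasure \<mu>1 (A \<times> E) = emeasure \<mu>2 (A \<times> E)" .
  qed
  then show ?thesis using mu1[OF G] mu2[OF G] by simp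
qed

text \<open>Now \<open>G\<close> is frozen and the set in (Y, Z) varies: \<open>indicator G\<close>
  and its conditional expectation, used as densities, induce the same measure, as rectangles show.
  Equality of measures admits every nonnegative \<open>W\<close>, and the defining property of
  conditional expectation, used twice, moves the conditioning from \<open>G\<close> to
  \<open>W\<close>.\<close>

lemma nn_integral_indicator_XZ:
  assumes G [measurable]: "G \<in> sets (borel \<Otimes>\<^sub>M borel)" and W [measurable]: "W \<in> borel_measurable (borel \<Otimes>\<^sub>M borel)"
  shows "(\<integral>\<^sup>+\<omega>. indicator G (X \<omega>, Z \<omega>) * W (Y \<omega>, Z \<omega>) \<partial>M)
       = (\<integral>\<^sup>+\<omega>. indicator G (X \<omega>, Z \<omega>) * nn_cond_exp M F (\<lambda>\<omega>. W (Y \<omega>, Z \<omega>)) \<omega> \<partial>M)"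
proof -
  let ?pG = "nn_cond_exp M F (\<lambda>\<omega>. indicator G (X \<omega>, Z \<omega>))"
  define \<mu>1 where "\<mu>1 = distr (density M (\<lambda>\<omega>. indicator G (X \<omega>, Z \<omega>))) (borel \<Otimes>\<^sub>M borel) (\<lambda>\<omega>. (Y \<omega>, Z \<omega>))"
  define \<mu>2 where "\<mu>2 = distr (density M ?pG) (borel \<Otimes>\<^sub>M borel) (\<lambda>\<omega>. (Y \<omega>, Z \<omega>))"
  have mu1: "(\<integral>\<^sup>+x. h x \<partial>\<mu>1) = (\<integral>\<^sup>+\<omega>. indicator G (X \<omega>, Z \<omega>) * h (Y \<omega>, Z \<omega>) \<partial>M)"
    if [measurable]: "h \<in> borel_measurable (borel \<Otimes>\<^sub>M borel)" for h
    unfolding \<mu>1_def by (subst nn_integral_distr) (auto simp: nn_integral_density)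
  have mu2: "(\<integral>\<^sup>+x. h x \<partial>\<mu>2) = (\<integral>\<^sup>+\<omega>. ?pG \<omega> * h (Y \<omega>, Z \<omega>) \<partial>M)"
    if [measurable]: "h \<in> borel_measurable (borel \<Otimes>\<^sub>M borel)" for h
    unfolding \<mu>2_def by (subst nn_integral_distr) (auto simp: nn_integral_density)
  have "\<mu>1 = \<mu>2"
  proof (rule finite_measure_eqI_rectangles)
    show s: "sets \<mu>1 = sets (borel \<Otimes>\<^sub>M borel)" "sets \<mu>2 = sets (borel \<Otimes>\<^sub>M borel)"
      by (simp_all add: \<mu>1_def \<mu>2_def)
    have "emeasure \<mu>1 (space \<mu>1) = (\<integral>\<^sup>+x. 1 \<partial>\<mu>1)" by simp
    also have "\<dots> \<le> (\<integral>\<^sup>+\<omega>. 1 \<partial>M)"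
      by (subst mu1) (auto intro!: nn_integral_mono simp: indicator_def simp del: nn_integral_const)
    finally show "emeasure \<mu>1 (space \<mu>1) \<noteq> \<infinity>" by (auto simp: emeasure_space_1 top_unique)
    fix B :: "real set" and D :: "'z set" assume [measurable]: "B \<in> sets borel" "D \<in> sets borel"
    let ?pB = "nn_cond_exp M F (\<lambda>\<omega>. indicator B (Y \<omega>))"
    have "emeasure \<mu>1 (B \<times> D) = (\<integral>\<^sup>+x. indicator (B \<times> D) x \<partial>\<mu>1)"
      by (rule nn_integral_indicator[symmetric]) (simp add: s)
    also have "\<dots> = (\<integral>\<^sup>+\<omega>. indicator G (X \<omega>, Z \<omega>) * (indicator B (Y \<omega>) * indicator D (Z \<omega>)) \<partial>M)"
      by (subst mu1) (auto simp: indicator_times)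
    also have "\<dots> = (\<integral>\<^sup>+\<omega>. (?pB \<omega> * indicator D (Z \<omega>)) * indicator G (X \<omega>, Z \<omega>) \<partial>M)"
      by (subst nn_integral_XZ_indicator_Y) (auto simp: mult_ac)
    also have "\<dots> = (\<integral>\<^sup>+\<omega>. (?pB \<omega> * indicator D (Z \<omega>)) * ?pG \<omega> \<partial>M)"
      by (rule nn_cond_exp_intg[symmetric]) auto
    also have "\<dots> = (\<integral>\<^sup>+\<omega>. (?pG \<omega> * indicator D (Z \<omega>)) * ?pB \<omega> \<partial>M)"
      by (simp add: mult_ac)
    also have "\<dots> = (\<integral>\<^sup>+\<omega>. (?pG \<omega> * indicator D (Z \<omega>)) * indicator B (Y \<omega>) \<partial>M)"
      by (rule nn_cond_exp_intg) auto
    also have "\<dots> = (\<integral>\<^sup>+x. indicator (B \<times> D) x \<partial>\<mu>2)"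
      by (subst mu2) (auto simp: indicator_times mult_ac)
    also have "\<dots> = emeasure \<mu>2 (B \<times> D)"
      by (rule nn_integral_indicator) (simp add: s)
    finally show "emeasure \<mu>1 (B \<times> D) = emeasure \<mu>2 (B \<times> D)" .
  qed
  then have "(\<integral>\<^sup>+\<omega>. indicator G (X \<omega>, Z \<omega>) * W (Y \<omega>, Z \<omega>) \<partial>M) = (\<integral>\<^sup>+\<omega>. ?pG \<omega> * W (Y \<omega>, Z \<omega>) \<partial>M)"
    using mu1[OF W] mu2[OF W] by simp
  also have "\<dots> = (\<integral>\<^sup>+\<omega>. ?pG \<omega> * nn_cond_exp M F (\<lambda>\<omega>. W (Y \<omega>, Z \<omega>)) \<omega> \<partial>M)"
    by (rule nn_cond_exp_intg[symmetric]) auto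
  also have "\<dots> = (\<integral>\<^sup>+\<omega>. nn_cond_exp M F (\<lambda>\<omega>. W (Y \<omega>, Z \<omega>)) \<omega> * ?pG \<omega> \<partial>M)"
    by (simp add: mult_ac)
  also have "\<dots> = (\<integral>\<^sup>+\<omega>. nn_cond_exp M F (\<lambda>\<omega>. W (Y \<omega>, Z \<omega>)) \<omega> * indicator G (X \<omega>, Z \<omega>) \<partial>M)"
    by (rule nn_cond_exp_intg) auto
  finally show ?thesis by (simp add: mult_ac)
qed

text \<open>For fixed \<open>W\<close> the previous lemma gives agreement on every measurable
  \<open>G\<close>, so the two measures are compared set by set and may have infinite mass. This
  order of extension admits squared residuals as \<open>W\<close> without a second moment.\<close>

lemma nn_integral_cond_indep:
  assumes k [measurable]: "k \<in> borel_measurable (borel \<Otimes>\<^sub>M borel)" and W [measurable]: "W \<in> borel_measurable (borel \<Otimes>\<^sub>M borel)"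
  shows "(\<integral>\<^sup>+\<omega>. k (X \<omega>, Z \<omega>) * W (Y \<omega>, Z \<omega>) \<partial>M)
       = (\<integral>\<^sup>+\<omega>. k (X \<omega>, Z \<omega>) * nn_cond_exp M F (\<lambda>\<omega>. W (Y \<omega>, Z \<omega>)) \<omega> \<partial>M)"
proof -
  let ?pW = "nn_cond_exp M F (\<lambda>\<omega>. W (Y \<omega>, Z \<omega>))"
  define \<mu>1 where "\<mu>1 = distr (density M (\<lambda>\<omega>. W (Y \<omega>, Z \<omega>))) (borel \<Otimes>\<^sub>M borel) (\<lambda>\<omega>. (X \<omega>, Z \<omega>))"
  define \<mu>2 where "\<mu>2 = distr (density M ?pW) (borel \<Otimes>\<^sub>M borel) (\<lambda>\<omega>. (X \<omega>, Z \<omega>))"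
  have mu1: "(\<integral>\<^sup>+x. h x \<partial>\<mu>1) = (\<integral>\<^sup>+\<omega>. h (X \<omega>, Z \<omega>) * W (Y \<omega>, Z \<omega>) \<partial>M)"
    if [measurable]: "h \<in> borel_measurable (borel \<Otimes>\<^sub>M borel)" for h
    unfolding \<mu>1_def by (subst nn_integral_distr) (auto simp: nn_integral_density mult_ac)
  have mu2: "(\<integral>\<^sup>+x. h x \<partial>\<mu>2) = (\<integral>\<^sup>+\<omega>. h (X \<omega>, Z \<omega>) * ?pW \<omega> \<partial>M)"
    if [measurable]: "h \<in> borel_measurable (borel \<Otimes>\<^sub>M borel)" for h
    unfolding \<mu>2_def by (subst nn_integral_distr) (auto simp: nn_integral_density mult_ac)
  have "\<mu>1 = \<mu>2"
  proof (rule measure_eqI)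
    show s: "sets \<mu>1 = sets \<mu>2" by (simp_all add: \<mu>1_def \<mu>2_def)
    fix G assume "G \<in> sets \<mu>1"
    then have G [measurable]: "G \<in> sets (borel \<Otimes>\<^sub>M borel)" by (simp add: \<mu>1_def)
    have "emeasure \<mu>1 G = (\<integral>\<^sup>+x. indicator G x \<partial>\<mu>1)"
      by (rule nn_integral_indicator[symmetric]) (simp add: \<mu>1_def)
    also have "\<dots> = (\<integral>\<^sup>+x. indicator G x \<partial>\<mu>2)"
      by (subst mu1, simp, subst mu2, simp) (rule nn_integral_indicator_XZ[OF G W])
    also have "\<dots> = emeasure \<mu>2 G"
      by (rule nn_integral_indicator) (simp add: \<mu>2_def)
    finally show "emeasure \<mu>1 G = emeasure \<mu>2 G" .
  qed
  then show ?thesis using mu1[OF k] mu2[OF k] by simp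
qed

text \<open>The positive and negative parts of \<xi> have the same conditional expectation given Z.
  By conditional independence they then have the same integral against every nonnegative weight in
  (X, Z).\<close>

lemma integral_residual_eq_0:
  fixes k :: "real \<times> 'z \<Rightarrow> real" and g :: "'z \<Rightarrow> real"
  assumes k [measurable]: "k \<in> borel_measurable (borel \<Otimes>\<^sub>M borel)"
    and [measurable]: "g \<in> borel_measurable borel"
    and Yint: "integrable M Y"
    and g: "AE \<omega> in M. real_cond_exp M F Y \<omega> = g (Z \<omega>)"
    and int: "integrable M (\<lambda>\<omega>. k (X \<omega>, Z \<omega>) * (Y \<omega> - g (Z \<omega>)))"
  shows "(\<integral>\<omega>. k (X \<omega>, Z \<omega>) * (Y \<omega> - g (Z \<omega>)) \<partial>M) = 0"
proof -
  define \<xi> where "\<xi> \<omega> = Y \<omega> - g (Z \<omega>)" for \<omega>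
  have [measurable]: "\<xi> \<in> borel_measurable M" by (simp add: \<xi>_def[abs_def])
  have gint: "integrable M (\<lambda>\<omega>. g (Z \<omega>))"
    using real_cond_exp_int(1)[OF Yint] g by (subst integrable_cong_AE[of _ M "real_cond_exp M F Y"]) auto
  have \<xi>int: "integrable M \<xi>" unfolding \<xi>_def[abs_def] using Yint gint by simp
  have "AE \<omega> in M. real_cond_exp M F (\<lambda>\<omega>. Y \<omega> - g (Z \<omega>)) \<omega> = real_cond_exp M F Y \<omega> - real_cond_exp M F (\<lambda>\<omega>. g (Z \<omega>)) \<omega>"
    by (rule real_cond_exp_diff[OF Yint gint])
  moreover have "AE \<omega> in M. real_cond_exp M F (\<lambda>\<omega>. g (Z \<omega>)) \<omega> = g (Z \<omega>)"
    by (rule real_cond_exp_F_meas[OF gint]) simp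
  ultimately have zero: "AE \<omega> in M. real_cond_exp M F \<xi> \<omega> = 0"
    using g unfolding \<xi>_def[abs_def] by eventually_elim simp
  \<comment> \<open>Finiteness matters because \<open>enn2real\<close> sends infinity to 0: only for
    finite values does a vanishing real conditional expectation force both parts to agree.\<close>
  have fin: "AE \<omega> in M. nn_cond_exp M F (\<lambda>\<omega>. ennreal (h \<omega>)) \<omega> \<noteq> \<infinity>" if h: "integrable M h" for h
  proof -
    have [measurable]: "h \<in> borel_measurable M" using h by simp
    have "(\<integral>\<^sup>+\<omega>. nn_cond_exp M F (\<lambda>\<omega>. ennreal (h \<omega>)) \<omega> \<partial>M) = (\<integral>\<^sup>+\<omega>. 1 * nn_cond_exp M F (\<lambda>\<omega>. ennreal (h \<omega>)) \<omega> \<partial>M)" by simp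
    also have "\<dots> = (\<integral>\<^sup>+\<omega>. 1 * ennreal (h \<omega>) \<partial>M)" by (rule nn_cond_exp_intg) auto
    also have "\<dots> \<le> (\<integral>\<^sup>+\<omega>. ennreal (norm (h \<omega>)) \<partial>M)" by (intro nn_integral_mono) (simp add: ennreal_leI)
    also have "\<dots> < \<infinity>" using h by (simp add: integrable_iff_bounded)
    finally show ?thesis by (intro nn_integral_PInf_AE) auto
  qed
  have eq: "AE \<omega> in M. nn_cond_exp M F (\<lambda>\<omega>. ennreal (\<xi> \<omega>)) \<omega> = nn_cond_exp M F (\<lambda>\<omega>. ennreal (- \<xi> \<omega>)) \<omega>"
    using zero fin[OF \<xi>int] fin[OF integrable_minus[OF \<xi>int]]
  proof eventually_elim
    case (elim \<omega>)
    let ?p = "nn_cond_exp M F (\<lambda>\<omega>. ennreal (\<xi> \<omega>)) \<omega>" and ?m = "nn_cond_exp M F (\<lambda>\<omega>. ennreal (- \<xi> \<omega>)) \<omega>"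
    have e: "enn2real ?p = enn2real ?m" using elim(1) unfolding real_cond_exp_def by simp
    have "?p = ennreal (enn2real ?p)" using elim(2) by (simp add: less_top)
    also have "\<dots> = ennreal (enn2real ?m)" by (simp only: e)
    also have "\<dots> = ?m" using elim(3) by (simp add: less_top)
    finally show ?case .
  qed
  have nn: "(\<integral>\<^sup>+\<omega>. ennreal (h (X \<omega>, Z \<omega>)) * ennreal (\<xi> \<omega>) \<partial>M) = (\<integral>\<^sup>+\<omega>. ennreal (h (X \<omega>, Z \<omega>)) * ennreal (- \<xi> \<omega>) \<partial>M)"
    if [measurable]: "h \<in> borel_measurable (borel \<Otimes>\<^sub>M borel)" for h :: "real \<times> 'z \<Rightarrow> real"
  proof -
    have "(\<integral>\<^sup>+\<omega>. ennreal (h (X \<omega>, Z \<omega>)) * ennreal (\<xi> \<omega>) \<partial>M)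
       = (\<integral>\<^sup>+\<omega>. ennreal (h (X \<omega>, Z \<omega>)) * nn_cond_exp M F (\<lambda>\<omega>. ennreal (\<xi> \<omega>)) \<omega> \<partial>M)"
      using nn_integral_cond_indep[of "\<lambda>p. ennreal (h p)" "\<lambda>p. ennreal (fst p - g (snd p))"] by (simp add: \<xi>_def)
    also have "\<dots> = (\<integral>\<^sup>+\<omega>. ennreal (h (X \<omega>, Z \<omega>)) * nn_cond_exp M F (\<lambda>\<omega>. ennreal (- \<xi> \<omega>)) \<omega> \<partial>M)"
      by (rule nn_integral_cong_AE) (use eq in auto)
    also have "\<dots> = (\<integral>\<^sup>+\<omega>. ennreal (h (X \<omega>, Z \<omega>)) * ennreal (- \<xi> \<omega>) \<partial>M)"
      using nn_integral_cond_indep[of "\<lambda>p. ennreal (h p)" "\<lambda>p. ennreal (- (fst p - g (snd p)))"] by (simp add: \<xi>_def)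
    finally show ?thesis .
  qed
  \<comment> \<open>Only the product of \<open>k\<close> with \<xi> is known to be integrable. The
    positive and negative parts of \<open>k\<close> are dominated by its absolute value, so each
    inherits integrability of the product.\<close>
  have part: "integrable M (\<lambda>\<omega>. h (X \<omega>, Z \<omega>) * \<xi> \<omega>)" "(\<integral>\<omega>. h (X \<omega>, Z \<omega>) * \<xi> \<omega> \<partial>M) = 0"
    if [measurable]: "h \<in> borel_measurable (borel \<Otimes>\<^sub>M borel)" and h: "\<And>p. 0 \<le> h p" "\<And>p. h p \<le> \<bar>k p\<bar>" for h :: "real \<times> 'z \<Rightarrow> real"
  proof -
    show i: "integrable M (\<lambda>\<omega>. h (X \<omega>, Z \<omega>) * \<xi> \<omega>)"
      by (rule Bochner_Integration.integrable_bound[OF int])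
         (auto simp: abs_mult \<xi>_def[symmetric] h intro!: mult_right_mono)
    show "(\<integral>\<omega>. h (X \<omega>, Z \<omega>) * \<xi> \<omega> \<partial>M) = 0"
    proof -
      have "(\<integral>\<^sup>+\<omega>. ennreal (h (X \<omega>, Z \<omega>) * \<xi> \<omega>) \<partial>M) = (\<integral>\<^sup>+\<omega>. ennreal (h (X \<omega>, Z \<omega>)) * ennreal (\<xi> \<omega>) \<partial>M)"
        by (rule nn_integral_cong, rule ennreal_mult') (rule h(1))
      moreover have "(\<integral>\<^sup>+\<omega>. ennreal (- (h (X \<omega>, Z \<omega>) * \<xi> \<omega>)) \<partial>M) = (\<integral>\<^sup>+\<omega>. ennreal (h (X \<omega>, Z \<omega>)) * ennreal (- \<xi> \<omega>) \<partial>M)"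
        unfolding mult_minus_right[symmetric] by (rule nn_integral_cong, rule ennreal_mult') (rule h(1))
      ultimately show ?thesis
        using nn[OF that(1)] by (subst real_lebesgue_integral_def[OF i]) simp
    qed
  qed
  have "(\<lambda>\<omega>. k (X \<omega>, Z \<omega>) * \<xi> \<omega>) = (\<lambda>\<omega>. max 0 (k (X \<omega>, Z \<omega>)) * \<xi> \<omega> - max 0 (- k (X \<omega>, Z \<omega>)) * \<xi> \<omega>)"
    by (auto simp: fun_eq_iff max_def)
  then show ?thesis
    using part[of "\<lambda>p. max 0 (k p)"] part[of "\<lambda>p. max 0 (- k p)"] by (simp add: \<xi>_def[symmetric])
qed

end

lemma cond_indep_given_commute:
  assumes "cond_indep_given M X Y Z F"
  shows "cond_indep_given M Y X Z F"
proof -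
  interpret cond_indep_given M X Y Z F by fact
  have "AE \<omega> in M. real_cond_exp M F (\<lambda>\<omega>. indicator B (Y \<omega>) * indicator A (X \<omega>)) \<omega>
      = real_cond_exp M F (\<lambda>\<omega>. indicator B (Y \<omega>)) \<omega> * real_cond_exp M F (\<lambda>\<omega>. indicator A (X \<omega>)) \<omega>"
    if "B \<in> sets borel" "A \<in> sets borel" for A B
    using cond_indep[OF that(2,1)] by (simp only: mult.commute[of "indicator A _"] mult.commute[of "real_cond_exp M F (\<lambda>\<omega>. indicator A (X \<omega>)) _"])
  then show ?thesis
    by (intro cond_indep_given.intro cond_indep_given_axioms.intro prob_space_axioms X Y Z F_def)
qed

section \<open>Sums of centred noise with random weights\<close>

text \<open>\<pi> is what the weights may observe. \<open>orth\<close> and \<open>var\<close> are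
  the integrated forms of conditional mean 0 and conditional variance \<open>v\<close> given \<pi>.
  Besides regression residuals, a one-point observable space covers plain i.i.d. sums.\<close>

locale centred_noise = prob_space P for P :: "'a measure" +
  fixes N :: "'b measure" and \<pi> :: "'a \<Rightarrow> 'b" and \<xi> :: "'a \<Rightarrow> real" and v :: "'a \<Rightarrow> ennreal"
  assumes \<pi> [measurable]: "\<pi> \<in> measurable P N"
    and \<xi> [measurable]: "\<xi> \<in> borel_measurable P"
    and v [measurable]: "v \<in> borel_measurable P"
    and orth: "\<And>h. h \<in> borel_measurable N \<Longrightarrow> integrable P (\<lambda>x. h (\<pi> x) * \<xi> x) \<Longrightarrow> (\<integral>x. h (\<pi> x) * \<xi> x \<partial>P) = 0"
    and var: "\<And>h. h \<in> borel_measurable N \<Longrightarrow>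
        (\<integral>\<^sup>+x. h (\<pi> x) * ennreal ((\<xi> x)\<^sup>2) \<partial>P) = (\<integral>\<^sup>+x. h (\<pi> x) * v x \<partial>P)"
begin

text \<open>A weight may depend on the observables of the whole sample, its own coordinate included,
  as a fitted regression function does.\<close>

definition lift :: "nat \<Rightarrow> (nat \<Rightarrow> 'a) \<Rightarrow> (nat \<Rightarrow> 'b)" where
  "lift n \<omega> = (\<lambda>i\<in>{..<n}. \<pi> (\<omega> i))"

lemma measurable_lift [measurable]: "lift n \<in> measurable (PiM {..<n} (\<lambda>_. P)) (PiM {..<n} (\<lambda>_. N))"
  unfolding lift_def[abs_def] by measurable

lemma product_sigma_finite_P: "product_sigma_finite (\<lambda>_::nat. P)"
  by unfold_locales

lemma lift_update:
  assumes "i < n"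
  shows "lift n (x(i := y)) = (\<lambda>j\<in>{..<n} - {i}. \<pi> (x j))(i := \<pi> y)"
  using assms by (auto simp: lift_def fun_eq_iff)

text \<open>With all other coordinates fixed, a weight depends on coordinate \<open>i\<close>
  through its observable only, which is the form of test function that \<open>orth\<close> and
  \<open>var\<close> accept.\<close>

lemma measurable_frozen:
  assumes "i < n" and x: "x \<in> space (PiM ({..<n} - {i}) (\<lambda>_. P))"
    and k: "k \<in> measurable (PiM {..<n} (\<lambda>_. N)) K"
  shows "(\<lambda>b. k ((\<lambda>j\<in>{..<n} - {i}. \<pi> (x j))(i := b))) \<in> measurable N K"
proof -
  have "(\<lambda>j\<in>{..<n} - {i}. \<pi> (x j)) \<in> space (PiM ({..<n} - {i}) (\<lambda>_. N))"
    using x measurable_space[OF \<pi>] by (auto simp: space_PiM PiE_def Pi_def)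
  then have "(\<lambda>b. (\<lambda>j\<in>{..<n} - {i}. \<pi> (x j))(i := b)) \<in> measurable N (PiM (insert i ({..<n} - {i})) (\<lambda>_. N))"
    by (rule measurable_component_update) simp
  moreover have "insert i ({..<n} - {i}) = {..<n}" using assms(1) by auto
  ultimately show ?thesis using measurable_compose[OF _ k] by simp
qed

lemma nn_integral_noise_square:
  assumes i: "i < n" and k [measurable]: "k \<in> borel_measurable (PiM {..<n} (\<lambda>_. N))"
  shows "(\<integral>\<^sup>+\<omega>. k (lift n \<omega>) * ennreal ((\<xi> (\<omega> i))\<^sup>2) \<partial>PiM {..<n} (\<lambda>_. P))
       = (\<integral>\<^sup>+\<omega>. k (lift n \<omega>) * v (\<omega> i) \<partial>PiM {..<n} (\<lambda>_. P))"
proof -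
  interpret product_sigma_finite "\<lambda>_::nat. P" by (rule product_sigma_finite_P)
  have ins: "insert i ({..<n} - {i}) = {..<n}" using i by auto
  have [measurable]: "(\<lambda>\<omega>. \<omega> i) \<in> measurable (PiM {..<n} (\<lambda>_. P)) P"
    using i by (intro measurable_component_singleton) auto
  have step: "(\<integral>\<^sup>+\<omega>. k (lift n \<omega>) * h (\<omega> i) \<partial>PiM {..<n} (\<lambda>_. P))
      = (\<integral>\<^sup>+x. (\<integral>\<^sup>+y. k ((\<lambda>j\<in>{..<n} - {i}. \<pi> (x j))(i := \<pi> y)) * h y \<partial>P) \<partial>PiM ({..<n} - {i}) (\<lambda>_. P))"
    if [measurable]: "h \<in> borel_measurable P" for h
  proof -
    have "(\<lambda>\<omega>. k (lift n \<omega>) * h (\<omega> i)) \<in> borel_measurable (PiM (insert i ({..<n} - {i})) (\<lambda>_. P))"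
      unfolding ins by measurable
    from product_nn_integral_insert[OF _ _ this] show ?thesis
      unfolding ins by (simp add: lift_update[OF i])
  qed
  have "(\<integral>\<^sup>+\<omega>. k (lift n \<omega>) * ennreal ((\<xi> (\<omega> i))\<^sup>2) \<partial>PiM {..<n} (\<lambda>_. P))
      = (\<integral>\<^sup>+x. (\<integral>\<^sup>+y. k ((\<lambda>j\<in>{..<n} - {i}. \<pi> (x j))(i := \<pi> y)) * ennreal ((\<xi> y)\<^sup>2) \<partial>P) \<partial>PiM ({..<n} - {i}) (\<lambda>_. P))"
    by (rule step) measurable
  also have "\<dots> = (\<integral>\<^sup>+x. (\<integral>\<^sup>+y. k ((\<lambda>j\<in>{..<n} - {i}. \<pi> (x j))(i := \<pi> y)) * v y \<partial>P) \<partial>PiM ({..<n} - {i}) (\<lambda>_. P))"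
    by (rule nn_integral_cong, rule var, rule measurable_frozen[OF i _ k])
  also have "\<dots> = (\<integral>\<^sup>+\<omega>. k (lift n \<omega>) * v (\<omega> i) \<partial>PiM {..<n} (\<lambda>_. P))"
    by (rule step[symmetric]) measurable
  finally show ?thesis .
qed

lemma integral_noise_cross:
  assumes i: "i < n" and j: "j < n" "i \<noteq> j" and k [measurable]: "k \<in> borel_measurable (PiM {..<n} (\<lambda>_. N))"
    and int: "integrable (PiM {..<n} (\<lambda>_. P)) (\<lambda>\<omega>. k (lift n \<omega>) * \<xi> (\<omega> j) * \<xi> (\<omega> i))"
  shows "(\<integral>\<omega>. k (lift n \<omega>) * \<xi> (\<omega> j) * \<xi> (\<omega> i) \<partial>PiM {..<n} (\<lambda>_. P)) = 0"
proof -
  interpret product_sigma_finite "\<lambda>_::nat. P" by (rule product_sigma_finite_P)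
  have ins: "insert i ({..<n} - {i}) = {..<n}" using i by auto
  have "(\<integral>\<omega>. k (lift n \<omega>) * \<xi> (\<omega> j) * \<xi> (\<omega> i) \<partial>PiM {..<n} (\<lambda>_. P))
      = (\<integral>x. (\<integral>y. k ((\<lambda>j\<in>{..<n} - {i}. \<pi> (x j))(i := \<pi> y)) * \<xi> (x j) * \<xi> y \<partial>P) \<partial>PiM ({..<n} - {i}) (\<lambda>_. P))"
    using product_integral_insert[of "{..<n} - {i}" i "\<lambda>\<omega>. k (lift n \<omega>) * \<xi> (\<omega> j) * \<xi> (\<omega> i)"] int j
    unfolding ins by (simp add: lift_update[OF i])
  also have "\<dots> = (\<integral>x. 0 \<partial>PiM ({..<n} - {i}) (\<lambda>_. P))"
  proof (rule Bochner_Integration.integral_cong[OF refl])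
    fix x assume x: "x \<in> space (PiM ({..<n} - {i}) (\<lambda>_. P))"
    let ?h = "\<lambda>b. k ((\<lambda>j\<in>{..<n} - {i}. \<pi> (x j))(i := b)) * \<xi> (x j)"
    have "?h \<in> borel_measurable N" using measurable_frozen[OF i x k] by (intro borel_measurable_times) auto
    from orth[OF this] show "(\<integral>y. k ((\<lambda>j\<in>{..<n} - {i}. \<pi> (x j))(i := \<pi> y)) * \<xi> (x j) * \<xi> y \<partial>P) = 0"
      \<comment> \<open>A non-integrable section has Bochner integral 0 by convention, so the
        integrable case, where \<open>orth\<close> applies, is the only one with content.\<close>
      using not_integrable_integral_eq by blast
  qed
  finally show ?thesis by simp
qed

text \<open>Cross terms vanish and the diagonal is given by \<open>v\<close>. Finiteness of
  \<open>B\<close> makes every summand square integrable, hence all products integrable, which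
  justifies expanding the square under the Bochner integral.\<close>

lemma nn_integral_square_noise_sum_le:
  assumes k [measurable]: "\<And>i. i < n \<Longrightarrow> k i \<in> borel_measurable (PiM {..<n} (\<lambda>_. N))"
    and B: "(\<Sum>i<n. \<integral>\<^sup>+\<omega>. ennreal ((k i (lift n \<omega>))\<^sup>2) * v (\<omega> i) \<partial>PiM {..<n} (\<lambda>_. P)) \<le> B" "B < \<infinity>"
  shows "(\<integral>\<^sup>+\<omega>. ennreal ((\<Sum>i<n. k i (lift n \<omega>) * \<xi> (\<omega> i))\<^sup>2) \<partial>PiM {..<n} (\<lambda>_. P)) \<le> B"
proof -
  let ?M = "PiM {..<n} (\<lambda>_. P)"
  define a where "a i \<omega> = k i (lift n \<omega>) * \<xi> (\<omega> i)" for i \<omega>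
  have comp: "(\<lambda>\<omega>. \<omega> i) \<in> measurable ?M P" if "i < n" for i
    using that by (intro measurable_component_singleton) auto
  have a_meas: "a i \<in> borel_measurable ?M" if i: "i < n" for i
  proof -
    note [measurable] = k[OF i] comp[OF i]
    show ?thesis unfolding a_def[abs_def] by measurable
  qed
  have a2: "(\<integral>\<^sup>+\<omega>. ennreal ((a i \<omega>)\<^sup>2) \<partial>?M) = (\<integral>\<^sup>+\<omega>. ennreal ((k i (lift n \<omega>))\<^sup>2) * v (\<omega> i) \<partial>?M)" if i: "i < n" for i
  proof -
    note [measurable] = k[OF i]
    show ?thesis
      unfolding a_def power_mult_distrib
      using nn_integral_noise_square[OF i, of "\<lambda>b. ennreal ((k i b)\<^sup>2)"] by (simp add: ennreal_mult')
  qed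
  have a2_int: "integrable ?M (\<lambda>\<omega>. (a i \<omega>)\<^sup>2)" if i: "i < n" for i
  proof (rule integrableI_nonneg)
    have "(\<integral>\<^sup>+\<omega>. ennreal ((a i \<omega>)\<^sup>2) \<partial>?M) \<le> (\<Sum>i<n. \<integral>\<^sup>+\<omega>. ennreal ((k i (lift n \<omega>))\<^sup>2) * v (\<omega> i) \<partial>?M)"
      unfolding a2[OF i] by (rule member_le_sum) (use i in auto)
    then show "(\<integral>\<^sup>+\<omega>. ennreal ((a i \<omega>)\<^sup>2) \<partial>?M) < \<infinity>" using B by (meson order_trans le_less_trans)
  qed (use a_meas[OF i] in auto)
  have aa_int: "integrable ?M (\<lambda>\<omega>. a i \<omega> * a j \<omega>)" if i: "i < n" and j: "j < n" for i j
  proof (rule Bochner_Integration.integrable_bound)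
    show "integrable ?M (\<lambda>\<omega>. (a i \<omega>)\<^sup>2 + (a j \<omega>)\<^sup>2)" using a2_int i j by simp
    show "(\<lambda>\<omega>. a i \<omega> * a j \<omega>) \<in> borel_measurable ?M" using a_meas[OF i] a_meas[OF j] by simp
    have "\<bar>x * y\<bar> \<le> x\<^sup>2 + y\<^sup>2" for x y :: real
    proof -
      have "2 * (\<bar>x\<bar> * \<bar>y\<bar>) \<le> x\<^sup>2 + y\<^sup>2" using sum_squares_bound[of "\<bar>x\<bar>" "\<bar>y\<bar>"] by simp
      moreover have "0 \<le> \<bar>x\<bar> * \<bar>y\<bar>" by simp
      ultimately show ?thesis unfolding abs_mult by linarith
    qed
    then show "AE \<omega> in ?M. norm (a i \<omega> * a j \<omega>) \<le> norm ((a i \<omega>)\<^sup>2 + (a j \<omega>)\<^sup>2)" by simp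
  qed
  have cross: "(\<integral>\<omega>. a i \<omega> * a j \<omega> \<partial>?M) = (if i = j then \<integral>\<omega>. (a i \<omega>)\<^sup>2 \<partial>?M else 0)" if i: "i < n" and j: "j < n" for i j
  proof (cases "i = j")
    case False
    note [measurable] = k[OF i] k[OF j]
    have e: "(\<lambda>\<omega>. a i \<omega> * a j \<omega>) = (\<lambda>\<omega>. (\<lambda>b. k i b * k j b) (lift n \<omega>) * \<xi> (\<omega> j) * \<xi> (\<omega> i))"
      by (simp add: a_def mult_ac)
    have "(\<integral>\<omega>. a i \<omega> * a j \<omega> \<partial>?M) = 0"
      unfolding e by (rule integral_noise_cross[OF i j False]) (measurable, use aa_int[OF i j] in \<open>simp only: e\<close>)
    with False show ?thesis by simp
  qed (simp add: power2_eq_square)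
  have sq: "(\<Sum>i<n. a i \<omega>)\<^sup>2 = (\<Sum>i<n. \<Sum>j<n. a i \<omega> * a j \<omega>)" for \<omega>
    by (simp add: power2_eq_square sum_product)
  have int: "integrable ?M (\<lambda>\<omega>. (\<Sum>i<n. a i \<omega>)\<^sup>2)"
    unfolding sq by (intro Bochner_Integration.integrable_sum aa_int) auto
  have "(\<integral>\<^sup>+\<omega>. ennreal ((\<Sum>i<n. a i \<omega>)\<^sup>2) \<partial>?M) = ennreal (\<integral>\<omega>. (\<Sum>i<n. a i \<omega>)\<^sup>2 \<partial>?M)"
    by (rule nn_integral_eq_integral[OF int]) simp
  also have "(\<integral>\<omega>. (\<Sum>i<n. a i \<omega>)\<^sup>2 \<partial>?M) = (\<Sum>i<n. \<Sum>j<n. \<integral>\<omega>. a i \<omega> * a j \<omega> \<partial>?M)"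
    unfolding sq by (subst Bochner_Integration.integral_sum) (auto intro!: Bochner_Integration.integrable_sum aa_int sum.cong Bochner_Integration.integral_sum)
  also have "\<dots> = (\<Sum>i<n. \<integral>\<omega>. (a i \<omega>)\<^sup>2 \<partial>?M)"
    by (rule sum.cong[OF refl]) (simp add: cross if_distrib cong: if_cong)
  also have "ennreal \<dots> = (\<Sum>i<n. ennreal (\<integral>\<omega>. (a i \<omega>)\<^sup>2 \<partial>?M))"
    by (rule sum_ennreal[symmetric]) simp
  also have "\<dots> = (\<Sum>i<n. \<integral>\<^sup>+\<omega>. ennreal ((k i (lift n \<omega>))\<^sup>2) * v (\<omega> i) \<partial>?M)"
    by (rule sum.cong[OF refl]) (simp add: nn_integral_eq_integral a2_int flip: a2)
  finally show ?thesis using B(1) by (simp add: a_def)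
qed

end

section \<open>Uniform central limit theorem and law of large numbers\<close>

lemma Phi_eq_cdf: "Phi = cdf std_normal_distribution"
  by (simp add: Phi_def cdf_def fun_eq_iff)

lemma Phi_mono: "x \<le> y \<Longrightarrow> Phi x \<le> Phi y"
proof -
  interpret real_distribution std_normal_distribution by (rule real_dist_normal_dist)
  show "x \<le> y \<Longrightarrow> Phi x \<le> Phi y" unfolding Phi_eq_cdf by (rule cdf_nondecreasing)
qed

lemma Phi_bounds: "0 \<le> Phi x" "Phi x \<le> 1"
proof -
  interpret real_distribution std_normal_distribution by (rule real_dist_normal_dist)
  show "0 \<le> Phi x" "Phi x \<le> 1" unfolding Phi_eq_cdf by (auto intro: cdf_nonneg cdf_bounded_prob)
qed

lemma std_normal_density_le_1: "std_normal_density x \<le> 1"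
proof -
  have 1: "1 \<le> sqrt (2 * pi)" using pi_gt3 by simp
  have "exp (- x\<^sup>2 / 2) \<le> 1" by simp
  then have "exp (- x\<^sup>2 / 2) \<le> sqrt (2 * pi)" using 1 by (rule order_trans)
  then show ?thesis unfolding std_normal_density_def
    by (simp add: divide_le_eq)
qed

text \<open>The density is at most 1. The Lipschitz constant 1 is not sharp, but it turns a shift of
  the statistic by some amount into an error of at most the same amount in probability.\<close>

lemma Phi_lipschitz:
  assumes "x \<le> y" shows "Phi y \<le> Phi x + (y - x)"
proof -
  interpret real_distribution std_normal_distribution by (rule real_dist_normal_dist)
  have "Phi y - Phi x = measure std_normal_distribution {x<..y}"
  proof (cases "x = y")
    case False
    then show ?thesis unfolding Phi_eq_cdf using assms by (intro cdf_diff_eq) auto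
  qed simp
  also have "\<dots> \<le> y - x"
  proof -
    have "emeasure std_normal_distribution {x<..y} = (\<integral>\<^sup>+z. ennreal (std_normal_density z) * indicator {x<..y} z \<partial>lborel)"
      by (subst emeasure_density) auto
    also have "\<dots> \<le> (\<integral>\<^sup>+z. indicator {x<..y} z \<partial>lborel)"
    proof (rule nn_integral_mono)
      fix z :: real
      have "ennreal (std_normal_density z) \<le> 1" using std_normal_density_le_1[of z] by simp
      then show "ennreal (std_normal_density z) * indicator {x<..y} z \<le> indicator {x<..y} z"
        by (simp add: indicator_def)
    qed
    also have "\<dots> = ennreal (y - x)" using assms by simp
    finally show ?thesis unfolding measure_def using assms by (simp add: enn2real_leI)
  qed
  finally show ?thesis by simp
qed

text \<open>Polya's argument: convergence at the finitely many points of a grid of spacing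
  \<epsilon>/2 suffices, since both distribution functions are monotone and \<open>Phi\<close> grows
  by at most \<epsilon>/2 across a cell. The ends of the grid are placed where \<open>Phi\<close> is
  within \<epsilon>/2 of 0 and 1.\<close>

lemma weak_conv_std_normal_uniform:
  fixes \<nu> :: "nat \<Rightarrow> real measure"
  assumes conv: "weak_conv_m \<nu> std_normal_distribution" and dist: "\<And>n. real_distribution (\<nu> n)" and \<epsilon>: "\<epsilon> > 0"
  shows "eventually (\<lambda>n. \<forall>t. \<bar>cdf (\<nu> n) t - Phi t\<bar> \<le> \<epsilon>) sequentially"
proof -
  interpret N: real_distribution std_normal_distribution by (rule real_dist_normal_dist)
  define \<delta> where "\<delta> = \<epsilon> / 2"
  have \<delta>: "\<delta> > 0" using \<epsilon> by (simp add: \<delta>_def)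
  have "isCont Phi x" for x
  proof -
    have "\<exists>d>0. \<forall>y. \<bar>y - x\<bar> < d \<longrightarrow> \<bar>Phi y - Phi x\<bar> < e" if "e > 0" for e
    proof (intro exI[of _ e] conjI allI impI that)
      fix y assume "\<bar>y - x\<bar> < e"
      then show "\<bar>Phi y - Phi x\<bar> < e"
        using Phi_lipschitz[of x y] Phi_lipschitz[of y x] Phi_mono[of x y] Phi_mono[of y x] by linarith
    qed
    then show ?thesis by (simp add: continuous_at_eps_delta dist_real_def)
  qed
  then have pw: "(\<lambda>n. cdf (\<nu> n) x) \<longlonglongrightarrow> Phi x" for x
    using conv unfolding weak_conv_m_def weak_conv_def Phi_eq_cdf by auto
  have "eventually (\<lambda>x. Phi x < \<delta>) at_bot"
    using order_tendstoD(2)[OF N.cdf_lim_at_bot \<delta>] by (simp add: Phi_eq_cdf)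
  then obtain L where L: "Phi L < \<delta>" by (auto simp: eventually_at_bot_linorder)
  have "eventually (\<lambda>x. 1 - \<delta> < Phi x) at_top"
    using order_tendstoD(1)[OF N.cdf_lim_at_top_prob, of "1 - \<delta>"] \<delta> by (simp add: Phi_eq_cdf)
  then obtain R where R: "\<And>x. x \<ge> R \<Longrightarrow> 1 - \<delta> < Phi x" by (auto simp: eventually_at_top_linorder)
  define x where "x j = L + real j * \<delta>" for j :: nat
  obtain J :: nat where J: "R - L \<le> real J * \<delta>"
    using real_arch_simple[of "(R - L) / \<delta>"] \<delta> by (auto simp: field_simps)
  have RJ: "1 - \<delta> < Phi (x J)" by (rule R) (use J in \<open>simp add: x_def\<close>)
  have "eventually (\<lambda>n. \<forall>j\<in>{..J}. \<bar>cdf (\<nu> n) (x j) - Phi (x j)\<bar> < \<delta>) sequentially"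
    by (rule eventually_ball_finite) (use pw \<delta> in \<open>auto simp: tendsto_iff dist_real_def\<close>)
  then show ?thesis
  proof eventually_elim
    case (elim n)
    interpret n: real_distribution "\<nu> n" by (rule dist)
    have F_mono: "s \<le> t \<Longrightarrow> cdf (\<nu> n) s \<le> cdf (\<nu> n) t" for s t by (rule n.cdf_nondecreasing)
    have F01: "0 \<le> cdf (\<nu> n) t" "cdf (\<nu> n) t \<le> 1" for t by (auto intro: n.cdf_nonneg n.cdf_bounded_prob)
    show ?case
    proof
      fix t
      consider "t < x 0" | "x J \<le> t" | "x 0 \<le> t" "t < x J" by linarith
      then show "\<bar>cdf (\<nu> n) t - Phi t\<bar> \<le> \<epsilon>"
      proof cases
        case 1
        then have "cdf (\<nu> n) t \<le> cdf (\<nu> n) (x 0)" "Phi t \<le> Phi (x 0)" by (auto intro: F_mono Phi_mono)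
        moreover have "\<bar>cdf (\<nu> n) (x 0) - Phi (x 0)\<bar> < \<delta>" using elim by auto
        moreover have "Phi (x 0) < \<delta>" using L by (simp add: x_def)
        ultimately show ?thesis using F01[of t] Phi_bounds[of t] \<epsilon> unfolding \<delta>_def by linarith
      next
        case 2
        then have "cdf (\<nu> n) (x J) \<le> cdf (\<nu> n) t" "Phi (x J) \<le> Phi t" by (auto intro: F_mono Phi_mono)
        moreover have "\<bar>cdf (\<nu> n) (x J) - Phi (x J)\<bar> < \<delta>" using elim by auto
        ultimately show ?thesis using RJ F01[of t] Phi_bounds[of t] \<epsilon> unfolding \<delta>_def by linarith
      next
        case 3
        define j where "j = nat \<lfloor>(t - L) / \<delta>\<rfloor>"
        have "0 \<le> (t - L) / \<delta>" using 3(1) \<delta> by (simp add: x_def)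
        then have j: "real j \<le> (t - L) / \<delta>" "(t - L) / \<delta> < real j + 1"
          unfolding j_def by linarith+
        have xj: "x j \<le> t" "t \<le> x (Suc j)" "x (Suc j) = x j + \<delta>"
          using j \<delta> by (auto simp: x_def field_simps)
        have "real j < real J"
        proof -
          have "real j * \<delta> < real J * \<delta>" using xj(1) 3(2) by (simp add: x_def)
          then show ?thesis using \<delta> by simp
        qed
        then have "\<bar>cdf (\<nu> n) (x j) - Phi (x j)\<bar> < \<delta>" "\<bar>cdf (\<nu> n) (x (Suc j)) - Phi (x (Suc j))\<bar> < \<delta>"
          using elim by auto
        moreover have "cdf (\<nu> n) (x j) \<le> cdf (\<nu> n) t" "cdf (\<nu> n) t \<le> cdf (\<nu> n) (x (Suc j))"
          using xj by (auto intro: F_mono)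
        moreover have "Phi t \<le> Phi (x j) + \<delta>" "Phi (x (Suc j)) \<le> Phi t + \<delta>"
          using Phi_lipschitz[of "x j" t] Phi_lipschitz[of t "x (Suc j)"] xj by auto
        ultimately show ?thesis unfolding \<delta>_def by linarith
      qed
    qed
  qed
qed

section \<open>Characteristic functions and the central limit theorem\<close>

lemma measurable_sample_component:
  "f \<in> measurable M K \<Longrightarrow> i \<in> I \<Longrightarrow> (\<lambda>\<omega>. f (\<omega> i)) \<in> measurable (PiM I (\<lambda>_. M)) K"
  by (rule measurable_PiM_component_rev)

text \<open>With y = |s x| this is min(6, y) \<le> 6 y^\<eta>, multiplied by x^2: for y \<le> 1 it
  uses \<eta> \<le> 1, and for y > 1 the power is at least 1. It interpolates between the quadratic
  and the cubic Taylor bound, so that a moment of order 2 + \<eta> controls the error.\<close>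

lemma min_square_cube_le:
  fixes s x \<eta> :: real
  assumes "0 < \<eta>" "\<eta> \<le> 1"
  shows "min (6 * x\<^sup>2) (\<bar>s\<bar> * \<bar>x\<bar> ^ 3) \<le> 6 * (\<bar>s\<bar> powr \<eta> * \<bar>x\<bar> powr (2 + \<eta>))"
proof (cases "x = 0")
  case False
  have e: "\<bar>s\<bar> powr \<eta> * \<bar>x\<bar> powr (2 + \<eta>) = x\<^sup>2 * \<bar>s * x\<bar> powr \<eta>"
    using False by (simp add: powr_add abs_mult powr_mult powr_numeral)
  show ?thesis
  proof (cases "\<bar>s * x\<bar> \<le> 1")
    case True
    have "\<bar>s * x\<bar> powr 1 \<le> \<bar>s * x\<bar> powr \<eta>"
    proof (cases "s = 0")
      case False
      then show ?thesis using True \<open>x \<noteq> 0\<close> assms by (intro powr_mono') auto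
    qed simp
    then have "x\<^sup>2 * \<bar>s * x\<bar> \<le> x\<^sup>2 * \<bar>s * x\<bar> powr \<eta>" by (intro mult_left_mono) auto
    moreover have "\<bar>s\<bar> * \<bar>x\<bar> ^ 3 = x\<^sup>2 * \<bar>s * x\<bar>"
      by (simp add: abs_mult power3_eq_cube power2_eq_square mult_ac)
    moreover have "0 \<le> x\<^sup>2 * \<bar>s * x\<bar> powr \<eta>" by simp
    ultimately show ?thesis unfolding e by linarith
  next
    case False
    then have "1 \<le> \<bar>s * x\<bar> powr \<eta>" using assms by (intro ge_one_powr_ge_zero) auto
    then have "x\<^sup>2 * 1 \<le> x\<^sup>2 * \<bar>s * x\<bar> powr \<eta>" by (intro mult_left_mono) auto
    then show ?thesis unfolding e by linarith
  qed
qed simp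

text \<open>The class of standardised summands over which the limit theorems are uniform.
  Integrability is listed separately because the integral of a non-integrable function is 0, which
  would satisfy the mean condition, and the moment bound for K \<ge> 0, vacuously.\<close>

definition lyapunov_law :: "real \<Rightarrow> real \<Rightarrow> 'a measure \<Rightarrow> ('a \<Rightarrow> real) \<Rightarrow> bool" where
  "lyapunov_law \<eta> K M U \<longleftrightarrow> prob_space M \<and> U \<in> borel_measurable M \<and>
     integrable M U \<and> (\<integral>x. U x \<partial>M) = 0 \<and> integrable M (\<lambda>x. (U x)\<^sup>2) \<and> (\<integral>x. (U x)\<^sup>2 \<partial>M) = 1 \<and>
     integrable M (\<lambda>x. \<bar>U x\<bar> powr (2 + \<eta>)) \<and> (\<integral>x. \<bar>U x\<bar> powr (2 + \<eta>) \<partial>M) \<le> K"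

text \<open>The characteristic function of the sum is an n-th power, and n-th powers of numbers of
  modulus at most 1 differ by at most n times the difference of the bases. The third-order expansion
  at s = t / sqrt n bounds that difference by s^2 |s|^\<eta> K, and n s^2 = t^2.\<close>

lemma char_iid_sum_approx:
  fixes U :: "'a \<Rightarrow> real" and t \<eta> :: real
  assumes law: "lyapunov_law \<eta> K M U"
    and \<eta>: "0 < \<eta>" "\<eta> \<le> 1"
    and n: "0 < n" "t\<^sup>2 / 4 \<le> real n"
  shows "cmod (char (distr (PiM {..<n} (\<lambda>_. M)) borel (\<lambda>\<omega>. (\<Sum>i<n. U (\<omega> i)) / sqrt (real n))) t
      - complex_of_real ((1 + (- t\<^sup>2 / 2) / real n) ^ n)) \<le> t\<^sup>2 * (\<bar>t / sqrt (real n)\<bar> powr \<eta> * K)"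
proof -
  interpret prob_space M using law by (simp add: lyapunov_law_def)
  have U [measurable]: "U \<in> borel_measurable M"
    and U1: "integrable M U" "expectation U = 0"
    and U2: "integrable M (\<lambda>x. (U x)\<^sup>2)" "expectation (\<lambda>x. (U x)\<^sup>2) = 1"
    and U3: "integrable M (\<lambda>x. \<bar>U x\<bar> powr (2 + \<eta>))" "expectation (\<lambda>x. \<bar>U x\<bar> powr (2 + \<eta>)) \<le> K"
    using law by (simp_all add: lyapunov_law_def)
  define s where "s = t / sqrt (real n)"
  define \<psi> where "\<psi> = char (distr M borel U) s"
  interpret product_sigma_finite "\<lambda>_::nat. M" by unfold_locales
  interpret D: real_distribution "distr M borel U" by (rule real_distribution_distr) (rule U)
  have [measurable]: "(\<lambda>\<omega>. \<Sum>i<n. U (\<omega> i)) \<in> borel_measurable (PiM {..<n} (\<lambda>_. M))"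
    by (intro borel_measurable_sum measurable_sample_component U)
  have "char (distr (PiM {..<n} (\<lambda>_. M)) borel (\<lambda>\<omega>. (\<Sum>i<n. U (\<omega> i)) / sqrt (real n))) t
      = (\<integral>\<omega>. iexp (t * ((\<Sum>i<n. U (\<omega> i)) / sqrt (real n))) \<partial>PiM {..<n} (\<lambda>_. M))"
    unfolding char_def by (subst integral_distr) measurable
  also have "\<dots> = (\<integral>\<omega>. (\<Prod>i<n. iexp (s * U (\<omega> i))) \<partial>PiM {..<n} (\<lambda>_. M))"
  proof (rule Bochner_Integration.integral_cong[OF refl])
    fix \<omega>
    have "t * ((\<Sum>i<n. U (\<omega> i)) / sqrt (real n)) = (\<Sum>i<n. s * U (\<omega> i))"
      by (simp add: s_def sum_distrib_left sum_divide_distrib)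
    then have "iexp (t * ((\<Sum>i<n. U (\<omega> i)) / sqrt (real n))) = exp (\<Sum>i<n. \<i> * complex_of_real (s * U (\<omega> i)))"
      by (simp only: of_real_sum sum_distrib_left)
    also have "\<dots> = (\<Prod>i<n. iexp (s * U (\<omega> i)))"
      by (rule exp_sum) simp
    finally show "iexp (t * ((\<Sum>i<n. U (\<omega> i)) / sqrt (real n))) = (\<Prod>i<n. iexp (s * U (\<omega> i)))" .
  qed
  also have "\<dots> = (\<Prod>i<n. \<integral>x. iexp (s * U x) \<partial>M)"
  proof (rule product_integral_prod)
    show "integrable M (\<lambda>x. iexp (s * U x))"
      by (rule integrable_const_bound[where B = 1]) auto
  qed simp
  also have "\<dots> = \<psi> ^ n"
    unfolding \<psi>_def char_def by (subst integral_distr[OF U]) simp_all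
  finally have eq: "char (distr (PiM {..<n} (\<lambda>_. M)) borel (\<lambda>\<omega>. (\<Sum>i<n. U (\<omega> i)) / sqrt (real n))) t = \<psi> ^ n" .
  have s2: "s\<^sup>2 = t\<^sup>2 / real n" using n by (simp add: s_def power_divide)
  have E: "expectation (\<lambda>x. min (6 * (U x)\<^sup>2) (\<bar>s\<bar> * \<bar>U x\<bar> ^ 3)) \<le> 6 * (\<bar>s\<bar> powr \<eta> * K)"
  proof -
    have "expectation (\<lambda>x. min (6 * (U x)\<^sup>2) (\<bar>s\<bar> * \<bar>U x\<bar> ^ 3))
        \<le> expectation (\<lambda>x. 6 * (\<bar>s\<bar> powr \<eta> * \<bar>U x\<bar> powr (2 + \<eta>)))"
    proof (rule integral_mono)
      show "integrable M (\<lambda>x. min (6 * (U x)\<^sup>2) (\<bar>s\<bar> * \<bar>U x\<bar> ^ 3))"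
        by (rule Bochner_Integration.integrable_bound[OF integrable_mult_right[OF U2(1), of 6]]) auto
    qed (auto intro!: U3 min_square_cube_le \<eta>)
    also have "\<dots> = 6 * (\<bar>s\<bar> powr \<eta> * expectation (\<lambda>x. \<bar>U x\<bar> powr (2 + \<eta>)))" by simp
    also have "\<dots> \<le> 6 * (\<bar>s\<bar> powr \<eta> * K)" by (intro mult_left_mono U3) auto
    finally show ?thesis .
  qed
  have "cmod (\<psi> - (1 - s\<^sup>2 * 1 / 2)) \<le> (s\<^sup>2 / 6) * expectation (\<lambda>x. min (6 * (U x)\<^sup>2) (\<bar>s\<bar> * \<bar>U x\<bar> ^ 3))"
    unfolding \<psi>_def by (rule char_approx3'[OF U U1(1) U2(1) U1(2) _ refl]) (simp add: U1 U2)
  also have "\<dots> \<le> (s\<^sup>2 / 6) * (6 * (\<bar>s\<bar> powr \<eta> * K))"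
    by (intro mult_left_mono E) auto
  finally have \<psi>: "cmod (\<psi> - (1 - s\<^sup>2 * 1 / 2)) \<le> s\<^sup>2 * (\<bar>s\<bar> powr \<eta> * K)" by simp
  let ?z = "complex_of_real (1 + (- t\<^sup>2 / 2) / real n)"
  have z: "(1 - s\<^sup>2 * 1 / 2 :: complex) = ?z" by (simp add: s2 flip: of_real_power)
  \<comment> \<open>This is where t^2 / 4 \<le> n enters: it keeps 1 - t^2 / (2n) above -1.\<close>
  have "\<bar>1 + (- t\<^sup>2 / 2) / real n\<bar> \<le> 1"
    using n by (intro abs_leI) (auto simp: field_simps)
  then have "cmod ?z \<le> 1" unfolding norm_of_real .
  then have "cmod (\<psi> ^ n - ?z ^ n) \<le> real n * cmod (\<psi> - ?z)"
    unfolding \<psi>_def by (intro norm_power_diff D.cmod_char_le_1)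
  also have "\<dots> \<le> real n * (s\<^sup>2 * (\<bar>s\<bar> powr \<eta> * K))"
    using \<psi> unfolding z by (intro mult_left_mono) auto
  also have "\<dots> = t\<^sup>2 * (\<bar>s\<bar> powr \<eta> * K)" using n by (simp add: s2)
  finally show ?thesis unfolding eq by (simp add: s_def)
qed

text \<open>The uniformity in the law is obtained by contradiction: a sequence of violating laws forms a
  triangular array to which Levy's continuity theorem applies.\<close>

lemma uniform_clt:
  fixes \<eta> K \<epsilon> :: real
  assumes \<eta>: "0 < \<eta>" "\<eta> \<le> 1" and \<epsilon>: "0 < \<epsilon>"
  shows "\<exists>N. \<forall>n\<ge>N. \<forall>(M::'a measure) U. lyapunov_law \<eta> K M U \<longrightarrow>
     (\<forall>t. \<bar>measure (PiM {..<n} (\<lambda>_. M)) {\<omega> \<in> space (PiM {..<n} (\<lambda>_. M)). (\<Sum>i<n. U (\<omega> i)) / sqrt (real n) \<le> t} - Phi t\<bar> \<le> \<epsilon>)"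
proof (rule ccontr)
  define R where "R n M U \<longleftrightarrow>
     (\<forall>t. \<bar>measure (PiM {..<n} (\<lambda>_. M)) {\<omega> \<in> space (PiM {..<n} (\<lambda>_. M)). (\<Sum>i<n. U (\<omega> i)) / sqrt (real n) \<le> t} - Phi t\<bar> \<le> \<epsilon>)"
    for n and M :: "'a measure" and U
  assume "\<not> ?thesis"
  then have "\<forall>N. \<exists>n M U. n \<ge> N \<and> lyapunov_law \<eta> K M U \<and> \<not> R n M U" unfolding R_def[symmetric] by blast
  then obtain m :: "nat \<Rightarrow> nat" and M :: "nat \<Rightarrow> 'a measure" and U
    where m: "\<And>N. m N \<ge> N" and law: "\<And>N. lyapunov_law \<eta> K (M N) (U N)" and bad: "\<And>N. \<not> R (m N) (M N) (U N)"
    by metis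
  have prob: "prob_space (M N)" and U: "U N \<in> borel_measurable (M N)" for N
    using law[of N] by (simp_all add: lyapunov_law_def)
  define \<nu> where "\<nu> N = distr (PiM {..<m N} (\<lambda>_. M N)) borel (\<lambda>\<omega>. (\<Sum>i<m N. U N (\<omega> i)) / sqrt (real (m N)))" for N
  have meas: "(\<lambda>\<omega>. (\<Sum>i<m N. U N (\<omega> i)) / sqrt (real (m N))) \<in> borel_measurable (PiM {..<m N} (\<lambda>_. M N))" for N
    by (intro borel_measurable_divide borel_measurable_sum borel_measurable_const measurable_sample_component U)
  have rd: "real_distribution (\<nu> N)" for N
  proof -
    interpret prob_space "PiM {..<m N} (\<lambda>_. M N)" by (intro prob_space_PiM prob)
    show ?thesis unfolding \<nu>_def by (intro real_distribution_distr meas)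
  qed
  have m_lim: "filterlim m sequentially sequentially"
    by (rule filterlim_at_top_mono[OF filterlim_ident]) (simp add: m)
  have "weak_conv_m \<nu> std_normal_distribution"
  proof (rule levy_continuity[OF rd real_dist_normal_dist])
    fix t :: real
    have lim1: "(\<lambda>N. complex_of_real ((1 + (- t\<^sup>2 / 2) / real (m N)) ^ m N)) \<longlonglongrightarrow> complex_of_real (exp (- t\<^sup>2 / 2))"
      by (intro tendsto_of_real filterlim_compose[OF tendsto_exp_limit_sequentially m_lim])
    have "eventually (\<lambda>N. N \<ge> 1 \<and> t\<^sup>2 / 4 \<le> real N) sequentially"
      by (intro eventually_conj eventually_ge_at_top)
         (metis filterlim_real_sequentially filterlim_at_top)
    \<comment> \<open>The bound involves the law only through \<open>K\<close>, so it is harmless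
      that the law changes with \<open>N\<close>.\<close>
    then have ev: "eventually (\<lambda>N. cmod (char (\<nu> N) t - complex_of_real ((1 + (- t\<^sup>2 / 2) / real (m N)) ^ m N))
        \<le> t\<^sup>2 * (\<bar>t / sqrt (real (m N))\<bar> powr \<eta> * K)) sequentially"
    proof eventually_elim
      case (elim N)
      have "real N \<le> real (m N)" using m[of N] by simp
      then have "0 < m N" "t\<^sup>2 / 4 \<le> real (m N)" using elim by auto
      then show ?case unfolding \<nu>_def
        by (intro char_iid_sum_approx \<eta> law)
    qed
    have "(\<lambda>N. \<bar>t / sqrt (real (m N))\<bar>) \<longlonglongrightarrow> 0"
    proof -
      have "filterlim (\<lambda>N. sqrt (real (m N))) at_top sequentially"
        by (intro filterlim_compose[OF sqrt_at_top] filterlim_compose[OF filterlim_real_sequentially m_lim])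
      then have "(\<lambda>N. t / sqrt (real (m N))) \<longlonglongrightarrow> 0"
        by (rule tendsto_divide_0[OF tendsto_const filterlim_at_top_imp_at_infinity])
      then show ?thesis by (rule tendsto_rabs_zero)
    qed
    then have "(\<lambda>N. \<bar>t / sqrt (real (m N))\<bar> powr \<eta>) \<longlonglongrightarrow> 0"
      by (rule tendsto_zero_powrI[OF _ tendsto_const]) (use \<eta> in auto)
    then have "(\<lambda>N. t\<^sup>2 * (\<bar>t / sqrt (real (m N))\<bar> powr \<eta> * K)) \<longlonglongrightarrow> 0"
      by (auto intro!: tendsto_mult_right_zero tendsto_mult_left_zero)
    then have "(\<lambda>N. char (\<nu> N) t - complex_of_real ((1 + (- t\<^sup>2 / 2) / real (m N)) ^ m N)) \<longlonglongrightarrow> 0"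
      by (rule Lim_null_comparison[OF ev])
    then have "(\<lambda>N. char (\<nu> N) t) \<longlonglongrightarrow> complex_of_real (exp (- t\<^sup>2 / 2))"
      using lim1 by (rule Lim_transform[rotated])
    then show "(\<lambda>N. char (\<nu> N) t) \<longlonglongrightarrow> char std_normal_distribution t"
      by (simp add: char_std_normal_distribution)
  qed
  from weak_conv_std_normal_uniform[OF this rd \<epsilon>]
  obtain N where N: "\<forall>t. \<bar>cdf (\<nu> N) t - Phi t\<bar> \<le> \<epsilon>"
    by (auto simp: eventually_sequentially)
  have "cdf (\<nu> N) t = measure (PiM {..<m N} (\<lambda>_. M N)) {\<omega> \<in> space (PiM {..<m N} (\<lambda>_. M N)). (\<Sum>i<m N. U N (\<omega> i)) / sqrt (real (m N)) \<le> t}" for t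
    unfolding cdf_def \<nu>_def by (subst measure_distr[OF meas]) (auto intro!: arg_cong[where f = "measure _"])
  with N bad[of N] show False by (simp add: R_def)
qed

section \<open>Second moment bounds and the law of large numbers\<close>

lemma (in prob_space) prob_gt_le_nn_integral:
  assumes [measurable]: "f \<in> borel_measurable M" and B: "(\<integral>\<^sup>+x. f x \<partial>M) \<le> ennreal B" "0 \<le> B" and c: "0 < c"
  shows "prob {x \<in> space M. f x > ennreal c} \<le> B / c"
proof -
  have "emeasure M {x \<in> space M. f x > ennreal c} \<le> emeasure M {x \<in> space M. 1 \<le> ennreal (1 / c) * f x}"
  proof (rule emeasure_mono)
    have "1 \<le> ennreal (1 / c) * y" if "ennreal c < y" for y
    proof -
      have "1 = ennreal (1 / c) * ennreal c" using c by (simp flip: ennreal_mult)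
      also have "\<dots> \<le> ennreal (1 / c) * y" using that by (intro mult_left_mono) auto
      finally show ?thesis .
    qed
    then show "{x \<in> space M. f x > ennreal c} \<subseteq> {x \<in> space M. 1 \<le> ennreal (1 / c) * f x}" by auto
  qed measurable
  also have "\<dots> \<le> ennreal (1 / c) * (\<integral>\<^sup>+x. f x * indicator (space M) x \<partial>M)"
    by (rule nn_integral_Markov_inequality) auto
  also have "(\<integral>\<^sup>+x. f x * indicator (space M) x \<partial>M) = (\<integral>\<^sup>+x. f x \<partial>M)"
    by (intro nn_integral_cong) (simp add: indicator_def)
  also have "ennreal (1 / c) * (\<integral>\<^sup>+x. f x \<partial>M) \<le> ennreal (1 / c) * ennreal B"
    by (intro mult_left_mono B) simp
  also have "\<dots> = ennreal (B / c)" using B(2) c by (simp flip: ennreal_mult)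
  finally show ?thesis using B(2) c by (simp add: emeasure_eq_measure)
qed

lemma (in prob_space) prob_abs_gt_le_nn_integral_square:
  assumes [measurable]: "f \<in> borel_measurable M" and B: "(\<integral>\<^sup>+x. ennreal ((f x)\<^sup>2) \<partial>M) \<le> ennreal B" "0 \<le> B" and c: "0 < c"
  shows "prob {x \<in> space M. \<bar>f x\<bar> > c} \<le> B / c\<^sup>2"
proof -
  have "prob {x \<in> space M. ennreal ((f x)\<^sup>2) > ennreal (c\<^sup>2)} \<le> B / c\<^sup>2"
    by (rule prob_gt_le_nn_integral) (use B c in auto)
  moreover have "{x \<in> space M. ennreal ((f x)\<^sup>2) > ennreal (c\<^sup>2)} = {x \<in> space M. \<bar>f x\<bar> > c}"
  proof -
    have "c\<^sup>2 < y\<^sup>2 \<longleftrightarrow> c < \<bar>y\<bar>" for y :: real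
      using c abs_le_square_iff[of y c] by (simp add: not_le[symmetric])
    then show ?thesis by (simp add: ennreal_less_iff)
  qed
  ultimately show ?thesis by simp
qed

text \<open>Centred i.i.d. variables are noise relative to a one-point observable with constant
  conditional variance, so the bound for weighted noise sums applies with constant weights.\<close>

lemma (in prob_space) nn_integral_iid_sum_square_le:
  fixes X :: "'a \<Rightarrow> real"
  assumes X [measurable]: "X \<in> borel_measurable M"
    and X1: "expectation X = 0" and X2: "integrable M (\<lambda>x. (X x)\<^sup>2)" "expectation (\<lambda>x. (X x)\<^sup>2) \<le> s"
  shows "(\<integral>\<^sup>+\<omega>. ennreal ((\<Sum>i<n. c * X (\<omega> i))\<^sup>2) \<partial>PiM {..<n} (\<lambda>_. M)) \<le> ennreal (real n * c\<^sup>2 * s)"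
proof -
  have nn2: "(\<integral>\<^sup>+x. ennreal ((X x)\<^sup>2) \<partial>M) = ennreal (expectation (\<lambda>x. (X x)\<^sup>2))"
    by (rule nn_integral_eq_integral[OF X2(1)]) simp
  have s: "0 \<le> s" by (rule order_trans[OF Bochner_Integration.integral_nonneg X2(2)]) simp
  interpret C: centred_noise M "count_space (UNIV :: unit set)" "\<lambda>_. ()" X "\<lambda>_. ennreal (expectation (\<lambda>x. (X x)\<^sup>2))"
    by unfold_locales (auto simp: X1 nn2 nn_integral_cmult emeasure_space_1)
  interpret P: prob_space "PiM {..<n} (\<lambda>_. M)" by (intro prob_space_PiM prob_space_axioms)
  show ?thesis
  proof (rule C.nn_integral_square_noise_sum_le[where k = "\<lambda>_ _. c"])
    have "(\<Sum>i<n. \<integral>\<^sup>+\<omega>. ennreal (c\<^sup>2) * ennreal (expectation (\<lambda>x. (X x)\<^sup>2)) \<partial>PiM {..<n} (\<lambda>_. M))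
        = ennreal (real n * (c\<^sup>2 * expectation (\<lambda>x. (X x)\<^sup>2)))"
      by (simp add: P.emeasure_space_1 ennreal_mult' ennreal_of_nat_eq_real_of_nat)
    also have "\<dots> \<le> ennreal (real n * c\<^sup>2 * s)"
      using X2(2) by (intro ennreal_leI) (simp add: mult.assoc mult_left_mono)
    finally show "(\<Sum>i<n. \<integral>\<^sup>+\<omega>. ennreal (c\<^sup>2) * ennreal (expectation (\<lambda>x. (X x)\<^sup>2)) \<partial>PiM {..<n} (\<lambda>_. M))
        \<le> ennreal (real n * c\<^sup>2 * s)" .
  qed auto
qed

lemma nn_integral_PiM_component:
  assumes "prob_space M" "i \<in> I" and h: "h \<in> borel_measurable M"
  shows "(\<integral>\<^sup>+\<omega>. h (\<omega> i) \<partial>PiM I (\<lambda>_. M)) = (\<integral>\<^sup>+x. h x \<partial>M)"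
proof -
  have "(\<integral>\<^sup>+\<omega>. h (\<omega> i) \<partial>PiM I (\<lambda>_. M)) = (\<integral>\<^sup>+x. h x \<partial>distr (PiM I (\<lambda>_. M)) M (\<lambda>\<omega>. \<omega> i))"
    using assms by (intro nn_integral_distr[symmetric] measurable_component_singleton) auto
  also have "distr (PiM I (\<lambda>_. M)) M (\<lambda>\<omega>. \<omega> i) = M"
    using distr_PiM_component[of I "\<lambda>_. M" i] assms by simp
  finally show ?thesis .
qed

text \<open>No moment of order four is available, hence the truncation at level \<open>L\<close>.\<close>

lemma lln_bound:
  assumes law: "lyapunov_law \<eta> K M U" and \<eta>: "0 < \<eta>" and L: "0 < L" and \<kappa>: "0 < \<kappa>"
    and small: "K * L powr (- \<eta> / 2) \<le> \<kappa> / 3" and n: "0 < n"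
  shows "measure (PiM {..<n} (\<lambda>_. M)) {\<omega> \<in> space (PiM {..<n} (\<lambda>_. M)). \<bar>(\<Sum>i<n. (U (\<omega> i))\<^sup>2) / real n - 1\<bar> > \<kappa>}
     \<le> 9 * L / (real n * \<kappa>\<^sup>2) + 3 * (K * L powr (- \<eta> / 2)) / \<kappa>"
proof -
  interpret prob_space M using law by (simp add: lyapunov_law_def)
  interpret P: prob_space "PiM {..<n} (\<lambda>_. M)" by (intro prob_space_PiM prob_space_axioms)
  have U [measurable]: "U \<in> borel_measurable M"
    and U2: "integrable M (\<lambda>x. (U x)\<^sup>2)" "expectation (\<lambda>x. (U x)\<^sup>2) = 1"
    and U3: "integrable M (\<lambda>x. \<bar>U x\<bar> powr (2 + \<eta>))" "expectation (\<lambda>x. \<bar>U x\<bar> powr (2 + \<eta>)) \<le> K"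
    using law by (simp_all add: lyapunov_law_def)
  let ?e = "K * L powr (- \<eta> / 2)"
  define V1 V2 where "V1 x = (if (U x)\<^sup>2 \<le> L then (U x)\<^sup>2 else 0)" and "V2 x = (if (U x)\<^sup>2 \<le> L then 0 else (U x)\<^sup>2)" for x
  have [measurable]: "V1 \<in> borel_measurable M" "V2 \<in> borel_measurable M"
    unfolding V1_def[abs_def] V2_def[abs_def] by measurable
  have V: "(U x)\<^sup>2 = V1 x + V2 x" "0 \<le> V1 x" "0 \<le> V2 x" "V1 x \<le> (U x)\<^sup>2" "V2 x \<le> (U x)\<^sup>2" "V1 x \<le> L" for x
    using L by (auto simp: V1_def V2_def)
  have int1: "integrable M V1" and int2: "integrable M V2"
    by (rule Bochner_Integration.integrable_bound[OF U2(1)]; use V in simp)+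
  have V1sq: "(V1 x)\<^sup>2 \<le> L * (U x)\<^sup>2" for x
    unfolding power2_eq_square[of "V1 x"] using V L by (intro mult_mono) auto
  \<comment> \<open>Beyond the truncation level |U| > sqrt L, hence 1 \<le> L^(-\<eta>/2)
    |U|^\<eta>. The discarded part thus has mean at most K L^(-\<eta>/2).\<close>
  have V2le: "V2 x \<le> L powr (- \<eta> / 2) * \<bar>U x\<bar> powr (2 + \<eta>)" for x
  proof (cases "(U x)\<^sup>2 \<le> L")
    case False
    have U0: "0 < \<bar>U x\<bar>" using False L by (auto simp: not_le intro: ccontr)
    have "L powr (\<eta> / 2) \<le> ((U x)\<^sup>2) powr (\<eta> / 2)" using False L \<eta> by (intro powr_mono2) auto
    also have "\<dots> = \<bar>U x\<bar> powr \<eta>"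
    proof -
      have "((U x)\<^sup>2) powr (\<eta> / 2) = (\<bar>U x\<bar> powr 2) powr (\<eta> / 2)" using U0 by (simp add: powr_numeral)
      also have "\<dots> = \<bar>U x\<bar> powr \<eta>" unfolding powr_powr by simp
      finally show ?thesis .
    qed
    finally have "1 \<le> L powr (- \<eta> / 2) * \<bar>U x\<bar> powr \<eta>"
      using L by (simp add: powr_minus field_simps)
    then have "(U x)\<^sup>2 * 1 \<le> (U x)\<^sup>2 * (L powr (- \<eta> / 2) * \<bar>U x\<bar> powr \<eta>)"
      by (intro mult_left_mono) auto
    then show ?thesis using False U0 by (simp add: V2_def powr_add powr_numeral mult_ac)
  qed (simp add: V2_def)
  have EV2: "expectation V2 \<le> ?e"
  proof -
    have "expectation V2 \<le> expectation (\<lambda>x. L powr (- \<eta> / 2) * \<bar>U x\<bar> powr (2 + \<eta>))"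
      by (intro integral_mono int2 integrable_mult_right U3 V2le)
    also have "\<dots> \<le> L powr (- \<eta> / 2) * K" using U3(2) by (simp add: mult_left_mono)
    finally show ?thesis by (simp add: mult.commute)
  qed
  have EV2_nn: "0 \<le> expectation V2" using V by (intro Bochner_Integration.integral_nonneg) auto
  have EV: "expectation V1 + expectation V2 = 1"
    using U2(2) int1 int2 by (simp add: V(1))
  \<comment> \<open>The truncated square is at most \<open>L\<close>, so its own square is at most L
    U^2. This gives the variance bound \<open>L\<close> needed for Chebyshev.\<close>
  define W where "W x = V1 x - expectation V1" for x
  have [measurable]: "W \<in> borel_measurable M" unfolding W_def[abs_def] by measurable
  have int1s: "integrable M (\<lambda>x. (V1 x)\<^sup>2)"
    by (rule Bochner_Integration.integrable_bound[OF integrable_mult_right[OF U2(1), of L]]) (use V1sq L in auto)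
  have W: "expectation W = 0" "integrable M (\<lambda>x. (W x)\<^sup>2)" "expectation (\<lambda>x. (W x)\<^sup>2) \<le> L"
  proof -
    show "expectation W = 0" unfolding W_def[abs_def] using int1 by (simp add: prob_space)
    have e: "(W x)\<^sup>2 = (V1 x)\<^sup>2 - 2 * expectation V1 * V1 x + (expectation V1)\<^sup>2" for x
      by (simp add: W_def power2_diff algebra_simps)
    show "integrable M (\<lambda>x. (W x)\<^sup>2)" unfolding e using int1s int1 by simp
    have "expectation (\<lambda>x. (W x)\<^sup>2) = expectation (\<lambda>x. (V1 x)\<^sup>2) - (expectation V1)\<^sup>2"
      unfolding e using int1s int1 by (simp add: prob_space power2_eq_square)
    also have "\<dots> \<le> expectation (\<lambda>x. (V1 x)\<^sup>2)" by simp
    also have "\<dots> \<le> expectation (\<lambda>x. L * (U x)\<^sup>2)"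
      by (intro integral_mono int1s integrable_mult_right U2 V1sq)
    finally show "expectation (\<lambda>x. (W x)\<^sup>2) \<le> L" using U2 by simp
  qed
  define A where "A \<omega> = (\<Sum>i<n. 1 / real n * W (\<omega> i))" for \<omega>
  define B where "B \<omega> = (\<Sum>i<n. V2 (\<omega> i) / real n)" for \<omega>
  have Am [measurable]: "A \<in> borel_measurable (PiM {..<n} (\<lambda>_. M))"
    unfolding A_def[abs_def]
    by (intro borel_measurable_sum measurable_sample_component) measurable
  have Bm [measurable]: "B \<in> borel_measurable (PiM {..<n} (\<lambda>_. M))"
    unfolding B_def[abs_def]
    by (intro borel_measurable_sum measurable_sample_component) measurable
  have Um [measurable]: "(\<lambda>\<omega>. (\<Sum>i<n. (U (\<omega> i))\<^sup>2)) \<in> borel_measurable (PiM {..<n} (\<lambda>_. M))"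
    by (intro borel_measurable_sum measurable_sample_component) measurable
  have PA: "P.prob {\<omega> \<in> space (PiM {..<n} (\<lambda>_. M)). \<bar>A \<omega>\<bar> > \<kappa> / 3} \<le> (L / real n) / (\<kappa> / 3)\<^sup>2"
  proof (rule P.prob_abs_gt_le_nn_integral_square)
    show "(\<integral>\<^sup>+\<omega>. ennreal ((A \<omega>)\<^sup>2) \<partial>PiM {..<n} (\<lambda>_. M)) \<le> ennreal (L / real n)"
      using nn_integral_iid_sum_square_le[OF _ W, of n "1 / real n"] n
      by (simp add: A_def power_divide power2_eq_square)
  qed (use L \<kappa> in auto)
  have PB: "P.prob {\<omega> \<in> space (PiM {..<n} (\<lambda>_. M)). ennreal (B \<omega>) > ennreal (\<kappa> / 3)} \<le> ?e / (\<kappa> / 3)"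
  proof (rule P.prob_gt_le_nn_integral)
    have "(\<integral>\<^sup>+\<omega>. ennreal (B \<omega>) \<partial>PiM {..<n} (\<lambda>_. M)) = (\<integral>\<^sup>+\<omega>. (\<Sum>i<n. ennreal (V2 (\<omega> i) / real n)) \<partial>PiM {..<n} (\<lambda>_. M))"
      unfolding B_def using V by (intro nn_integral_cong sum_ennreal[symmetric]) auto
    also have "\<dots> = (\<Sum>i<n. \<integral>\<^sup>+\<omega>. ennreal (V2 (\<omega> i) / real n) \<partial>PiM {..<n} (\<lambda>_. M))"
      by (rule nn_integral_sum) (intro measurable_compose[OF _ measurable_ennreal] measurable_sample_component, auto)
    also have "\<dots> = (\<Sum>i<n. \<integral>\<^sup>+x. ennreal (V2 x / real n) \<partial>M)"
      by (rule sum.cong[OF refl], rule nn_integral_PiM_component) (auto intro: prob_space_axioms)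
    also have "(\<integral>\<^sup>+x. ennreal (V2 x / real n) \<partial>M) = ennreal (expectation V2 / real n)"
      using V int2 by (subst nn_integral_eq_integral) auto
    also have "(\<Sum>i<n. ennreal (expectation V2 / real n)) = ennreal (expectation V2)"
      using n EV2_nn by (simp add: ennreal_of_nat_eq_real_of_nat flip: ennreal_mult)
    finally show "(\<integral>\<^sup>+\<omega>. ennreal (B \<omega>) \<partial>PiM {..<n} (\<lambda>_. M)) \<le> ennreal ?e" using EV2 by (simp add: ennreal_leI)
  qed (use EV2 EV2_nn \<kappa> in auto)
  \<comment> \<open>Three pieces of size \<kappa>/3: the centred truncated mean \<open>A\<close>
    (Chebyshev), the discarded mean \<open>B\<close> (Markov), and the deterministic bias
    \<open>expectation V2\<close>, which \<open>small\<close> bounds.\<close>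
  have dec: "(\<Sum>i<n. (U (\<omega> i))\<^sup>2) / real n - 1 = A \<omega> + B \<omega> - expectation V2" for \<omega>
  proof -
    have "A \<omega> = (\<Sum>i<n. V1 (\<omega> i)) / real n - expectation V1"
      unfolding A_def W_def using n by (simp add: sum_subtractf right_diff_distrib flip: sum_divide_distrib)
    moreover have "B \<omega> = (\<Sum>i<n. V2 (\<omega> i)) / real n" by (simp add: B_def sum_divide_distrib)
    moreover have "(\<Sum>i<n. (U (\<omega> i))\<^sup>2) = (\<Sum>i<n. V1 (\<omega> i)) + (\<Sum>i<n. V2 (\<omega> i))"
      by (simp add: V(1) sum.distrib)
    ultimately show ?thesis using EV by (simp add: add_divide_distrib)
  qed
  have B_nn: "0 \<le> B \<omega>" for \<omega> unfolding B_def using V by (intro sum_nonneg) auto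
  have "P.prob {\<omega> \<in> space (PiM {..<n} (\<lambda>_. M)). \<bar>(\<Sum>i<n. (U (\<omega> i))\<^sup>2) / real n - 1\<bar> > \<kappa>}
     \<le> P.prob ({\<omega> \<in> space (PiM {..<n} (\<lambda>_. M)). \<bar>A \<omega>\<bar> > \<kappa> / 3} \<union> {\<omega> \<in> space (PiM {..<n} (\<lambda>_. M)). ennreal (B \<omega>) > ennreal (\<kappa> / 3)})"
  proof (rule P.finite_measure_mono)
    have "\<bar>A \<omega>\<bar> > \<kappa> / 3 \<or> B \<omega> > \<kappa> / 3" if "\<bar>(\<Sum>i<n. (U (\<omega> i))\<^sup>2) / real n - 1\<bar> > \<kappa>" for \<omega>
      using that small EV2 EV2_nn B_nn[of \<omega>] unfolding dec by linarith
    then show "{\<omega> \<in> space (PiM {..<n} (\<lambda>_. M)). \<bar>(\<Sum>i<n. (U (\<omega> i))\<^sup>2) / real n - 1\<bar> > \<kappa>}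
      \<subseteq> {\<omega> \<in> space (PiM {..<n} (\<lambda>_. M)). \<bar>A \<omega>\<bar> > \<kappa> / 3} \<union> {\<omega> \<in> space (PiM {..<n} (\<lambda>_. M)). ennreal (B \<omega>) > ennreal (\<kappa> / 3)}"
      using \<kappa> by (auto simp: ennreal_less_iff)
  qed measurable
  also have "\<dots> \<le> (L / real n) / (\<kappa> / 3)\<^sup>2 + ?e / (\<kappa> / 3)"
    by (rule order_trans[OF measure_Un_le add_mono[OF PA PB]]) measurable
  also have "\<dots> = 9 * L / (real n * \<kappa>\<^sup>2) + 3 * ?e / \<kappa>"
    using \<kappa> n by (simp add: field_simps)
  finally show ?thesis .
qed

text \<open>\<open>lln_bound\<close> depends on the law only through \<open>K\<close>, so uniformity
  is immediate: \<open>L\<close> is chosen first to make the discarded part contribute at most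
  \<epsilon>/2, then n large compared with L / (\<kappa>^2 \<epsilon>) for the Chebyshev
  part.\<close>

lemma uniform_lln:
  assumes \<eta>: "0 < \<eta>" and \<kappa>: "0 < \<kappa>" and \<epsilon>: "0 < \<epsilon>"
  shows "\<exists>N. \<forall>n\<ge>N. \<forall>(M::'a measure) U. lyapunov_law \<eta> K M U \<longrightarrow>
     measure (PiM {..<n} (\<lambda>_. M)) {\<omega> \<in> space (PiM {..<n} (\<lambda>_. M)). \<bar>(\<Sum>i<n. (U (\<omega> i))\<^sup>2) / real n - 1\<bar> > \<kappa>} \<le> \<epsilon>"
proof -
  have "((\<lambda>L::real. L powr (- \<eta> / 2)) \<longlongrightarrow> 0) at_top"
    by (rule tendsto_neg_powr) (use \<eta> in \<open>auto intro: filterlim_ident\<close>)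
  then have "((\<lambda>L::real. K * L powr (- \<eta> / 2)) \<longlongrightarrow> 0) at_top" by (rule tendsto_mult_right_zero)
  then have "eventually (\<lambda>L. K * L powr (- \<eta> / 2) < min (\<kappa> / 3) (\<kappa> * \<epsilon> / 6)) at_top"
    by (rule order_tendstoD) (use \<kappa> \<epsilon> in auto)
  then obtain L where L: "L > 0" "K * L powr (- \<eta> / 2) < min (\<kappa> / 3) (\<kappa> * \<epsilon> / 6)"
    using eventually_conj[OF eventually_gt_at_top[of "0::real"]] eventually_happens[of _ "at_top::real filter"] by (metis (mono_tags, lifting) trivial_limit_at_top_linorder)
  obtain N :: nat where N: "18 * L / (\<kappa>\<^sup>2 * \<epsilon>) \<le> real N" using real_arch_simple by blast
  show ?thesis
  proof (intro exI[of _ "max N 1"] allI impI)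
    fix n :: nat and M :: "'a measure" and U assume n: "max N 1 \<le> n" and law: "lyapunov_law \<eta> K M U"
    have "18 * L / (\<kappa>\<^sup>2 * \<epsilon>) \<le> real n" using N n by linarith
    then have a: "9 * L / (real n * \<kappa>\<^sup>2) \<le> \<epsilon> / 2" using n \<kappa> \<epsilon> by (simp add: field_simps)
    have b: "3 * (K * L powr (- \<eta> / 2)) / \<kappa> \<le> \<epsilon> / 2" using L(2) \<kappa> by (simp add: field_simps)
    have "measure (PiM {..<n} (\<lambda>_. M)) {\<omega> \<in> space (PiM {..<n} (\<lambda>_. M)). \<bar>(\<Sum>i<n. (U (\<omega> i))\<^sup>2) / real n - 1\<bar> > \<kappa>}
     \<le> 9 * L / (real n * \<kappa>\<^sup>2) + 3 * (K * L powr (- \<eta> / 2)) / \<kappa>"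
      by (rule lln_bound[OF law \<eta> L(1) \<kappa>]) (use L n in auto)
    then show "measure (PiM {..<n} (\<lambda>_. M)) {\<omega> \<in> space (PiM {..<n} (\<lambda>_. M)). \<bar>(\<Sum>i<n. (U (\<omega> i))\<^sup>2) / real n - 1\<bar> > \<kappa>} \<le> \<epsilon>"
      using a b by linarith
  qed
qed

section \<open>Remainder terms and studentization\<close>

context centred_noise
begin

text \<open>Conditional Chebyshev bounds: setting the weights to 0 on the event that the conditional variance
  exceeds \<open>\<delta>\<close> leaves a sum with second moment at most \<open>\<delta>\<close>.\<close>

lemma
  fixes v' :: "'b \<Rightarrow> ennreal" and k :: "nat \<Rightarrow> (nat \<Rightarrow> 'b) \<Rightarrow> real"
  assumes v': "v = (\<lambda>x. v' (\<pi> x))" "v' \<in> borel_measurable N"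
    and k: "\<And>i. i < n \<Longrightarrow> k i \<in> borel_measurable (PiM {..<n} (\<lambda>_. N))"
    and \<delta>: "0 < \<delta>" and s: "0 < s"
  defines "\<Omega> \<equiv> PiM {..<n} (\<lambda>_. P)"
  shows prob_noise_sum_le: "measure \<Omega> {\<omega> \<in> space \<Omega>. \<bar>\<Sum>i<n. k i (lift n \<omega>) * \<xi> (\<omega> i)\<bar> > s}
      \<le> measure \<Omega> {\<omega> \<in> space \<Omega>. (\<Sum>i<n. ennreal ((k i (lift n \<omega>))\<^sup>2) * v (\<omega> i)) > ennreal \<delta>} + \<delta> / s\<^sup>2"
    and prob_noise_square_sum_le: "measure \<Omega> {\<omega> \<in> space \<Omega>. (\<Sum>i<n. (k i (lift n \<omega>) * \<xi> (\<omega> i))\<^sup>2) > s}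
      \<le> measure \<Omega> {\<omega> \<in> space \<Omega>. (\<Sum>i<n. ennreal ((k i (lift n \<omega>))\<^sup>2) * v (\<omega> i)) > ennreal \<delta>} + \<delta> / s"
proof -
  interpret \<Omega>: prob_space \<Omega> unfolding \<Omega>_def by (intro prob_space_PiM prob_space_axioms)
  \<comment> \<open>As \<open>v\<close> factors through \<pi>, the conditional variance
    \<open>b\<close> is a function of the observables, so the truncated weights \<open>q\<close> are
    again admissible weights.\<close>
  define b where "b d = (\<Sum>i<n. ennreal ((k i d)\<^sup>2) * v' (d i))" for d
  define q where "q i d = (if b d \<le> ennreal \<delta> then k i d else 0)" for i d
  have comp: "(\<lambda>\<omega>. \<omega> i) \<in> measurable \<Omega> P" if "i < n" for i
    using that unfolding \<Omega>_def by (intro measurable_component_singleton) auto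
  have b_eq: "b (lift n \<omega>) = (\<Sum>i<n. ennreal ((k i (lift n \<omega>))\<^sup>2) * v (\<omega> i))" for \<omega>
    unfolding b_def v'(1) by (intro sum.cong) (auto simp: lift_def)
  have b [measurable]: "b \<in> borel_measurable (PiM {..<n} (\<lambda>_. N))"
    unfolding b_def[abs_def]
  proof (intro borel_measurable_sum)
    fix i assume "i \<in> {..<n}"
    then have i: "i < n" by simp
    note [measurable] = k[OF i] measurable_sample_component[OF v'(2) \<open>i \<in> {..<n}\<close>]
    show "(\<lambda>d. ennreal ((k i d)\<^sup>2) * v' (d i)) \<in> borel_measurable (PiM {..<n} (\<lambda>_. N))" by measurable
  qed
  have q: "q i \<in> borel_measurable (PiM {..<n} (\<lambda>_. N))" if "i < n" for i
  proof -
    note [measurable] = k[OF that]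
    show ?thesis unfolding q_def[abs_def] by measurable
  qed
  have lift [measurable]: "lift n \<in> measurable \<Omega> (PiM {..<n} (\<lambda>_. N))"
    unfolding \<Omega>_def by (rule measurable_lift)
  \<comment> \<open>The bound holds pointwise: the sum equals \<open>b\<close> on the good event and
    0 elsewhere, since 0 times infinity is 0 in \<open>ennreal\<close>. It is therefore finite even
    if \<open>v\<close> takes the value infinity.\<close>
  have qv: "(\<integral>\<^sup>+\<omega>. (\<Sum>i<n. ennreal ((q i (lift n \<omega>))\<^sup>2) * v (\<omega> i)) \<partial>\<Omega>) \<le> ennreal \<delta>"
  proof -
    have "(\<Sum>i<n. ennreal ((q i (lift n \<omega>))\<^sup>2) * v (\<omega> i)) \<le> ennreal \<delta>" for \<omega>
      using b_eq[of \<omega>] by (cases "b (lift n \<omega>) \<le> ennreal \<delta>") (simp_all add: q_def)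
    then have "(\<integral>\<^sup>+\<omega>. (\<Sum>i<n. ennreal ((q i (lift n \<omega>))\<^sup>2) * v (\<omega> i)) \<partial>\<Omega>) \<le> (\<integral>\<^sup>+\<omega>. ennreal \<delta> \<partial>\<Omega>)"
      by (intro nn_integral_mono)
    then show ?thesis by (simp add: \<Omega>.emeasure_space_1)
  qed
  have meas_qv: "(\<lambda>\<omega>. ennreal ((q i (lift n \<omega>))\<^sup>2) * v (\<omega> i)) \<in> borel_measurable \<Omega>" if "i < n" for i
  proof -
    note [measurable] = q[OF that] comp[OF that]
    show ?thesis by measurable
  qed
  have sum_qv: "(\<Sum>i<n. \<integral>\<^sup>+\<omega>. ennreal ((q i (lift n \<omega>))\<^sup>2) * v (\<omega> i) \<partial>\<Omega>) \<le> ennreal \<delta>"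
    using qv by (subst nn_integral_sum[symmetric]) (use meas_qv in auto)
  have meas_q: "(\<lambda>\<omega>. q i (lift n \<omega>) * \<xi> (\<omega> i)) \<in> borel_measurable \<Omega>" if "i < n" for i
  proof -
    note [measurable] = q[OF that] comp[OF that]
    show ?thesis by measurable
  qed
  have good: "q i (lift n \<omega>) = k i (lift n \<omega>)" if "\<not> ennreal \<delta> < b (lift n \<omega>)" for i \<omega>
    using that by (simp add: q_def not_less)
  have B_meas: "{\<omega> \<in> space \<Omega>. b (lift n \<omega>) > ennreal \<delta>} \<in> sets \<Omega>" by measurable
  have split: "measure \<Omega> {\<omega> \<in> space \<Omega>. G \<omega>} \<le> measure \<Omega> {\<omega> \<in> space \<Omega>. b (lift n \<omega>) > ennreal \<delta>} + e"
    if sub: "\<And>\<omega>. G \<omega> \<Longrightarrow> \<not> ennreal \<delta> < b (lift n \<omega>) \<Longrightarrow> H \<omega>"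
      and H: "{\<omega> \<in> space \<Omega>. H \<omega>} \<in> sets \<Omega>" "measure \<Omega> {\<omega> \<in> space \<Omega>. H \<omega>} \<le> e" for G H e
  proof -
    have "measure \<Omega> {\<omega> \<in> space \<Omega>. G \<omega>} \<le> measure \<Omega> ({\<omega> \<in> space \<Omega>. b (lift n \<omega>) > ennreal \<delta>} \<union> {\<omega> \<in> space \<Omega>. H \<omega>})"
      by (rule \<Omega>.finite_measure_mono) (use sub B_meas H in auto)
    also have "\<dots> \<le> measure \<Omega> {\<omega> \<in> space \<Omega>. b (lift n \<omega>) > ennreal \<delta>} + measure \<Omega> {\<omega> \<in> space \<Omega>. H \<omega>}"
      by (rule measure_Un_le[OF B_meas H(1)])
    finally show ?thesis using H(2) by linarith
  qed
  have m1: "(\<lambda>\<omega>. \<Sum>i<n. q i (lift n \<omega>) * \<xi> (\<omega> i)) \<in> borel_measurable \<Omega>"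
    by (intro borel_measurable_sum meas_q) auto
  have m2: "(\<lambda>\<omega>. \<Sum>i<n. (q i (lift n \<omega>) * \<xi> (\<omega> i))\<^sup>2) \<in> borel_measurable \<Omega>"
    by (intro borel_measurable_sum borel_measurable_power meas_q) auto
  show "measure \<Omega> {\<omega> \<in> space \<Omega>. \<bar>\<Sum>i<n. k i (lift n \<omega>) * \<xi> (\<omega> i)\<bar> > s}
      \<le> measure \<Omega> {\<omega> \<in> space \<Omega>. (\<Sum>i<n. ennreal ((k i (lift n \<omega>))\<^sup>2) * v (\<omega> i)) > ennreal \<delta>} + \<delta> / s\<^sup>2"
    unfolding b_eq[symmetric]
  proof (rule split[of _ "\<lambda>\<omega>. \<bar>\<Sum>i<n. q i (lift n \<omega>) * \<xi> (\<omega> i)\<bar> > s"])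
    show "{\<omega> \<in> space \<Omega>. \<bar>\<Sum>i<n. q i (lift n \<omega>) * \<xi> (\<omega> i)\<bar> > s} \<in> sets \<Omega>"
      using m1 by measurable
    show "measure \<Omega> {\<omega> \<in> space \<Omega>. \<bar>\<Sum>i<n. q i (lift n \<omega>) * \<xi> (\<omega> i)\<bar> > s} \<le> \<delta> / s\<^sup>2"
    proof (rule \<Omega>.prob_abs_gt_le_nn_integral_square[OF m1 _ _ s])
      show "(\<integral>\<^sup>+\<omega>. ennreal ((\<Sum>i<n. q i (lift n \<omega>) * \<xi> (\<omega> i))\<^sup>2) \<partial>\<Omega>) \<le> ennreal \<delta>"
        using sum_qv unfolding \<Omega>_def by (intro nn_integral_square_noise_sum_le q) auto
    qed (use \<delta> in simp)
  qed (simp add: good)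
  show "measure \<Omega> {\<omega> \<in> space \<Omega>. (\<Sum>i<n. (k i (lift n \<omega>) * \<xi> (\<omega> i))\<^sup>2) > s}
      \<le> measure \<Omega> {\<omega> \<in> space \<Omega>. (\<Sum>i<n. ennreal ((k i (lift n \<omega>))\<^sup>2) * v (\<omega> i)) > ennreal \<delta>} + \<delta> / s"
    unfolding b_eq[symmetric]
  proof (rule split[of _ "\<lambda>\<omega>. ennreal (\<Sum>i<n. (q i (lift n \<omega>) * \<xi> (\<omega> i))\<^sup>2) > ennreal s"])
    let ?f = "\<lambda>\<omega>. ennreal (\<Sum>i<n. (q i (lift n \<omega>) * \<xi> (\<omega> i))\<^sup>2)"
    have m2e: "?f \<in> borel_measurable \<Omega>" using m2 by measurable
    show "{\<omega> \<in> space \<Omega>. ?f \<omega> > ennreal s} \<in> sets \<Omega>"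
      using m2e by measurable
    show "measure \<Omega> {\<omega> \<in> space \<Omega>. ?f \<omega> > ennreal s} \<le> \<delta> / s"
    proof (rule \<Omega>.prob_gt_le_nn_integral[OF m2e _ _ s])
      have "(\<integral>\<^sup>+\<omega>. ?f \<omega> \<partial>\<Omega>) = (\<integral>\<^sup>+\<omega>. (\<Sum>i<n. ennreal ((q i (lift n \<omega>) * \<xi> (\<omega> i))\<^sup>2)) \<partial>\<Omega>)"
        by (intro nn_integral_cong sum_ennreal[symmetric]) simp
      also have "\<dots> = (\<Sum>i<n. \<integral>\<^sup>+\<omega>. ennreal ((q i (lift n \<omega>) * \<xi> (\<omega> i))\<^sup>2) \<partial>\<Omega>)"
        by (rule nn_integral_sum) (use meas_q in \<open>auto intro!: measurable_compose[OF _ measurable_ennreal] borel_measurable_power\<close>)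
      also have "\<dots> = (\<Sum>i<n. \<integral>\<^sup>+\<omega>. ennreal ((q i (lift n \<omega>))\<^sup>2) * v (\<omega> i) \<partial>\<Omega>)"
      proof (rule sum.cong[OF refl])
        fix i assume "i \<in> {..<n}"
        then have i: "i < n" by simp
        note [measurable] = q[OF i]
        show "(\<integral>\<^sup>+\<omega>. ennreal ((q i (lift n \<omega>) * \<xi> (\<omega> i))\<^sup>2) \<partial>\<Omega>) = (\<integral>\<^sup>+\<omega>. ennreal ((q i (lift n \<omega>))\<^sup>2) * v (\<omega> i) \<partial>\<Omega>)"
          using nn_integral_noise_square[OF i, of "\<lambda>d. ennreal ((q i d)\<^sup>2)"]
          unfolding \<Omega>_def power_mult_distrib by (simp add: ennreal_mult')
      qed
      finally show "(\<integral>\<^sup>+\<omega>. ?f \<omega> \<partial>\<Omega>) \<le> ennreal \<delta>" using sum_qv by simp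
    qed (use \<delta> in simp)
  qed (use s in \<open>simp add: good ennreal_less_iff\<close>)
qed

end

text \<open>Outside \<open>E\<close> the event T \<le> t lies between S \<le> t - \<kappa> and S
  \<le> t + \<kappa>; moving \<open>Phi\<close> back from these points to t costs at most \<kappa>
  by the Lipschitz bound.\<close>

lemma (in prob_space) normal_approx_perturb:
  fixes S T :: "'a \<Rightarrow> real"
  assumes S [measurable]: "S \<in> borel_measurable M" and T [measurable]: "T \<in> borel_measurable M"
    and E: "E \<in> events" "prob E \<le> e1" and close: "\<And>x. x \<in> space M \<Longrightarrow> x \<notin> E \<Longrightarrow> \<bar>T x - S x\<bar> \<le> \<kappa>" and \<kappa>: "0 \<le> \<kappa>"
    and S_approx: "\<And>t. \<bar>prob {x \<in> space M. S x \<le> t} - Phi t\<bar> \<le> e2"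
  shows "\<bar>prob {x \<in> space M. T x \<le> t} - Phi t\<bar> \<le> e1 + e2 + \<kappa>"
proof -
  have "prob {x \<in> space M. T x \<le> t} \<le> prob ({x \<in> space M. S x \<le> t + \<kappa>} \<union> E)"
    using close E by (intro finite_measure_mono) force+
  also have "\<dots> \<le> prob {x \<in> space M. S x \<le> t + \<kappa>} + prob E"
    using E by (intro measure_Un_le) auto
  finally have 1: "prob {x \<in> space M. T x \<le> t} \<le> prob {x \<in> space M. S x \<le> t + \<kappa>} + prob E" .
  have "prob {x \<in> space M. S x \<le> t - \<kappa>} \<le> prob ({x \<in> space M. T x \<le> t} \<union> E)"
    using close E by (intro finite_measure_mono) force+
  also have "\<dots> \<le> prob {x \<in> space M. T x \<le> t} + prob E"
    using E by (intro measure_Un_le) auto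
  finally have 2: "prob {x \<in> space M. S x \<le> t - \<kappa>} \<le> prob {x \<in> space M. T x \<le> t} + prob E" .
  show ?thesis
    using 1 2 E(2) S_approx[of "t + \<kappa>"] S_approx[of "t - \<kappa>"] Phi_lipschitz[of t "t + \<kappa>"] Phi_lipschitz[of "t - \<kappa>" t] \<kappa>
    by linarith
qed

text \<open>A deterministic statement: \<open>U\<close> is the leading part with empirical second
  moment near 1 and \<open>D\<close> the remainder. The numerator moves by at most \<rho>, but the
  error of the denominator is multiplied by the leading sum, which is why a bound \<open>M\<close>
  on that sum is required.\<close>

lemma studentized_close:
  fixes U D :: "nat \<Rightarrow> real" and n :: nat and \<rho> M :: real
  assumes n: "0 < n" and \<rho>: "0 < \<rho>" "\<rho> \<le> 1 / 14" and M: "0 \<le> M"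
    and D1: "\<bar>\<Sum>i<n. D i\<bar> / sqrt (real n) \<le> \<rho>" and D2: "(\<Sum>i<n. (D i)\<^sup>2) / real n \<le> \<rho>\<^sup>2"
    and S: "\<bar>\<Sum>i<n. U i\<bar> / sqrt (real n) \<le> M" and U2: "\<bar>(\<Sum>i<n. (U i)\<^sup>2) / real n - 1\<bar> \<le> \<rho>"
    and nM: "(M + 1)\<^sup>2 / real n \<le> \<rho>"
  defines "R i \<equiv> U i + D i"
  shows "\<bar>((\<Sum>i<n. R i) / sqrt (real n)) / sqrt ((\<Sum>i<n. (R i)\<^sup>2) / real n - ((\<Sum>i<n. R i) / real n)\<^sup>2)
      - (\<Sum>i<n. U i) / sqrt (real n)\<bar> \<le> 2 * \<rho> + 14 * M * \<rho>"
proof -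
  define tN where "tN = (\<Sum>i<n. R i) / sqrt (real n)"
  define s where "s = (\<Sum>i<n. U i) / sqrt (real n)"
  define d where "d = (\<Sum>i<n. (R i)\<^sup>2) / real n - ((\<Sum>i<n. R i) / real n)\<^sup>2"
  have sM: "\<bar>s\<bar> \<le> M" using S by (simp add: s_def)
  have tNs: "\<bar>tN - s\<bar> \<le> \<rho>"
  proof -
    have "tN - s = (\<Sum>i<n. D i) / sqrt (real n)"
      by (simp add: tN_def s_def R_def sum.distrib add_divide_distrib)
    then show ?thesis using D1 by simp
  qed
  have "((\<Sum>i<n. R i) / real n)\<^sup>2 = tN\<^sup>2 / real n"
    using n by (simp add: tN_def power_divide power2_eq_square)
  moreover have "tN\<^sup>2 \<le> (M + 1)\<^sup>2"
    using sM tNs \<rho> by (intro power2_le_iff_abs_le[THEN iffD2]) auto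
  ultimately have mean: "((\<Sum>i<n. R i) / real n)\<^sup>2 \<le> \<rho>"
    using nM n by (simp add: divide_right_mono order_trans[OF divide_right_mono nM])
  \<comment> \<open>Cauchy-Schwarz with the crude bound 4 for the mean square of \<open>U\<close>
    and \<rho>^2 for that of \<open>D\<close>.\<close>
  have UD: "\<bar>(\<Sum>i<n. U i * D i) / real n\<bar> \<le> 2 * \<rho>"
  proof -
    have "(\<Sum>i<n. U i * D i)\<^sup>2 \<le> (\<Sum>i<n. (U i)\<^sup>2) * (\<Sum>i<n. (D i)\<^sup>2)"
      by (rule Cauchy_Schwarz_ineq_sum)
    then have "((\<Sum>i<n. U i * D i) / real n)\<^sup>2 \<le> ((\<Sum>i<n. (U i)\<^sup>2) / real n) * ((\<Sum>i<n. (D i)\<^sup>2) / real n)"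
      using n by (simp add: power_divide power2_eq_square divide_right_mono)
    also have "\<dots> \<le> 4 * \<rho>\<^sup>2"
      using U2 D2 \<rho> by (intro mult_mono) (auto intro!: sum_nonneg divide_nonneg_nonneg)
    also have "\<dots> = (2 * \<rho>)\<^sup>2" by (simp add: power_mult_distrib)
    finally show ?thesis using \<rho> by (intro power2_le_iff_abs_le[THEN iffD1]) auto
  qed
  have "\<rho>\<^sup>2 \<le> \<rho>" using \<rho> by (simp add: power2_eq_square mult_left_le)
  moreover have "0 \<le> (\<Sum>i<n. (D i)\<^sup>2) / real n" by (intro divide_nonneg_nonneg sum_nonneg) auto
  moreover have "(\<Sum>i<n. (R i)\<^sup>2) / real n = (\<Sum>i<n. (U i)\<^sup>2) / real n + 2 * ((\<Sum>i<n. U i * D i) / real n) + (\<Sum>i<n. (D i)\<^sup>2) / real n"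
    by (simp add: R_def power2_sum sum.distrib add_divide_distrib mult.assoc flip: sum_distrib_left)
  \<comment> \<open>The 7 adds up \<rho> from the squares of \<open>U\<close>, twice 2\<rho> from
    the mixed term, \<rho> from the squares of \<open>D\<close> and \<rho> from the squared mean.
    With \<rho> \<le> 1/14 this keeps \<open>d\<close> at or above 1/2.\<close>
  ultimately have d1: "\<bar>d - 1\<bar> \<le> 7 * \<rho>"
    using U2 UD D2 mean zero_le_power2[of "(\<Sum>i<n. R i) / real n"] unfolding d_def by linarith
  then have d0: "1 / 2 \<le> d" using \<rho> by linarith
  define r where "r = sqrt d"
  have r: "r\<^sup>2 = d" "0 \<le> r" using d0 by (auto simp: r_def)
  have r2: "1 / 2 \<le> r"
  proof (rule ccontr)
    assume "\<not> 1 / 2 \<le> r"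
    then have "r\<^sup>2 \<le> (1 / 2)\<^sup>2" using r by (intro power_mono) auto
    then show False using r d0 by (simp add: power2_eq_square)
  qed
  have "\<bar>r - 1\<bar> * 1 \<le> \<bar>r - 1\<bar> * (r + 1)" using r by (intro mult_left_mono) auto
  also have "\<dots> = \<bar>d - 1\<bar>"
  proof -
    have "d - 1 = (r - 1) * (r + 1)" using r(1) by (simp add: power2_eq_square algebra_simps)
    then show ?thesis using r by (simp add: abs_mult)
  qed
  finally have r1: "\<bar>r - 1\<bar> \<le> 7 * \<rho>" using d1 by simp
  \<comment> \<open>Separates the error of the numerator from that of the denominator. Division by r
    \<ge> 1/2 doubles \<rho> + 7 M \<rho>, which is the final bound.\<close>
  have "tN / r - s = ((tN - s) + s * (1 - r)) / r" using r2 by (simp add: field_simps)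
  then have "\<bar>tN / r - s\<bar> = \<bar>(tN - s) + s * (1 - r)\<bar> / r" using r by simp
  also have "\<dots> \<le> (\<rho> + M * (7 * \<rho>)) / (1 / 2)"
  proof (rule frac_le)
    have "\<bar>s * (1 - r)\<bar> \<le> M * (7 * \<rho>)"
      unfolding abs_mult using sM r1 M by (intro mult_mono) (auto simp: abs_minus_commute)
    then show "\<bar>(tN - s) + s * (1 - r)\<bar> \<le> \<rho> + M * (7 * \<rho>)" using tNs by linarith
  qed (use r2 \<rho> M in auto)
  finally show ?thesis by (simp add: tN_def s_def r_def d_def algebra_simps)
qed

text \<open>The point where conditional independence is used: the residual of \<open>Y\<close> given
  Z alone remains centred, with unchanged conditional variance, when \<open>X\<close> is observed as
  well. Weights may therefore depend on \<open>X\<close>.\<close>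

lemma (in cond_indep_given) centred_noise_residual:
  assumes Y: "integrable M Y" and [measurable]: "g \<in> borel_measurable borel" "v \<in> borel_measurable borel"
    and g: "AE \<omega> in M. real_cond_exp M F Y \<omega> = g (Z \<omega>)"
    and v: "AE \<omega> in M. nn_cond_exp M F (\<lambda>\<omega>. ennreal ((Y \<omega> - g (Z \<omega>))\<^sup>2)) \<omega> = v (Z \<omega>)"
  shows "centred_noise M borel (\<lambda>\<omega>. (X \<omega>, Z \<omega>)) (\<lambda>\<omega>. Y \<omega> - g (Z \<omega>)) (\<lambda>\<omega>. v (Z \<omega>))"
proof
  show "(\<lambda>\<omega>. (X \<omega>, Z \<omega>)) \<in> measurable M borel" unfolding borel_prod[symmetric] by measurable
  show "(\<lambda>\<omega>. Y \<omega> - g (Z \<omega>)) \<in> borel_measurable M" "(\<lambda>\<omega>. v (Z \<omega>)) \<in> borel_measurable M" by measurable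
  fix h :: "real \<times> 'z \<Rightarrow> real" assume h: "h \<in> borel_measurable borel"
    and "integrable M (\<lambda>\<omega>. h (X \<omega>, Z \<omega>) * (Y \<omega> - g (Z \<omega>)))"
  then show "(\<integral>\<omega>. h (X \<omega>, Z \<omega>) * (Y \<omega> - g (Z \<omega>)) \<partial>M) = 0"
    by (intro integral_residual_eq_0 Y g) (simp_all add: borel_prod)
next
  fix h :: "real \<times> 'z \<Rightarrow> ennreal" assume "h \<in> borel_measurable borel"
  then have h: "h \<in> borel_measurable (borel \<Otimes>\<^sub>M borel)" by (simp add: borel_prod)
  have "(\<integral>\<^sup>+\<omega>. h (X \<omega>, Z \<omega>) * ennreal ((Y \<omega> - g (Z \<omega>))\<^sup>2) \<partial>M)
      = (\<integral>\<^sup>+\<omega>. h (X \<omega>, Z \<omega>) * nn_cond_exp M F (\<lambda>\<omega>. ennreal ((Y \<omega> - g (Z \<omega>))\<^sup>2)) \<omega> \<partial>M)"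
    using nn_integral_cond_indep[OF h, of "\<lambda>p. ennreal ((fst p - g (snd p))\<^sup>2)"] by simp
  also have "\<dots> = (\<integral>\<^sup>+\<omega>. h (X \<omega>, Z \<omega>) * v (Z \<omega>) \<partial>M)"
    by (rule nn_integral_cong_AE) (use v in auto)
  finally show "(\<integral>\<^sup>+\<omega>. h (X \<omega>, Z \<omega>) * ennreal ((Y \<omega> - g (Z \<omega>))\<^sup>2) \<partial>M) = (\<integral>\<^sup>+\<omega>. h (X \<omega>, Z \<omega>) * v (Z \<omega>) \<partial>M)" .
qed

lemma measurable_regression_error:
  fixes X :: "'a \<Rightarrow> real" and Z :: "'a \<Rightarrow> 'z::euclidean_space" and fhat :: "(nat \<Rightarrow> real \<times> 'z) \<Rightarrow> 'z \<Rightarrow> real"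
  assumes X: "X \<in> borel_measurable M" and Z: "Z \<in> borel_measurable M" and f: "f \<in> borel_measurable borel"
    and fhat: "(\<lambda>(d, z). fhat d z) \<in> borel_measurable (PiM {..<n} (\<lambda>_. borel) \<Otimes>\<^sub>M borel)"
    and i: "i < n"
  shows "(\<lambda>\<omega>. f (Z (\<omega> i)) - fhat (\<lambda>i\<in>{..<n}. (X (\<omega> i), Z (\<omega> i))) (Z (\<omega> i))) \<in> borel_measurable (PiM {..<n} (\<lambda>_. M))"
proof -
  have Zi [measurable]: "(\<lambda>\<omega>. Z (\<omega> i)) \<in> borel_measurable (PiM {..<n} (\<lambda>_. M))"
    by (rule measurable_sample_component[OF Z]) (use i in simp)
  have "(\<lambda>\<omega>. (X (\<omega> j), Z (\<omega> j))) \<in> measurable (PiM {..<n} (\<lambda>_. M)) borel" if "j \<in> {..<n}" for j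
    unfolding borel_prod[symmetric] by (intro measurable_Pair measurable_sample_component X Z that)
  then have d [measurable]: "(\<lambda>\<omega>. \<lambda>i\<in>{..<n}. (X (\<omega> i), Z (\<omega> i))) \<in> measurable (PiM {..<n} (\<lambda>_. M)) (PiM {..<n} (\<lambda>_. borel))"
    by (intro measurable_restrict) auto
  have "(\<lambda>\<omega>. fhat (\<lambda>i\<in>{..<n}. (X (\<omega> i), Z (\<omega> i))) (Z (\<omega> i))) \<in> borel_measurable (PiM {..<n} (\<lambda>_. M))"
    using measurable_compose[OF measurable_Pair[OF d Zi] fhat] by simp
  moreover have "(\<lambda>\<omega>. f (Z (\<omega> i))) \<in> borel_measurable (PiM {..<n} (\<lambda>_. M))"
    by (rule measurable_compose[OF Zi f])
  ultimately show ?thesis by (intro borel_measurable_diff)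
qed

text \<open>With weights (f - f_hat) w / sqrt n the conditional variance of the noise sum is at most
  C^2 B_f, because |w| \<le> C. The event that it exceeds C^2 \<delta> thus lies in the event B_f >
  \<delta>, and the conditional Chebyshev bounds apply. Exchanging \<open>X\<close> and
  \<open>Y\<close> yields the corresponding bounds from B_g.\<close>

lemma
  fixes X Y :: "'a \<Rightarrow> real" and Z :: "'a \<Rightarrow> 'z::euclidean_space" and fhat :: "(nat \<Rightarrow> real \<times> 'z) \<Rightarrow> 'z \<Rightarrow> real"
    and v :: "'z \<Rightarrow> ennreal" and w :: "'z \<Rightarrow> real"
  assumes noise: "centred_noise M borel (\<lambda>\<omega>. (X \<omega>, Z \<omega>)) (\<lambda>\<omega>. Y \<omega> - g (Z \<omega>)) (\<lambda>\<omega>. v (Z \<omega>))"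
    and v: "v \<in> borel_measurable borel" and f: "f \<in> borel_measurable borel" and w: "w \<in> borel_measurable borel"
    and fhat: "(\<lambda>(d, z). fhat d z) \<in> borel_measurable (PiM {..<n} (\<lambda>_. borel) \<Otimes>\<^sub>M borel)"
    and n: "0 < n" and C: "0 < C" "\<And>z. \<bar>w z\<bar> \<le> C" and \<delta>: "0 < \<delta>" and s: "0 < s"
  defines "\<Omega> \<equiv> PiM {..<n} (\<lambda>_. M)"
    and "a \<equiv> \<lambda>\<omega> i. f (Z (\<omega> i)) - fhat (\<lambda>i\<in>{..<n}. (X (\<omega> i), Z (\<omega> i))) (Z (\<omega> i))"
  assumes B: "measure \<Omega> {\<omega> \<in> space \<Omega>. (\<Sum>i<n. ennreal ((a \<omega> i)\<^sup>2) * v (Z (\<omega> i))) / of_nat n > ennreal \<delta>} \<le> \<beta>"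
    and Z: "Z \<in> borel_measurable M" and X: "X \<in> borel_measurable M"
  shows regression_noise_sum: "measure \<Omega> {\<omega> \<in> space \<Omega>. \<bar>\<Sum>i<n. a \<omega> i * w (Z (\<omega> i)) * (Y (\<omega> i) - g (Z (\<omega> i)))\<bar> / sqrt (real n) > s} \<le> \<beta> + C\<^sup>2 * \<delta> / s\<^sup>2"
    and regression_noise_square_sum: "measure \<Omega> {\<omega> \<in> space \<Omega>. (\<Sum>i<n. (a \<omega> i * w (Z (\<omega> i)) * (Y (\<omega> i) - g (Z (\<omega> i))))\<^sup>2) / real n > s} \<le> \<beta> + C\<^sup>2 * \<delta> / s"
proof -
  interpret N: centred_noise M borel "\<lambda>\<omega>. (X \<omega>, Z \<omega>)" "\<lambda>\<omega>. Y \<omega> - g (Z \<omega>)" "\<lambda>\<omega>. v (Z \<omega>)" by (rule noise)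
  interpret \<Omega>: prob_space \<Omega> unfolding \<Omega>_def by (intro prob_space_PiM N.prob_space_axioms)
  \<comment> \<open>The factor 1 / sqrt n makes the noise sum the normalised sum and its sum of
    squares the empirical second moment, so one choice of weights serves both conclusions.\<close>
  define k where "k i d = (f (snd (d i)) - fhat d (snd (d i))) * w (snd (d i)) / sqrt (real n)" for i and d :: "nat \<Rightarrow> real \<times> 'z"
  have snd_b: "(snd :: real \<times> 'z \<Rightarrow> 'z) \<in> borel_measurable borel" unfolding borel_prod[symmetric] by measurable
  have k: "k i \<in> borel_measurable (PiM {..<n} (\<lambda>_. borel))" if i: "i < n" for i
  proof -
    have [measurable]: "(\<lambda>d. snd (d i)) \<in> measurable (PiM {..<n} (\<lambda>_. borel :: (real \<times> 'z) measure)) borel"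
      using measurable_sample_component[OF snd_b, of i "{..<n}"] i by simp
    note [measurable] = f w
    have "(\<lambda>d. fhat d (snd (d i))) \<in> borel_measurable (PiM {..<n} (\<lambda>_. borel))"
      using measurable_compose[OF measurable_Pair[OF measurable_ident_sets[OF refl]] fhat, of "\<lambda>d. snd (d i)"] by simp
    then show ?thesis unfolding k_def[abs_def] by measurable
  qed
  have v': "(\<lambda>p. v (snd p)) \<in> borel_measurable (borel :: (real \<times> 'z) measure)"
    by (rule measurable_compose[OF snd_b v])
  have lift: "N.lift n \<omega> = (\<lambda>i\<in>{..<n}. (X (\<omega> i), Z (\<omega> i)))" for \<omega> by (simp add: N.lift_def)
  have kl: "k i (N.lift n \<omega>) = a \<omega> i * w (Z (\<omega> i)) / sqrt (real n)" if "i < n" for i \<omega>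
    using that by (simp add: k_def lift a_def)
  have "(\<Sum>i<n. ennreal ((k i (N.lift n \<omega>))\<^sup>2) * v (Z (\<omega> i))) \<le> ennreal (C\<^sup>2) * ((\<Sum>i<n. ennreal ((a \<omega> i)\<^sup>2) * v (Z (\<omega> i))) / of_nat n)" for \<omega>
  proof -
    have "ennreal ((k i (N.lift n \<omega>))\<^sup>2) * v (Z (\<omega> i)) \<le> ennreal (C\<^sup>2 / real n) * (ennreal ((a \<omega> i)\<^sup>2) * v (Z (\<omega> i)))" if i: "i < n" for i
    proof -
      have "(w (Z (\<omega> i)))\<^sup>2 \<le> C\<^sup>2" using C by (simp add: power2_le_iff_abs_le)
      then have "(a \<omega> i)\<^sup>2 * (w (Z (\<omega> i)))\<^sup>2 / real n \<le> (a \<omega> i)\<^sup>2 * C\<^sup>2 / real n"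
        by (intro divide_right_mono mult_left_mono) auto
      then have "(k i (N.lift n \<omega>))\<^sup>2 \<le> C\<^sup>2 / real n * (a \<omega> i)\<^sup>2"
        using n by (simp add: kl[OF i] power_divide power_mult_distrib mult.commute)
      then have "ennreal ((k i (N.lift n \<omega>))\<^sup>2) \<le> ennreal (C\<^sup>2 / real n) * ennreal ((a \<omega> i)\<^sup>2)"
        by (subst ennreal_mult[symmetric]) (auto intro: ennreal_leI)
      then show ?thesis unfolding mult.assoc[symmetric] by (rule mult_right_mono) simp
    qed
    then have "(\<Sum>i<n. ennreal ((k i (N.lift n \<omega>))\<^sup>2) * v (Z (\<omega> i))) \<le> ennreal (C\<^sup>2 / real n) * (\<Sum>i<n. ennreal ((a \<omega> i)\<^sup>2) * v (Z (\<omega> i)))"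
      unfolding sum_distrib_left by (intro sum_mono) auto
    also have "ennreal (C\<^sup>2 / real n) = ennreal (C\<^sup>2) / of_nat n"
      using n by (simp add: divide_ennreal ennreal_of_nat_eq_real_of_nat)
    finally show ?thesis by (simp add: divide_ennreal_def mult_ac)
  qed
  then have "\<not> ennreal \<delta> < (\<Sum>i<n. ennreal ((a \<omega> i)\<^sup>2) * v (Z (\<omega> i))) / of_nat n \<Longrightarrow>
     (\<Sum>i<n. ennreal ((k i (N.lift n \<omega>))\<^sup>2) * v (Z (\<omega> i))) \<le> ennreal (C\<^sup>2 * \<delta>)" for \<omega>
    using C \<delta> by (simp add: ennreal_mult not_less) (meson mult_left_mono order_trans zero_le)
  then have sub: "{\<omega> \<in> space \<Omega>. (\<Sum>i<n. ennreal ((k i (N.lift n \<omega>))\<^sup>2) * v (Z (\<omega> i))) > ennreal (C\<^sup>2 * \<delta>)}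
     \<subseteq> {\<omega> \<in> space \<Omega>. (\<Sum>i<n. ennreal ((a \<omega> i)\<^sup>2) * v (Z (\<omega> i))) / of_nat n > ennreal \<delta>}"
    by (auto simp: not_less[symmetric])
  have "{\<omega> \<in> space \<Omega>. (\<Sum>i<n. ennreal ((a \<omega> i)\<^sup>2) * v (Z (\<omega> i))) / of_nat n > ennreal \<delta>} \<in> sets \<Omega>"
  proof -
    have "(\<lambda>\<omega>. \<Sum>i<n. ennreal ((a \<omega> i)\<^sup>2) * v (Z (\<omega> i))) \<in> borel_measurable \<Omega>"
    proof (rule borel_measurable_sum)
      fix i assume i: "i \<in> {..<n}"
      then have [measurable]: "(\<lambda>\<omega>. a \<omega> i) \<in> borel_measurable \<Omega>"
        unfolding a_def \<Omega>_def by (intro measurable_regression_error X Z f fhat) simp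
      have [measurable]: "(\<lambda>\<omega>. v (Z (\<omega> i))) \<in> borel_measurable \<Omega>"
        unfolding \<Omega>_def by (rule measurable_sample_component[OF measurable_compose[OF Z v] i])
      show "(\<lambda>\<omega>. ennreal ((a \<omega> i)\<^sup>2) * v (Z (\<omega> i))) \<in> borel_measurable \<Omega>" by measurable
    qed
    then show ?thesis by measurable
  qed
  from \<Omega>.finite_measure_mono[OF sub this] B
  have le: "measure \<Omega> {\<omega> \<in> space \<Omega>. (\<Sum>i<n. ennreal ((k i (N.lift n \<omega>))\<^sup>2) * v (Z (\<omega> i))) > ennreal (C\<^sup>2 * \<delta>)} \<le> \<beta>"
    by linarith
  have v1: "(\<lambda>\<omega>. v (Z \<omega>)) = (\<lambda>\<omega>. v (snd (X \<omega>, Z \<omega>)))" by simp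
  have C\<delta>: "0 < C\<^sup>2 * \<delta>" using C \<delta> by simp
  have eq1: "(\<Sum>i<n. k i (N.lift n \<omega>) * (Y (\<omega> i) - g (Z (\<omega> i)))) = (\<Sum>i<n. a \<omega> i * w (Z (\<omega> i)) * (Y (\<omega> i) - g (Z (\<omega> i)))) / sqrt (real n)" for \<omega>
    unfolding sum_divide_distrib by (intro sum.cong) (auto simp: kl)
  have eq2: "(\<Sum>i<n. (k i (N.lift n \<omega>) * (Y (\<omega> i) - g (Z (\<omega> i))))\<^sup>2) = (\<Sum>i<n. (a \<omega> i * w (Z (\<omega> i)) * (Y (\<omega> i) - g (Z (\<omega> i))))\<^sup>2) / real n" for \<omega>
    unfolding sum_divide_distrib by (intro sum.cong) (auto simp: kl power_divide power_mult_distrib)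
  show "measure \<Omega> {\<omega> \<in> space \<Omega>. \<bar>\<Sum>i<n. a \<omega> i * w (Z (\<omega> i)) * (Y (\<omega> i) - g (Z (\<omega> i)))\<bar> / sqrt (real n) > s} \<le> \<beta> + C\<^sup>2 * \<delta> / s\<^sup>2"
    using N.prob_noise_sum_le[where v' = "\<lambda>p. v (snd p)" and k = k, OF v1 v' k C\<delta> s] le unfolding \<Omega>_def[symmetric] snd_conv eq1 by simp
  show "measure \<Omega> {\<omega> \<in> space \<Omega>. (\<Sum>i<n. (a \<omega> i * w (Z (\<omega> i)) * (Y (\<omega> i) - g (Z (\<omega> i))))\<^sup>2) / real n > s} \<le> \<beta> + C\<^sup>2 * \<delta> / s"
    using N.prob_noise_square_sum_le[where v' = "\<lambda>p. v (snd p)" and k = k, OF v1 v' k C\<delta> s] le unfolding \<Omega>_def[symmetric] snd_conv eq2 by simp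
qed

text \<open>The statistic as a functional of the residual products alone, which turns scaling and
  perturbation into deterministic statements about sequences.\<close>

definition studentized :: "(nat \<Rightarrow> real) \<Rightarrow> nat \<Rightarrow> real" where
  "studentized r n = ((\<Sum>i<n. r i) / sqrt (real n)) / sqrt ((\<Sum>i<n. (r i)\<^sup>2) / real n - ((\<Sum>i<n. r i) / real n)\<^sup>2)"

lemma Tstat_eq_studentized: "Tstat fh gh w n \<omega> a = studentized (Rres fh gh w n \<omega> a) n"
  by (simp add: Tstat_def tauN_def tauD_def studentized_def)

text \<open>Numerator and denominator both scale by \<open>c\<close>; positivity is essential, as a
  negative factor would flip the sign. It allows the weight \<open>w\<close> to be replaced by w /
  \<sigma>.\<close>

lemma studentized_scale:
  assumes "0 < c" shows "studentized (\<lambda>i. c * r i) n = studentized r n"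
proof -
  have "(\<Sum>i<n. (c * r i)\<^sup>2) / real n - ((\<Sum>i<n. c * r i) / real n)\<^sup>2
     = c\<^sup>2 * ((\<Sum>i<n. (r i)\<^sup>2) / real n - ((\<Sum>i<n. r i) / real n)\<^sup>2)"
    by (simp add: power_mult_distrib right_diff_distrib power_divide flip: sum_distrib_left)
  then show ?thesis
    using assms unfolding studentized_def by (simp add: real_sqrt_mult flip: sum_distrib_left)
qed

lemma measurable_studentized:
  assumes [measurable]: "\<And>i. i < n \<Longrightarrow> (\<lambda>x. r x i) \<in> borel_measurable M"
  shows "(\<lambda>x. studentized (r x) n) \<in> borel_measurable M"
proof -
  have [measurable]: "(\<lambda>x. \<Sum>i<n. r x i) \<in> borel_measurable M" "(\<lambda>x. \<Sum>i<n. (r x i)\<^sup>2) \<in> borel_measurable M"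
    by (intro borel_measurable_sum borel_measurable_power assms; simp)+
  show ?thesis unfolding studentized_def by measurable
qed

lemma (in finite_measure) measure_Un_bound:
  assumes "A \<in> sets M \<and> measure M A \<le> a" "B \<in> sets M \<and> measure M B \<le> b"
  shows "A \<union> B \<in> sets M \<and> measure M (A \<union> B) \<le> a + b"
  using assms measure_Un_le[of A M B] by fastforce

lemma sum3_square_le:
  fixes x y z :: real
  shows "(x + y + z)\<^sup>2 \<le> 3 * (x\<^sup>2 + y\<^sup>2 + z\<^sup>2)"
proof -
  have "3 * (x\<^sup>2 + y\<^sup>2 + z\<^sup>2) - (x + y + z)\<^sup>2 = (x - y)\<^sup>2 + (y - z)\<^sup>2 + (x - z)\<^sup>2"
    by (simp add: power2_eq_square algebra_simps)
  then show ?thesis using zero_le_power2[of "x - y"] zero_le_power2[of "y - z"] zero_le_power2[of "x - z"] by linarith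
qed

text \<open>Here \<open>e\<close> and \<open>x\<close> stand for \<epsilon> and \<xi>. Each of the
  three remainder terms receives a third of the budget \<rho>, both for its normalised sum and,
  squared, for its empirical second moment.\<close>

lemma studentized_residuals_close:
  fixes a b e x w :: "nat \<Rightarrow> real"
  assumes n: "0 < n" and \<rho>: "0 < \<rho>" "\<rho> \<le> 1 / 14" and m: "0 \<le> m"
    and C: "0 < C" "\<And>i. \<bar>w i\<bar> \<le> C"
    and ab: "real n * ((\<Sum>i<n. (a i)\<^sup>2) / real n * ((\<Sum>i<n. (b i)\<^sup>2) / real n)) \<le> \<delta>" and \<delta>: "C\<^sup>2 * \<delta> \<le> (\<rho> / 3)\<^sup>2"
    and ax: "\<bar>\<Sum>i<n. a i * w i * x i\<bar> / sqrt (real n) \<le> \<rho> / 3" "(\<Sum>i<n. (a i * w i * x i)\<^sup>2) / real n \<le> (\<rho> / 3)\<^sup>2"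
    and be: "\<bar>\<Sum>i<n. b i * w i * e i\<bar> / sqrt (real n) \<le> \<rho> / 3" "(\<Sum>i<n. (b i * w i * e i)\<^sup>2) / real n \<le> (\<rho> / 3)\<^sup>2"
    and S: "\<bar>\<Sum>i<n. w i * e i * x i\<bar> / sqrt (real n) \<le> m"
    and U2: "\<bar>(\<Sum>i<n. (w i * e i * x i)\<^sup>2) / real n - 1\<bar> \<le> \<rho>"
    and nm: "(m + 1)\<^sup>2 / real n \<le> \<rho>"
  shows "\<bar>studentized (\<lambda>i. (e i + a i) * (x i + b i) * w i) n - (\<Sum>i<n. w i * e i * x i) / sqrt (real n)\<bar> \<le> 2 * \<rho> + 14 * m * \<rho>"
proof -
  define D1 where "D1 i = w i * a i * b i" for i
  define D2 where "D2 i = a i * w i * x i" for i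
  define D3 where "D3 i = b i * w i * e i" for i
  \<comment> \<open>This product bounds the squared sum of the \<open>D1 i\<close> by Cauchy-Schwarz
    and also the sum of their squares, so the rate of A_f A_g controls both.\<close>
  have wab: "(\<Sum>i<n. (w i * a i)\<^sup>2) * (\<Sum>i<n. (b i)\<^sup>2) \<le> C\<^sup>2 * \<delta> * real n"
  proof -
    have "(w i * a i)\<^sup>2 \<le> C\<^sup>2 * (a i)\<^sup>2" for i
      unfolding power_mult_distrib using C by (intro mult_right_mono) (auto simp: power2_le_iff_abs_le)
    then have "(\<Sum>i<n. (w i * a i)\<^sup>2) \<le> C\<^sup>2 * (\<Sum>i<n. (a i)\<^sup>2)"
      unfolding sum_distrib_left by (intro sum_mono)
    then have "(\<Sum>i<n. (w i * a i)\<^sup>2) * (\<Sum>i<n. (b i)\<^sup>2) \<le> C\<^sup>2 * (\<Sum>i<n. (a i)\<^sup>2) * (\<Sum>i<n. (b i)\<^sup>2)"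
      by (intro mult_right_mono sum_nonneg) auto
    also have "\<dots> = C\<^sup>2 * ((\<Sum>i<n. (a i)\<^sup>2) * (\<Sum>i<n. (b i)\<^sup>2))" by simp
    also have "(\<Sum>i<n. (a i)\<^sup>2) * (\<Sum>i<n. (b i)\<^sup>2) \<le> \<delta> * real n" using ab n by (simp add: field_simps)
    then have "C\<^sup>2 * ((\<Sum>i<n. (a i)\<^sup>2) * (\<Sum>i<n. (b i)\<^sup>2)) \<le> C\<^sup>2 * (\<delta> * real n)" by (intro mult_left_mono) auto
    finally show ?thesis by simp
  qed
  have CS: "(\<Sum>i<n. D1 i)\<^sup>2 \<le> C\<^sup>2 * \<delta> * real n"
    using Cauchy_Schwarz_ineq_sum[of "\<lambda>i. w i * a i" b "{..<n}"] wab unfolding D1_def by linarith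
  have D1a: "\<bar>\<Sum>i<n. D1 i\<bar> / sqrt (real n) \<le> \<rho> / 3"
  proof -
    have "((\<Sum>i<n. D1 i) / sqrt (real n))\<^sup>2 \<le> C\<^sup>2 * \<delta>" using CS n by (simp add: power_divide field_simps)
    also note \<delta>
    finally have "\<bar>(\<Sum>i<n. D1 i) / sqrt (real n)\<bar> \<le> \<rho> / 3" using \<rho> by (intro power2_le_iff_abs_le[THEN iffD1]) auto
    then show ?thesis by simp
  qed
  have D1b: "(\<Sum>i<n. (D1 i)\<^sup>2) / real n \<le> (\<rho> / 3)\<^sup>2"
  proof -
    have "(\<Sum>i<n. (D1 i)\<^sup>2) \<le> (\<Sum>i<n. (w i * a i)\<^sup>2 * (\<Sum>j<n. (b j)\<^sup>2))"
    proof (rule sum_mono)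
      fix i assume "i \<in> {..<n}"
      then have "(b i)\<^sup>2 \<le> (\<Sum>j<n. (b j)\<^sup>2)" by (intro member_le_sum) auto
      then show "(D1 i)\<^sup>2 \<le> (w i * a i)\<^sup>2 * (\<Sum>j<n. (b j)\<^sup>2)"
        unfolding D1_def power_mult_distrib[of "w i * a i"] by (intro mult_left_mono) auto
    qed
    also have "\<dots> \<le> C\<^sup>2 * \<delta> * real n" using wab by (simp add: sum_distrib_right)
    also have "\<dots> \<le> (\<rho> / 3)\<^sup>2 * real n" using \<delta> by (rule mult_right_mono) simp
    finally show ?thesis using n by (simp add: pos_divide_le_eq)
  qed
  have r: "(e i + a i) * (x i + b i) * w i = w i * e i * x i + (D1 i + D2 i + D3 i)" for i
    by (simp add: D1_def D2_def D3_def algebra_simps)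
  show ?thesis
    unfolding studentized_def r
  proof (rule studentized_close[OF n \<rho> m _ _ S U2 nm])
    have "\<bar>\<Sum>i<n. D1 i + D2 i + D3 i\<bar> \<le> \<bar>\<Sum>i<n. D1 i\<bar> + \<bar>\<Sum>i<n. D2 i\<bar> + \<bar>\<Sum>i<n. D3 i\<bar>"
      unfolding sum.distrib by linarith
    then have "\<bar>\<Sum>i<n. D1 i + D2 i + D3 i\<bar> / sqrt (real n)
       \<le> (\<bar>\<Sum>i<n. D1 i\<bar> + \<bar>\<Sum>i<n. D2 i\<bar> + \<bar>\<Sum>i<n. D3 i\<bar>) / sqrt (real n)" by (rule divide_right_mono) simp
    then show "\<bar>\<Sum>i<n. D1 i + D2 i + D3 i\<bar> / sqrt (real n) \<le> \<rho>"
      using D1a ax(1) be(1) unfolding add_divide_distrib D2_def[symmetric] D3_def[symmetric] by linarith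
    have "(\<Sum>i<n. (D1 i + D2 i + D3 i)\<^sup>2) \<le> (\<Sum>i<n. 3 * ((D1 i)\<^sup>2 + (D2 i)\<^sup>2 + (D3 i)\<^sup>2))"
      by (intro sum_mono sum3_square_le)
    also have "\<dots> = 3 * ((\<Sum>i<n. (D1 i)\<^sup>2) + (\<Sum>i<n. (D2 i)\<^sup>2) + (\<Sum>i<n. (D3 i)\<^sup>2))"
      by (simp add: sum.distrib flip: sum_distrib_left)
    finally have "(\<Sum>i<n. (D1 i + D2 i + D3 i)\<^sup>2) / real n \<le> 3 * ((\<Sum>i<n. (D1 i)\<^sup>2) + (\<Sum>i<n. (D2 i)\<^sup>2) + (\<Sum>i<n. (D3 i)\<^sup>2)) / real n"
      by (rule divide_right_mono) simp
    also have "\<dots> = 3 * ((\<Sum>i<n. (D1 i)\<^sup>2) / real n + (\<Sum>i<n. (D2 i)\<^sup>2) / real n + (\<Sum>i<n. (D3 i)\<^sup>2) / real n)"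
      by (simp add: add_divide_distrib)
    \<comment> \<open>The factor 3 from squaring three terms and the three thirds cancel exactly: 3
      * 3 * (\<rho>/3)^2 = \<rho>^2.\<close>
    also have "\<dots> \<le> 3 * ((\<rho> / 3)\<^sup>2 + (\<rho> / 3)\<^sup>2 + (\<rho> / 3)\<^sup>2)"
      using D1b ax(2) be(2) unfolding D2_def[symmetric] D3_def[symmetric] by (intro mult_left_mono add_mono) auto
    also have "\<dots> = \<rho>\<^sup>2" by (simp add: power_divide)
    finally show "(\<Sum>i<n. (D1 i + D2 i + D3 i)\<^sup>2) / real n \<le> \<rho>\<^sup>2" .
  qed
qed

text \<open>A non-asymptotic bound for one law, one weight and one sample size. Outside seven
  exceptional events the statistic is close to the normalised i.i.d. sum, which is close to normal
  by \<open>clt\<close>. The bound collects the probabilities of these events, the normal error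
  \<open>e2\<close> and the perturbation from \<open>studentized_residuals_close\<close>.\<close>

lemma gcm_normal_approx:
  fixes X Y :: "'a \<Rightarrow> real" and Z :: "'a \<Rightarrow> 'z::euclidean_space"
    and fhat ghat :: "(nat \<Rightarrow> real \<times> 'z) \<Rightarrow> 'z \<Rightarrow> real" and u v :: "'z \<Rightarrow> ennreal" and w :: "'z \<Rightarrow> real"
  assumes ci: "cond_indep_given M X Y Z F"
    and f: "integrable M X" "f \<in> borel_measurable borel" "AE \<omega> in M. real_cond_exp M F X \<omega> = f (Z \<omega>)"
    and g: "integrable M Y" "g \<in> borel_measurable borel" "AE \<omega> in M. real_cond_exp M F Y \<omega> = g (Z \<omega>)"
    and u: "u \<in> borel_measurable borel" "AE \<omega> in M. nn_cond_exp M F (\<lambda>\<omega>. ennreal ((X \<omega> - f (Z \<omega>))\<^sup>2)) \<omega> = u (Z \<omega>)"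
    and v: "v \<in> borel_measurable borel" "AE \<omega> in M. nn_cond_exp M F (\<lambda>\<omega>. ennreal ((Y \<omega> - g (Z \<omega>))\<^sup>2)) \<omega> = v (Z \<omega>)"
    and w: "w \<in> borel_measurable borel" and C: "0 < C" "\<And>z. \<bar>w z\<bar> \<le> C"
    and fhat: "(\<lambda>(d, z). fhat d z) \<in> borel_measurable (PiM {..<n} (\<lambda>_. borel) \<Otimes>\<^sub>M borel)"
    and ghat: "(\<lambda>(d, z). ghat d z) \<in> borel_measurable (PiM {..<n} (\<lambda>_. borel) \<Otimes>\<^sub>M borel)"
    and n: "0 < n" and \<rho>: "0 < \<rho>" "\<rho> \<le> 1 / 14" and m: "0 < m" "(m + 1)\<^sup>2 / real n \<le> \<rho>"
    and \<delta>: "0 < \<delta>" "C\<^sup>2 * \<delta> \<le> (\<rho> / 3)\<^sup>2"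
  defines "\<Omega> \<equiv> PiM {..<n} (\<lambda>_. M)"
    and "a \<equiv> \<lambda>\<omega> i. f (Z (\<omega> i)) - fhat (\<lambda>i\<in>{..<n}. (X (\<omega> i), Z (\<omega> i))) (Z (\<omega> i))"
    and "b \<equiv> \<lambda>\<omega> i. g (Z (\<omega> i)) - ghat (\<lambda>i\<in>{..<n}. (Y (\<omega> i), Z (\<omega> i))) (Z (\<omega> i))"
    and "U \<equiv> \<lambda>\<omega>. w (Z \<omega>) * (X \<omega> - f (Z \<omega>)) * (Y \<omega> - g (Z \<omega>))"
  assumes law: "lyapunov_law \<eta> K M U"
    and AA: "measure \<Omega> {\<omega> \<in> space \<Omega>. \<bar>real n * ((\<Sum>i<n. (a \<omega> i)\<^sup>2) / real n * ((\<Sum>i<n. (b \<omega> i)\<^sup>2) / real n))\<bar> > \<delta>} \<le> \<beta>"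
    and Bf: "measure \<Omega> {\<omega> \<in> space \<Omega>. (\<Sum>i<n. ennreal ((a \<omega> i)\<^sup>2) * v (Z (\<omega> i))) / of_nat n > ennreal \<delta>} \<le> \<beta>"
    and Bg: "measure \<Omega> {\<omega> \<in> space \<Omega>. (\<Sum>i<n. ennreal ((b \<omega> i)\<^sup>2) * u (Z (\<omega> i))) / of_nat n > ennreal \<delta>} \<le> \<beta>"
    and lln: "measure \<Omega> {\<omega> \<in> space \<Omega>. \<bar>(\<Sum>i<n. (U (\<omega> i))\<^sup>2) / real n - 1\<bar> > \<rho>} \<le> e1"
    and clt: "\<And>t. \<bar>measure \<Omega> {\<omega> \<in> space \<Omega>. (\<Sum>i<n. U (\<omega> i)) / sqrt (real n) \<le> t} - Phi t\<bar> \<le> e2"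
  shows "\<bar>measure \<Omega> {\<omega> \<in> space \<Omega>. studentized (\<lambda>i. (X (\<omega> i) - fhat (\<lambda>i\<in>{..<n}. (X (\<omega> i), Z (\<omega> i))) (Z (\<omega> i)))
        * (Y (\<omega> i) - ghat (\<lambda>i\<in>{..<n}. (Y (\<omega> i), Z (\<omega> i))) (Z (\<omega> i))) * w (Z (\<omega> i))) n \<le> t} - Phi t\<bar>
      \<le> (5 * \<beta> + 36 * (C\<^sup>2 * \<delta>) / \<rho>\<^sup>2 + 1 / m\<^sup>2 + e1) + e2 + (2 * \<rho> + 14 * m * \<rho>)"
proof -
  interpret XY: cond_indep_given M X Y Z F by (rule ci)
  interpret YX: cond_indep_given M Y X Z F by (rule cond_indep_given_commute[OF ci])
  have X: "X \<in> borel_measurable M" and Y: "Y \<in> borel_measurable M" and Z: "Z \<in> borel_measurable M"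
    by (fact XY.X XY.Y XY.Z)+
  interpret \<Omega>: prob_space \<Omega> unfolding \<Omega>_def by (intro prob_space_PiM XY.prob_space_axioms)
  have noiseY: "centred_noise M borel (\<lambda>\<omega>. (X \<omega>, Z \<omega>)) (\<lambda>\<omega>. Y \<omega> - g (Z \<omega>)) (\<lambda>\<omega>. v (Z \<omega>))"
    by (rule XY.centred_noise_residual[OF g(1,2) v(1) g(3) v(2)])
  have noiseX: "centred_noise M borel (\<lambda>\<omega>. (Y \<omega>, Z \<omega>)) (\<lambda>\<omega>. X \<omega> - f (Z \<omega>)) (\<lambda>\<omega>. u (Z \<omega>))"
    by (rule YX.centred_noise_residual[OF f(1,2) u(1) f(3) u(2)])
  define e where "e \<omega> i = X (\<omega> i) - f (Z (\<omega> i))" for \<omega> and i :: nat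
  define x where "x \<omega> i = Y (\<omega> i) - g (Z (\<omega> i))" for \<omega> and i :: nat
  define W where "W \<omega> i = w (Z (\<omega> i))" for \<omega> and i :: nat
  have am [measurable]: "(\<lambda>\<omega>. a \<omega> i) \<in> borel_measurable \<Omega>" if "i < n" for i
    unfolding a_def \<Omega>_def by (rule measurable_regression_error[OF X Z f(2) fhat that])
  have bm [measurable]: "(\<lambda>\<omega>. b \<omega> i) \<in> borel_measurable \<Omega>" if "i < n" for i
    unfolding b_def \<Omega>_def by (rule measurable_regression_error[OF Y Z g(2) ghat that])
  have eM: "(\<lambda>\<omega>. X \<omega> - f (Z \<omega>)) \<in> borel_measurable M" and xM: "(\<lambda>\<omega>. Y \<omega> - g (Z \<omega>)) \<in> borel_measurable M"
    and wM: "(\<lambda>\<omega>. w (Z \<omega>)) \<in> borel_measurable M"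
    using X Y Z f(2) g(2) w by measurable
  have em [measurable]: "(\<lambda>\<omega>. e \<omega> i) \<in> borel_measurable \<Omega>" if "i < n" for i
    unfolding e_def \<Omega>_def by (rule measurable_sample_component[OF eM]) (use that in simp)
  have xm [measurable]: "(\<lambda>\<omega>. x \<omega> i) \<in> borel_measurable \<Omega>" if "i < n" for i
    unfolding x_def \<Omega>_def by (rule measurable_sample_component[OF xM]) (use that in simp)
  have Wm [measurable]: "(\<lambda>\<omega>. W \<omega> i) \<in> borel_measurable \<Omega>" if "i < n" for i
    unfolding W_def \<Omega>_def by (rule measurable_sample_component[OF wM]) (use that in simp)
  have U: "U (\<omega> i) = W \<omega> i * e \<omega> i * x \<omega> i" for \<omega> and i :: nat by (simp add: U_def W_def e_def x_def)
  have sumM: "(\<lambda>\<omega>. \<Sum>i<n. h \<omega> i) \<in> borel_measurable \<Omega>" if "\<And>i. i < n \<Longrightarrow> (\<lambda>\<omega>. h \<omega> i) \<in> borel_measurable \<Omega>" for h :: "(nat \<Rightarrow> 'a) \<Rightarrow> nat \<Rightarrow> real"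
    by (intro borel_measurable_sum that) simp
  define S where "S \<omega> = (\<Sum>i<n. W \<omega> i * e \<omega> i * x \<omega> i) / sqrt (real n)" for \<omega>
  define T where "T \<omega> = studentized (\<lambda>i. (e \<omega> i + a \<omega> i) * (x \<omega> i + b \<omega> i) * W \<omega> i) n" for \<omega>
  have Sm: "S \<in> borel_measurable \<Omega>"
  proof -
    have [measurable]: "(\<lambda>\<omega>. \<Sum>i<n. W \<omega> i * e \<omega> i * x \<omega> i) \<in> borel_measurable \<Omega>" by (rule sumM) measurable
    show ?thesis unfolding S_def[abs_def] by measurable
  qed
  have Tm: "T \<in> borel_measurable \<Omega>"
    unfolding T_def[abs_def] by (rule measurable_studentized) measurable

  define E1 where "E1 = {\<omega> \<in> space \<Omega>. \<bar>real n * ((\<Sum>i<n. (a \<omega> i)\<^sup>2) / real n * ((\<Sum>i<n. (b \<omega> i)\<^sup>2) / real n))\<bar> > \<delta>}"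
  define E2 where "E2 = {\<omega> \<in> space \<Omega>. \<bar>\<Sum>i<n. a \<omega> i * W \<omega> i * x \<omega> i\<bar> / sqrt (real n) > \<rho> / 3}"
  define E3 where "E3 = {\<omega> \<in> space \<Omega>. (\<Sum>i<n. (a \<omega> i * W \<omega> i * x \<omega> i)\<^sup>2) / real n > (\<rho> / 3)\<^sup>2}"
  define E4 where "E4 = {\<omega> \<in> space \<Omega>. \<bar>\<Sum>i<n. b \<omega> i * W \<omega> i * e \<omega> i\<bar> / sqrt (real n) > \<rho> / 3}"
  define E5 where "E5 = {\<omega> \<in> space \<Omega>. (\<Sum>i<n. (b \<omega> i * W \<omega> i * e \<omega> i)\<^sup>2) / real n > (\<rho> / 3)\<^sup>2}"
  \<comment> \<open>Tightness of the leading sum: its second moment is 1, so Chebyshev gives 1 /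
    m^2.\<close>
  define E6 where "E6 = {\<omega> \<in> space \<Omega>. \<bar>S \<omega>\<bar> > m}"
  define E7 where "E7 = {\<omega> \<in> space \<Omega>. \<bar>(\<Sum>i<n. (W \<omega> i * e \<omega> i * x \<omega> i)\<^sup>2) / real n - 1\<bar> > \<rho>}"
  have E1: "E1 \<in> sets \<Omega> \<and> measure \<Omega> E1 \<le> \<beta>"
  proof
    have [measurable]: "(\<lambda>\<omega>. \<Sum>i<n. (a \<omega> i)\<^sup>2) \<in> borel_measurable \<Omega>" "(\<lambda>\<omega>. \<Sum>i<n. (b \<omega> i)\<^sup>2) \<in> borel_measurable \<Omega>"
      by (rule sumM, measurable)+
    show "E1 \<in> sets \<Omega>" unfolding E1_def by measurable
  qed (use AA in \<open>simp add: E1_def\<close>)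
  have \<rho>3: "0 < \<rho> / 3" "0 < (\<rho> / 3)\<^sup>2" using \<rho> by auto
  \<comment> \<open>The sums are cut at \<rho>/3 with a squared denominator, the sums of squares at
    (\<rho>/3)^2 with a plain one, so \<open>E2\<close> to \<open>E5\<close> share this constant;
    four copies of it give 36.\<close>
  have C9: "C\<^sup>2 * \<delta> / (\<rho> / 3)\<^sup>2 = 9 * (C\<^sup>2 * \<delta>) / \<rho>\<^sup>2" by (simp add: power_divide)
  have sums: "{\<omega> \<in> space \<Omega>. \<bar>\<Sum>i<n. h \<omega> i\<bar> / sqrt (real n) > s} \<in> sets \<Omega>"
    "{\<omega> \<in> space \<Omega>. (\<Sum>i<n. (h \<omega> i)\<^sup>2) / real n > s} \<in> sets \<Omega>"
    if "\<And>i. i < n \<Longrightarrow> (\<lambda>\<omega>. h \<omega> i) \<in> borel_measurable \<Omega>" for h :: "(nat \<Rightarrow> 'a) \<Rightarrow> nat \<Rightarrow> real" and s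
  proof -
    have [measurable]: "(\<lambda>\<omega>. \<Sum>i<n. h \<omega> i) \<in> borel_measurable \<Omega>" "(\<lambda>\<omega>. \<Sum>i<n. (h \<omega> i)\<^sup>2) \<in> borel_measurable \<Omega>"
      by (intro sumM borel_measurable_power that; simp)+
    show "{\<omega> \<in> space \<Omega>. \<bar>\<Sum>i<n. h \<omega> i\<bar> / sqrt (real n) > s} \<in> sets \<Omega>"
      "{\<omega> \<in> space \<Omega>. (\<Sum>i<n. (h \<omega> i)\<^sup>2) / real n > s} \<in> sets \<Omega>" by measurable
  qed
  have E2: "E2 \<in> sets \<Omega> \<and> measure \<Omega> E2 \<le> \<beta> + 9 * (C\<^sup>2 * \<delta>) / \<rho>\<^sup>2"
  proof
    show "E2 \<in> sets \<Omega>" unfolding E2_def by (rule sums(1)) measurable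
    show "measure \<Omega> E2 \<le> \<beta> + 9 * (C\<^sup>2 * \<delta>) / \<rho>\<^sup>2"
      using regression_noise_sum[OF noiseY v(1) f(2) w fhat n C \<delta>(1) \<rho>3(1) Bf[unfolded \<Omega>_def a_def] Z X]
      unfolding C9 E2_def W_def x_def a_def \<Omega>_def .
  qed
  have E3: "E3 \<in> sets \<Omega> \<and> measure \<Omega> E3 \<le> \<beta> + 9 * (C\<^sup>2 * \<delta>) / \<rho>\<^sup>2"
  proof
    show "E3 \<in> sets \<Omega>" unfolding E3_def by (rule sums(2)) measurable
    show "measure \<Omega> E3 \<le> \<beta> + 9 * (C\<^sup>2 * \<delta>) / \<rho>\<^sup>2"
      using regression_noise_square_sum[OF noiseY v(1) f(2) w fhat n C \<delta>(1) \<rho>3(2) Bf[unfolded \<Omega>_def a_def] Z X]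
      unfolding C9 E3_def W_def x_def a_def \<Omega>_def .
  qed
  have E4: "E4 \<in> sets \<Omega> \<and> measure \<Omega> E4 \<le> \<beta> + 9 * (C\<^sup>2 * \<delta>) / \<rho>\<^sup>2"
  proof
    show "E4 \<in> sets \<Omega>" unfolding E4_def by (rule sums(1)) measurable
    show "measure \<Omega> E4 \<le> \<beta> + 9 * (C\<^sup>2 * \<delta>) / \<rho>\<^sup>2"
      using regression_noise_sum[OF noiseX u(1) g(2) w ghat n C \<delta>(1) \<rho>3(1) Bg[unfolded \<Omega>_def b_def] Z Y]
      unfolding C9 E4_def W_def e_def b_def \<Omega>_def .
  qed
  have E5: "E5 \<in> sets \<Omega> \<and> measure \<Omega> E5 \<le> \<beta> + 9 * (C\<^sup>2 * \<delta>) / \<rho>\<^sup>2"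
  proof
    show "E5 \<in> sets \<Omega>" unfolding E5_def by (rule sums(2)) measurable
    show "measure \<Omega> E5 \<le> \<beta> + 9 * (C\<^sup>2 * \<delta>) / \<rho>\<^sup>2"
      using regression_noise_square_sum[OF noiseX u(1) g(2) w ghat n C \<delta>(1) \<rho>3(2) Bg[unfolded \<Omega>_def b_def] Z Y]
      unfolding C9 E5_def W_def e_def b_def \<Omega>_def .
  qed
  have E6: "E6 \<in> sets \<Omega> \<and> measure \<Omega> E6 \<le> 1 / m\<^sup>2"
  proof
    show "E6 \<in> sets \<Omega>" unfolding E6_def using Sm by measurable
    have Ul: "U \<in> borel_measurable M" "(\<integral>x. U x \<partial>M) = 0" "integrable M (\<lambda>x. (U x)\<^sup>2)" "(\<integral>x. (U x)\<^sup>2 \<partial>M) \<le> 1"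
      using law by (simp_all add: lyapunov_law_def)
    have S: "S \<omega> = (\<Sum>i<n. 1 / sqrt (real n) * U (\<omega> i))" for \<omega>
      by (simp add: S_def U sum_divide_distrib)
    show "measure \<Omega> E6 \<le> 1 / m\<^sup>2" unfolding E6_def
    proof (rule \<Omega>.prob_abs_gt_le_nn_integral_square[OF Sm _ _ m(1)])
      show "(\<integral>\<^sup>+\<omega>. ennreal ((S \<omega>)\<^sup>2) \<partial>\<Omega>) \<le> ennreal 1"
        using XY.nn_integral_iid_sum_square_le[OF Ul, of n "1 / sqrt (real n)"] n
        unfolding S \<Omega>_def by (simp add: power_divide)
    qed simp
  qed
  have E7: "E7 \<in> sets \<Omega> \<and> measure \<Omega> E7 \<le> e1"
  proof
    have [measurable]: "(\<lambda>\<omega>. \<Sum>i<n. (W \<omega> i * e \<omega> i * x \<omega> i)\<^sup>2) \<in> borel_measurable \<Omega>" by (rule sumM) measurable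
    show "E7 \<in> sets \<Omega>" unfolding E7_def by measurable
  qed (use lln in \<open>simp add: E7_def U\<close>)
  define E where "E = ((((((E1 \<union> E2) \<union> E3) \<union> E4) \<union> E5) \<union> E6) \<union> E7)"
  have E: "E \<in> sets \<Omega> \<and> measure \<Omega> E \<le> \<beta> + (\<beta> + 9 * (C\<^sup>2 * \<delta>) / \<rho>\<^sup>2) + (\<beta> + 9 * (C\<^sup>2 * \<delta>) / \<rho>\<^sup>2)
      + (\<beta> + 9 * (C\<^sup>2 * \<delta>) / \<rho>\<^sup>2) + (\<beta> + 9 * (C\<^sup>2 * \<delta>) / \<rho>\<^sup>2) + 1 / m\<^sup>2 + e1"
    unfolding E_def by (intro \<Omega>.measure_Un_bound E1 E2 E3 E4 E5 E6 E7)
  have Eb: "measure \<Omega> E \<le> 5 * \<beta> + 36 * (C\<^sup>2 * \<delta>) / \<rho>\<^sup>2 + 1 / m\<^sup>2 + e1"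
    using E by (simp add: mult.commute)
  have close: "\<bar>T \<omega> - S \<omega>\<bar> \<le> 2 * \<rho> + 14 * m * \<rho>" if \<omega>: "\<omega> \<in> space \<Omega>" "\<omega> \<notin> E" for \<omega>
    unfolding T_def S_def
  proof (rule studentized_residuals_close[OF n \<rho> less_imp_le[OF m(1)] C(1) _ _ \<delta>(2) _ _ _ _ _ _ m(2)])
    show "\<bar>W \<omega> i\<bar> \<le> C" for i using C(2) by (simp add: W_def)
    show "real n * ((\<Sum>i<n. (a \<omega> i)\<^sup>2) / real n * ((\<Sum>i<n. (b \<omega> i)\<^sup>2) / real n)) \<le> \<delta>"
    proof -
      have "\<omega> \<notin> E1" using \<omega> by (simp add: E_def)
      then have "\<not> \<bar>real n * ((\<Sum>i<n. (a \<omega> i)\<^sup>2) / real n * ((\<Sum>i<n. (b \<omega> i)\<^sup>2) / real n))\<bar> > \<delta>"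
        using \<omega>(1) unfolding E1_def by blast
      then show ?thesis by linarith
    qed
    show "\<bar>\<Sum>i<n. W \<omega> i * e \<omega> i * x \<omega> i\<bar> / sqrt (real n) \<le> m"
      using \<omega> unfolding E_def E6_def S_def by (auto simp: not_less)
  qed (use \<omega> in \<open>auto simp: E_def E2_def E3_def E4_def E5_def E7_def not_less\<close>)
  have "\<bar>measure \<Omega> {\<omega> \<in> space \<Omega>. T \<omega> \<le> t} - Phi t\<bar> \<le> (5 * \<beta> + 36 * (C\<^sup>2 * \<delta>) / \<rho>\<^sup>2 + 1 / m\<^sup>2 + e1) + e2 + (2 * \<rho> + 14 * m * \<rho>)"
  proof (rule \<Omega>.normal_approx_perturb[OF Sm Tm _ Eb close])
    show "\<bar>measure \<Omega> {\<omega> \<in> space \<Omega>. S \<omega> \<le> t} - Phi t\<bar> \<le> e2" for t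
      using clt[of t] by (simp add: S_def U)
  qed (use E \<rho> m in auto)
  then show ?thesis by (simp add: T_def e_def x_def a_def b_def W_def)
qed

section \<open>The generalised covariance measure\<close>

definition gcm_setting where
  "gcm_setting P f g u v fh gh \<longleftrightarrow> in_P0 P \<and> regr_measurable fh \<and> regr_measurable gh \<and>
     cond_mean_version P Xc f \<and> cond_mean_version P Yc g \<and>
     cond_mean_version_nn P (\<lambda>\<omega>. ennreal ((Xc \<omega> - f (Zc \<omega>))\<^sup>2)) u \<and>
     cond_mean_version_nn P (\<lambda>\<omega>. ennreal ((Yc \<omega> - g (Zc \<omega>))\<^sup>2)) v"

text \<open>One \<delta> serves as threshold and as probability level, which is enough because the
  assumptions hold eventually for every threshold and every level. The rate o(1/n) is encoded by
  multiplying A_f A_g by n.\<close>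

definition errors_small where
  "errors_small P f g u v fh gh n \<delta> \<longleftrightarrow>
     measure (sampleM P n) {\<omega> \<in> space (sampleM P n).
        \<bar>real n * (Aerr f (fh n (XZdata n \<omega>)) n \<omega> * Aerr g (gh n (YZdata n \<omega>)) n \<omega>)\<bar> > \<delta>} \<le> \<delta> \<and>
     measure (sampleM P n) {\<omega> \<in> space (sampleM P n). Berr f (fh n (XZdata n \<omega>)) v n \<omega> > ennreal \<delta>} \<le> \<delta> \<and>
     measure (sampleM P n) {\<omega> \<in> space (sampleM P n). Berr g (gh n (YZdata n \<omega>)) u n \<omega> > ennreal \<delta>} \<le> \<delta>"

lemma
  assumes "in_P0 (P :: 'z::euclidean_space obs measure)"
  shows prob_space_P0: "prob_space P" and cond_indep_P0: "cond_indep_given P Xc Yc Zc (sigZ P)"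
    and measurable_P0: "Xc \<in> borel_measurable P" "Yc \<in> borel_measurable P" "Zc \<in> borel_measurable P"
proof -
  show P: "prob_space P" using assms by (simp add: in_P0_def in_E0_def)
  have s: "sets P = sets borel" using assms by (simp add: in_P0_def in_E0_def)
  have "Xc \<in> borel_measurable (borel :: 'z obs measure)" "Yc \<in> borel_measurable (borel :: 'z obs measure)" "Zc \<in> borel_measurable (borel :: 'z obs measure)"
    unfolding Xc_def[abs_def] Yc_def[abs_def] Zc_def[abs_def] borel_prod[symmetric] by measurable
  then show m: "Xc \<in> borel_measurable P" "Yc \<in> borel_measurable P" "Zc \<in> borel_measurable P"
    by (simp_all add: measurable_cong_sets[OF s refl])
  show "cond_indep_given P Xc Yc Zc (sigZ P)"
    by (intro cond_indep_given.intro cond_indep_given_axioms.intro P m sigZ_def)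
       (use assms in \<open>simp add: in_P0_def\<close>)
qed

lemma regr_measurableD:
  assumes "regr_measurable fh"
  shows "(\<lambda>(d, z). fh n d z) \<in> borel_measurable (PiM {..<n} (\<lambda>_. borel) \<Otimes>\<^sub>M borel)"
  using assms by (simp add: regr_measurable_def)

lemma powr_le_1_plus_powr:
  fixes y p q :: real assumes "0 \<le> y" "0 \<le> p" "p \<le> q"
  shows "y powr p \<le> 1 + y powr q"
proof (cases "y \<le> 1")
  case True
  then have "y powr p \<le> 1" using assms by (intro powr_le1) auto
  then show ?thesis using powr_ge_zero[of y q] by linarith
next
  case False
  then have "y powr p \<le> y powr q" using assms by (intro powr_mono) auto
  then show ?thesis by simp
qed

text \<open>Here \<sigma>^2 is the variance of w \<epsilon> \<xi>, at least \<open>c\<close>, so the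
  rescaled weight is bounded by C / sqrt c and the moment bound depends only on C, c, K and \<eta>.
  The exponent is cut to \<open>min \<eta> 1\<close> as the central limit theorem requires; the 1 in
  \<open>1 + max K 0\<close> pays for lowering the power, and the \<open>max\<close> reflects that
  \<open>ennreal\<close> sends negative \<open>K\<close> to 0.\<close>

lemma lyapunov_law_normalized:
  fixes P :: "'z::euclidean_space obs measure" and w :: "'z \<Rightarrow> real"
  assumes set: "gcm_setting P f g u v fh gh"
    and w: "w \<in> borel_measurable borel" and C: "0 < C" "\<And>z. \<bar>w z\<bar> \<le> C" and c: "0 < c" and \<eta>: "0 < \<eta>"
    and mom: "moment_epsxi P f g \<eta> \<le> ennreal K"
    and var: "ennreal c \<le> (\<integral>\<^sup>+ \<omega>. ennreal ((w (Zc \<omega>))\<^sup>2 * (Xc \<omega> - f (Zc \<omega>))\<^sup>2 * (Yc \<omega> - g (Zc \<omega>))\<^sup>2) \<partial>P)"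
  obtains \<sigma> where "0 < \<sigma>" "\<And>z. \<bar>w z / \<sigma>\<bar> \<le> C / sqrt c"
    "lyapunov_law (min \<eta> 1) ((C / sqrt c) powr (2 + min \<eta> 1) * (1 + max K 0)) P (\<lambda>\<omega>. w (Zc \<omega>) / \<sigma> * (Xc \<omega> - f (Zc \<omega>)) * (Yc \<omega> - g (Zc \<omega>)))"
proof -
  have P0: "in_P0 P" and f: "integrable P Xc" "f \<in> borel_measurable borel" "AE \<omega> in P. real_cond_exp P (sigZ P) Xc \<omega> = f (Zc \<omega>)"
    and g: "integrable P Yc" "g \<in> borel_measurable borel" "AE \<omega> in P. real_cond_exp P (sigZ P) Yc \<omega> = g (Zc \<omega>)"
    using set by (auto simp: gcm_setting_def cond_mean_version_def)
  interpret prob_space P by (rule prob_space_P0[OF P0])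
  interpret CI: cond_indep_given P Xc Yc Zc "sigZ P" by (rule cond_indep_P0[OF P0])
  note [measurable] = f(2) g(2) w CI.X CI.Y CI.Z
  define y where "y \<omega> = (Xc \<omega> - f (Zc \<omega>)) * (Yc \<omega> - g (Zc \<omega>))" for \<omega>
  have [measurable]: "y \<in> borel_measurable P" unfolding y_def[abs_def] by measurable
  define \<eta>' where "\<eta>' = min \<eta> 1"
  have \<eta>': "0 < \<eta>'" "\<eta>' \<le> \<eta>" using \<eta> by (auto simp: \<eta>'_def)
  have q_nn: "(\<integral>\<^sup>+\<omega>. ennreal (\<bar>y \<omega>\<bar> powr (2 + \<eta>)) \<partial>P) \<le> ennreal K"
    using mom by (simp add: moment_epsxi_def y_def)
  have q_int: "integrable P (\<lambda>\<omega>. \<bar>y \<omega>\<bar> powr (2 + \<eta>))"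
    using q_nn by (intro integrableI_nonneg) (auto intro: le_less_trans)
  have q_le: "expectation (\<lambda>\<omega>. \<bar>y \<omega>\<bar> powr (2 + \<eta>)) \<le> max K 0"
  proof -
    have "ennreal (expectation (\<lambda>\<omega>. \<bar>y \<omega>\<bar> powr (2 + \<eta>))) \<le> ennreal (max K 0)"
      using q_nn by (simp add: nn_integral_eq_integral[OF q_int, symmetric] ennreal_max_0')
    then show ?thesis by (rule ennreal_le_iff[THEN iffD1, rotated]) simp
  qed
  have powr_int: "integrable P (\<lambda>\<omega>. \<bar>y \<omega>\<bar> powr p)" if "0 \<le> p" "p \<le> 2 + \<eta>" for p
    by (rule Bochner_Integration.integrable_bound[of _ "\<lambda>\<omega>. 1 + \<bar>y \<omega>\<bar> powr (2 + \<eta>)"])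
       (use q_int that powr_le_1_plus_powr[of "\<bar>y _\<bar>" p "2 + \<eta>"] in \<open>auto intro!: AE_I2 simp: add_nonneg_nonneg\<close>)
  have wy_int: "integrable P (\<lambda>\<omega>. (w (Zc \<omega>) * y \<omega>)\<^sup>2)"
  proof (rule Bochner_Integration.integrable_bound)
    have "integrable P (\<lambda>\<omega>. \<bar>y \<omega>\<bar> powr 2)" using \<eta> by (intro powr_int) auto
    then have "integrable P (\<lambda>\<omega>. (y \<omega>)\<^sup>2)" by (simp add: powr_numeral)
    then show "integrable P (\<lambda>\<omega>. C\<^sup>2 * (y \<omega>)\<^sup>2)" by simp
    have "(w z)\<^sup>2 \<le> C\<^sup>2" for z using C by (simp add: power2_le_iff_abs_le)
    then show "AE \<omega> in P. norm ((w (Zc \<omega>) * y \<omega>)\<^sup>2) \<le> norm (C\<^sup>2 * (y \<omega>)\<^sup>2)"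
      by (intro AE_I2) (auto simp: power_mult_distrib intro!: mult_right_mono)
  qed measurable
  define \<sigma> where "\<sigma> = sqrt (expectation (\<lambda>\<omega>. (w (Zc \<omega>) * y \<omega>)\<^sup>2))"
  have "ennreal c \<le> (\<integral>\<^sup>+\<omega>. ennreal ((w (Zc \<omega>) * y \<omega>)\<^sup>2) \<partial>P)"
    using var by (simp add: y_def power_mult_distrib mult.assoc)
  also have "\<dots> = ennreal (expectation (\<lambda>\<omega>. (w (Zc \<omega>) * y \<omega>)\<^sup>2))"
    by (rule nn_integral_eq_integral[OF wy_int]) simp
  finally have c_le: "c \<le> expectation (\<lambda>\<omega>. (w (Zc \<omega>) * y \<omega>)\<^sup>2)" using c by (simp add: ennreal_le_iff2)
  then have \<sigma>: "sqrt c \<le> \<sigma>" "0 < \<sigma>" "\<sigma>\<^sup>2 = expectation (\<lambda>\<omega>. (w (Zc \<omega>) * y \<omega>)\<^sup>2)"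
    using c by (auto simp: \<sigma>_def)
  have wb: "\<bar>w z / \<sigma>\<bar> \<le> C / sqrt c" for z
    using frac_le[OF _ C(2)[of z] _ \<sigma>(1)] C(1) c \<sigma>(2) by simp
  define U where "U \<omega> = w (Zc \<omega>) / \<sigma> * (Xc \<omega> - f (Zc \<omega>)) * (Yc \<omega> - g (Zc \<omega>))" for \<omega>
  have Uy: "U \<omega> = w (Zc \<omega>) / \<sigma> * y \<omega>" for \<omega> by (simp add: U_def y_def)
  have [measurable]: "U \<in> borel_measurable P" unfolding U_def[abs_def] by measurable
  have U2e: "(U \<omega>)\<^sup>2 = (w (Zc \<omega>) * y \<omega>)\<^sup>2 / \<sigma>\<^sup>2" for \<omega> by (simp add: Uy power_divide power_mult_distrib)
  have U2: "integrable P (\<lambda>\<omega>. (U \<omega>)\<^sup>2)" "expectation (\<lambda>\<omega>. (U \<omega>)\<^sup>2) = 1"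
    unfolding U2e using wy_int \<sigma>(3) c_le c by simp_all
  have U1: "integrable P U" by (rule square_integrable_imp_integrable[OF _ U2(1)]) simp
  \<comment> \<open>The weight times \<epsilon> is a function of (X, Z), against which \<xi>
    integrates to 0.\<close>
  have U0: "expectation U = 0"
    using CI.integral_residual_eq_0[of "\<lambda>p. w (snd p) / \<sigma> * (fst p - f (snd p))", OF _ g(2) g(1) g(3)] U1
    by (simp add: U_def[abs_def])
  have U3b: "\<bar>U \<omega>\<bar> powr (2 + \<eta>') \<le> (C / sqrt c) powr (2 + \<eta>') * (1 + \<bar>y \<omega>\<bar> powr (2 + \<eta>))" for \<omega>
  proof -
    have "\<bar>U \<omega>\<bar> powr (2 + \<eta>') = \<bar>w (Zc \<omega>) / \<sigma>\<bar> powr (2 + \<eta>') * \<bar>y \<omega>\<bar> powr (2 + \<eta>')"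
      unfolding Uy abs_mult by (rule powr_mult)
    also have "\<dots> \<le> (C / sqrt c) powr (2 + \<eta>') * (1 + \<bar>y \<omega>\<bar> powr (2 + \<eta>))"
      using wb \<eta>' by (intro mult_mono powr_mono2 powr_le_1_plus_powr) auto
    finally show ?thesis .
  qed
  have U3i: "integrable P (\<lambda>\<omega>. \<bar>U \<omega>\<bar> powr (2 + \<eta>'))"
    by (rule Bochner_Integration.integrable_bound[of _ "\<lambda>\<omega>. (C / sqrt c) powr (2 + \<eta>') * (1 + \<bar>y \<omega>\<bar> powr (2 + \<eta>))"])
       (use q_int U3b in \<open>auto intro!: AE_I2 simp: add_nonneg_nonneg\<close>)
  have "expectation (\<lambda>\<omega>. \<bar>U \<omega>\<bar> powr (2 + \<eta>')) \<le> expectation (\<lambda>\<omega>. (C / sqrt c) powr (2 + \<eta>') * (1 + \<bar>y \<omega>\<bar> powr (2 + \<eta>)))"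
    using q_int by (intro integral_mono U3i U3b) auto
  also have "\<dots> = (C / sqrt c) powr (2 + \<eta>') * (1 + expectation (\<lambda>\<omega>. \<bar>y \<omega>\<bar> powr (2 + \<eta>)))"
    using q_int by (simp add: prob_space)
  also have "\<dots> \<le> (C / sqrt c) powr (2 + \<eta>') * (1 + max K 0)"
    using q_le by (intro mult_left_mono) auto
  finally have "lyapunov_law \<eta>' ((C / sqrt c) powr (2 + \<eta>') * (1 + max K 0)) P U"
    unfolding lyapunov_law_def using U1 U0 U2 U3i prob_space_axioms by simp
  then show ?thesis using that[OF \<sigma>(2) wb] by (simp add: \<eta>'_def U_def[abs_def])
qed

text \<open>The order of quantifiers is the point: \<open>N\<close> and \<delta> are fixed before
  the law, the regressions, the weight and t. The weight is deterministic here, being the estimated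
  one at a fixed realisation of the auxiliary data.\<close>

lemma gcm_uniform_fixed_weight:
  fixes \<eta> K C c \<epsilon> :: real
  assumes \<eta>: "0 < \<eta>" and C: "0 < C" and c: "0 < c" and \<epsilon>: "0 < \<epsilon>"
  shows "\<exists>N. \<exists>\<delta>>0. \<forall>n\<ge>N. \<forall>(P :: 'z::euclidean_space obs measure) f g u v fh gh w t.
     gcm_setting P f g u v fh gh \<longrightarrow> w \<in> borel_measurable borel \<longrightarrow> (\<forall>z. \<bar>w z\<bar> \<le> C) \<longrightarrow>
     moment_epsxi P f g \<eta> \<le> ennreal K \<longrightarrow>
     ennreal c \<le> (\<integral>\<^sup>+ \<omega>. ennreal ((w (Zc \<omega>))\<^sup>2 * (Xc \<omega> - f (Zc \<omega>))\<^sup>2 * (Yc \<omega> - g (Zc \<omega>))\<^sup>2) \<partial>P) \<longrightarrow>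
     errors_small P f g u v fh gh n \<delta> \<longrightarrow>
     \<bar>measure (sampleM P n) {\<omega> \<in> space (sampleM P n). studentized (\<lambda>i. (Xc (\<omega> i) - fh n (XZdata n \<omega>) (Zc (\<omega> i)))
        * (Yc (\<omega> i) - gh n (YZdata n \<omega>) (Zc (\<omega> i))) * w (Zc (\<omega> i))) n \<le> t} - Phi t\<bar> \<le> \<epsilon>"
proof -
  \<comment> \<open>Six error terms receive at most \<epsilon>/8 each. The order of choice is
    forced: \<open>m\<close> makes 1 / m^2 small, \<rho> makes 2\<rho> + 14 m \<rho> small, then
    \<delta> is fitted to \<rho>. In \<delta>, 40 = 5 * 8 and 288 = 36 * 8 match the coefficients of
    the bound, and 1/9 ensures C'^2 \<delta> \<le> (\<rho>/3)^2.\<close>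
  define C' where "C' = C / sqrt c"
  define \<eta>' where "\<eta>' = min \<eta> 1"
  define K' where "K' = C' powr (2 + \<eta>') * (1 + max K 0)"
  define m where "m = 3 / sqrt \<epsilon>"
  define \<rho> where "\<rho> = min (1 / 14) (\<epsilon> / (8 * (2 + 14 * m)))"
  define \<delta> where "\<delta> = min (\<epsilon> / 40) (\<rho>\<^sup>2 * min (1 / 9) (\<epsilon> / 288) / C'\<^sup>2)"
  have C': "0 < C'" using C c by (simp add: C'_def)
  have \<eta>': "0 < \<eta>'" "\<eta>' \<le> 1" using \<eta> by (auto simp: \<eta>'_def)
  have m: "0 < m" "1 / m\<^sup>2 \<le> \<epsilon> / 8" using \<epsilon> by (auto simp: m_def power_divide)
  have "0 < 2 + 14 * m" using m by simp
  then have \<rho>: "0 < \<rho>" "\<rho> \<le> 1 / 14"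
    using \<epsilon> unfolding \<rho>_def by (simp_all only: min.cobounded1, simp)
  have "\<rho> * (2 + 14 * m) \<le> \<epsilon> / (8 * (2 + 14 * m)) * (2 + 14 * m)"
    using m by (intro mult_right_mono) (auto simp: \<rho>_def)
  also have "\<dots> = \<epsilon> / 8" using m by (simp add: field_simps)
  finally have \<rho>m: "2 * \<rho> + 14 * m * \<rho> \<le> \<epsilon> / 8" by (simp add: algebra_simps)
  have \<delta>: "0 < \<delta>" "5 * \<delta> \<le> \<epsilon> / 8" using \<epsilon> \<rho> C' by (auto simp: \<delta>_def)
  have "C'\<^sup>2 * \<delta> \<le> C'\<^sup>2 * (\<rho>\<^sup>2 * min (1 / 9) (\<epsilon> / 288) / C'\<^sup>2)"
    by (intro mult_left_mono) (auto simp: \<delta>_def)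
  then have "C'\<^sup>2 * \<delta> \<le> \<rho>\<^sup>2 * min (1 / 9) (\<epsilon> / 288)" using C' by simp
  moreover have "\<rho>\<^sup>2 * min (1 / 9) (\<epsilon> / 288) \<le> \<rho>\<^sup>2 * (1 / 9)" "\<rho>\<^sup>2 * min (1 / 9) (\<epsilon> / 288) \<le> \<rho>\<^sup>2 * (\<epsilon> / 288)"
    by (intro mult_left_mono; simp)+
  ultimately have C\<delta>: "C'\<^sup>2 * \<delta> \<le> (\<rho> / 3)\<^sup>2" "C'\<^sup>2 * \<delta> \<le> \<rho>\<^sup>2 * (\<epsilon> / 288)"
    by (auto simp: power_divide)
  have "36 * (C'\<^sup>2 * \<delta>) / \<rho>\<^sup>2 \<le> 36 * (\<rho>\<^sup>2 * (\<epsilon> / 288)) / \<rho>\<^sup>2"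
    using C\<delta>(2) by (intro divide_right_mono mult_left_mono) auto
  also have "\<dots> = \<epsilon> / 8" using \<rho> by simp
  finally have C\<delta>\<rho>: "36 * (C'\<^sup>2 * \<delta>) / \<rho>\<^sup>2 \<le> \<epsilon> / 8" .
  have \<epsilon>8: "0 < \<epsilon> / 8" using \<epsilon> by simp
  obtain N1 where N1: "\<forall>n\<ge>N1. \<forall>(M::'z obs measure) U. lyapunov_law \<eta>' K' M U \<longrightarrow>
     measure (PiM {..<n} (\<lambda>_. M)) {\<omega> \<in> space (PiM {..<n} (\<lambda>_. M)). \<bar>(\<Sum>i<n. (U (\<omega> i))\<^sup>2) / real n - 1\<bar> > \<rho>} \<le> \<epsilon> / 8"
    using uniform_lln[OF \<eta>'(1) \<rho>(1) \<epsilon>8, where K = K'] by (elim exE) (rule that)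
  obtain N2 where N2: "\<forall>n\<ge>N2. \<forall>(M::'z obs measure) U. lyapunov_law \<eta>' K' M U \<longrightarrow>
     (\<forall>t. \<bar>measure (PiM {..<n} (\<lambda>_. M)) {\<omega> \<in> space (PiM {..<n} (\<lambda>_. M)). (\<Sum>i<n. U (\<omega> i)) / sqrt (real n) \<le> t} - Phi t\<bar> \<le> \<epsilon> / 8)"
    using uniform_clt[OF \<eta>' \<epsilon>8, where K = K'] by (elim exE) (rule that)
  obtain N3 :: nat where N3: "(m + 1)\<^sup>2 / \<rho> \<le> real N3" using real_arch_simple[of "(m + 1)\<^sup>2 / \<rho>"] by (elim exE) (rule that)
  show ?thesis
  proof (intro exI[of _ "max (max N1 N2) (max N3 1)"] exI[of _ \<delta>] conjI \<delta>(1) allI impI)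
    fix n :: nat and P :: "'z obs measure" and f g u v fh gh w t
    assume n: "max (max N1 N2) (max N3 1) \<le> n" and set: "gcm_setting P f g u v fh gh"
      and w: "w \<in> borel_measurable borel" "\<forall>z. \<bar>w z\<bar> \<le> C" and mom: "moment_epsxi P f g \<eta> \<le> ennreal K"
      and var: "ennreal c \<le> (\<integral>\<^sup>+ \<omega>. ennreal ((w (Zc \<omega>))\<^sup>2 * (Xc \<omega> - f (Zc \<omega>))\<^sup>2 * (Yc \<omega> - g (Zc \<omega>))\<^sup>2) \<partial>P)"
      and err: "errors_small P f g u v fh gh n \<delta>"
    have n0: "0 < n" and "(m + 1)\<^sup>2 / \<rho> \<le> real n" using n N3 by auto
    then have nm: "(m + 1)\<^sup>2 / real n \<le> \<rho>" using \<rho> by (simp add: field_simps)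
    obtain \<sigma> where \<sigma>: "0 < \<sigma>" "\<And>z. \<bar>w z / \<sigma>\<bar> \<le> C'"
      and law: "lyapunov_law \<eta>' K' P (\<lambda>\<omega>. w (Zc \<omega>) / \<sigma> * (Xc \<omega> - f (Zc \<omega>)) * (Yc \<omega> - g (Zc \<omega>)))"
      unfolding C'_def K'_def \<eta>'_def
      by (rule lyapunov_law_normalized[OF set w(1) C w(2)[rule_format] c \<eta> mom var]) (rule that[unfolded C'_def K'_def \<eta>'_def])
    have P0: "in_P0 P" and f: "integrable P Xc" "f \<in> borel_measurable borel" "AE \<omega> in P. real_cond_exp P (sigZ P) Xc \<omega> = f (Zc \<omega>)"
      and g: "integrable P Yc" "g \<in> borel_measurable borel" "AE \<omega> in P. real_cond_exp P (sigZ P) Yc \<omega> = g (Zc \<omega>)"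
      and u: "u \<in> borel_measurable borel" "AE \<omega> in P. nn_cond_exp P (sigZ P) (\<lambda>\<omega>. ennreal ((Xc \<omega> - f (Zc \<omega>))\<^sup>2)) \<omega> = u (Zc \<omega>)"
      and v: "v \<in> borel_measurable borel" "AE \<omega> in P. nn_cond_exp P (sigZ P) (\<lambda>\<omega>. ennreal ((Yc \<omega> - g (Zc \<omega>))\<^sup>2)) \<omega> = v (Zc \<omega>)"
      and fh: "regr_measurable fh" and gh: "regr_measurable gh"
      using set by (auto simp: gcm_setting_def cond_mean_version_def cond_mean_version_nn_def)
    have w': "(\<lambda>z. w z / \<sigma>) \<in> borel_measurable borel" using w(1) by measurable
    have "n \<ge> N1" "n \<ge> N2" using n by auto
    note bound = gcm_normal_approx[OF cond_indep_P0[OF P0] f g u v w' C' \<sigma>(2)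
        regr_measurableD[OF fh] regr_measurableD[OF gh] n0 \<rho> m(1) nm \<delta>(1) C\<delta>(1) law _ _ _ N1[rule_format, OF \<open>n \<ge> N1\<close> law] N2[rule_format, OF \<open>n \<ge> N2\<close> law], of \<delta> t]
    have eq: "studentized (\<lambda>i. (Xc (\<omega> i) - fh n (XZdata n \<omega>) (Zc (\<omega> i))) * (Yc (\<omega> i) - gh n (YZdata n \<omega>) (Zc (\<omega> i))) * (w (Zc (\<omega> i)) / \<sigma>)) n
       = studentized (\<lambda>i. (Xc (\<omega> i) - fh n (XZdata n \<omega>) (Zc (\<omega> i))) * (Yc (\<omega> i) - gh n (YZdata n \<omega>) (Zc (\<omega> i))) * w (Zc (\<omega> i))) n" for \<omega>
      using studentized_scale[of "1 / \<sigma>" "\<lambda>i. (Xc (\<omega> i) - fh n (XZdata n \<omega>) (Zc (\<omega> i))) * (Yc (\<omega> i) - gh n (YZdata n \<omega>) (Zc (\<omega> i))) * w (Zc (\<omega> i))"] \<sigma>(1)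
      by simp
    have "\<bar>measure (sampleM P n) {\<omega> \<in> space (sampleM P n). studentized (\<lambda>i. (Xc (\<omega> i) - fh n (XZdata n \<omega>) (Zc (\<omega> i)))
        * (Yc (\<omega> i) - gh n (YZdata n \<omega>) (Zc (\<omega> i))) * (w (Zc (\<omega> i)) / \<sigma>)) n \<le> t} - Phi t\<bar>
      \<le> (5 * \<delta> + 36 * (C'\<^sup>2 * \<delta>) / \<rho>\<^sup>2 + 1 / m\<^sup>2 + \<epsilon> / 8) + \<epsilon> / 8 + (2 * \<rho> + 14 * m * \<rho>)"
      unfolding sampleM_def XZdata_def YZdata_def
      by (rule bound) (use err in \<open>simp_all add: errors_small_def sampleM_def XZdata_def YZdata_def Aerr_def Berr_def\<close>)
    also have "\<dots> \<le> \<epsilon>" using \<delta>(2) C\<delta>\<rho> m(2) \<rho>m \<epsilon> by linarith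
    finally show "\<bar>measure (sampleM P n) {\<omega> \<in> space (sampleM P n). studentized (\<lambda>i. (Xc (\<omega> i) - fh n (XZdata n \<omega>) (Zc (\<omega> i)))
        * (Yc (\<omega> i) - gh n (YZdata n \<omega>) (Zc (\<omega> i))) * w (Zc (\<omega> i))) n \<le> t} - Phi t\<bar> \<le> \<epsilon>" unfolding eq .
  qed
qed

section \<open>Integrating out the auxiliary data\<close>

lemma Rres_measurable:
  fixes P :: "'z::euclidean_space obs measure" and w :: "nat \<Rightarrow> 'a \<Rightarrow> 'z \<Rightarrow> real"
  assumes P0: "in_P0 P" and fh: "regr_measurable fh" and gh: "regr_measurable gh"
    and w: "(\<lambda>(a, z). w n a z) \<in> borel_measurable (Q \<Otimes>\<^sub>M borel)" and i: "i < n"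
  shows "(\<lambda>p. Rres fh gh w n (fst p) (snd p) i) \<in> borel_measurable (sampleM P n \<Otimes>\<^sub>M Q)"
proof -
  note m = measurable_P0[OF P0]
  have [measurable]: "(\<lambda>\<omega>. Xc (\<omega> i)) \<in> borel_measurable (sampleM P n)" "(\<lambda>\<omega>. Yc (\<omega> i)) \<in> borel_measurable (sampleM P n)"
    "(\<lambda>\<omega>. Zc (\<omega> i)) \<in> borel_measurable (sampleM P n)"
    unfolding sampleM_def using i by (auto intro!: measurable_sample_component m)
  have [measurable]: "(\<lambda>\<omega>. fh n (XZdata n \<omega>) (Zc (\<omega> i))) \<in> borel_measurable (sampleM P n)"
    using measurable_regression_error[OF m(1,3) borel_measurable_const[of 0] regr_measurableD[OF fh] i]
    unfolding sampleM_def XZdata_def by simp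
  have [measurable]: "(\<lambda>\<omega>. gh n (YZdata n \<omega>) (Zc (\<omega> i))) \<in> borel_measurable (sampleM P n)"
    using measurable_regression_error[OF m(2,3) borel_measurable_const[of 0] regr_measurableD[OF gh] i]
    unfolding sampleM_def YZdata_def by simp
  have [measurable]: "(\<lambda>p. w n (snd p) (Zc (fst p i))) \<in> borel_measurable (sampleM P n \<Otimes>\<^sub>M Q)"
  proof -
    have "(\<lambda>p. (snd p, Zc (fst p i))) \<in> measurable (sampleM P n \<Otimes>\<^sub>M Q) (Q \<Otimes>\<^sub>M borel)" by measurable
    from measurable_compose[OF this w] show ?thesis by simp
  qed
  show ?thesis unfolding Rres_def by measurable
qed

lemma sigma_bar2_measurable:
  fixes P :: "'z::euclidean_space obs measure"
  assumes P0: "in_P0 P" and [measurable]: "f \<in> borel_measurable borel" "g \<in> borel_measurable borel"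
    and w: "(\<lambda>(a, z). w n a z) \<in> borel_measurable (Q \<Otimes>\<^sub>M borel)"
  shows "(\<lambda>a. sigma_bar2 P f g w n a) \<in> borel_measurable Q"
proof -
  interpret prob_space P by (rule prob_space_P0[OF P0])
  note [measurable] = measurable_P0[OF P0]
  have [measurable]: "(\<lambda>p. w n (fst p) (Zc (snd p))) \<in> borel_measurable (Q \<Otimes>\<^sub>M P)"
  proof -
    have "(\<lambda>p. (fst p, Zc (snd p))) \<in> measurable (Q \<Otimes>\<^sub>M P) (Q \<Otimes>\<^sub>M borel)" by measurable
    from measurable_compose[OF this w] show ?thesis by simp
  qed
  show ?thesis unfolding sigma_bar2_def
    by (rule borel_measurable_nn_integral) (simp add: case_prod_beta')
qed

text \<open>Independence of the auxiliary data is the product measure, so Fubini writes the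
  probability as the average over \<open>Q\<close> of the probabilities \<open>h a\<close> at fixed
  realisations. On \<open>B\<close> the error is at most 1, as \<open>h a\<close> and
  \<open>Phi t\<close> both lie in [0,1].\<close>

lemma probT_close:
  fixes P :: "'z::euclidean_space obs measure" and Q :: "'a measure"
  assumes set: "gcm_setting P f g u v fh gh" and Q: "prob_space Q"
    and w: "(\<lambda>(a, z). w n a z) \<in> borel_measurable (Q \<Otimes>\<^sub>M borel)"
    and bad: "B \<in> sets Q" "measure Q B \<le> \<epsilon>2" and \<epsilon>1: "0 \<le> \<epsilon>1"
    and good: "\<And>a. a \<in> space Q \<Longrightarrow> a \<notin> B \<Longrightarrow>
      \<bar>measure (sampleM P n) {\<omega> \<in> space (sampleM P n). Tstat fh gh w n \<omega> a \<le> t} - Phi t\<bar> \<le> \<epsilon>1"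
  shows "\<bar>probT P Q fh gh w n t - Phi t\<bar> \<le> \<epsilon>1 + \<epsilon>2"
proof -
  have P0: "in_P0 P" and fh: "regr_measurable fh" and gh: "regr_measurable gh" using set by (auto simp: gcm_setting_def)
  interpret Q: prob_space Q by (rule Q)
  interpret S: prob_space "sampleM P n" unfolding sampleM_def by (intro prob_space_PiM prob_space_P0 P0)
  interpret PQ: pair_prob_space "sampleM P n" Q by unfold_locales
  define A where "A = {p \<in> space (sampleM P n \<Otimes>\<^sub>M Q). Tstat fh gh w n (fst p) (snd p) \<le> t}"
  define h where "h a = measure (sampleM P n) {\<omega> \<in> space (sampleM P n). Tstat fh gh w n \<omega> a \<le> t}" for a
  have "(\<lambda>p. Tstat fh gh w n (fst p) (snd p)) \<in> borel_measurable (sampleM P n \<Otimes>\<^sub>M Q)"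
    unfolding Tstat_eq_studentized by (rule measurable_studentized, rule Rres_measurable[where n = n]) (use P0 fh gh w in auto)
  then have A [measurable]: "A \<in> sets (sampleM P n \<Otimes>\<^sub>M Q)" unfolding A_def by measurable
  have sec: "(\<lambda>\<omega>. (\<omega>, a)) -` A = {\<omega> \<in> space (sampleM P n). Tstat fh gh w n \<omega> a \<le> t}" if "a \<in> space Q" for a
    using that by (auto simp: A_def space_pair_measure)
  have hm [measurable]: "h \<in> borel_measurable Q"
  proof -
    have "(\<lambda>a. measure (sampleM P n) ((\<lambda>\<omega>. (\<omega>, a)) -` A)) \<in> borel_measurable Q"
      unfolding measure_def using PQ.measurable_emeasure_Pair2[OF A] by measurable
    then show ?thesis by (rule measurable_cong[THEN iffD1, rotated]) (simp add: sec h_def)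
  qed
  have h01: "0 \<le> h a" "h a \<le> 1" for a by (auto simp: h_def)
  have hi: "integrable Q h" by (rule Q.integrable_const_bound[of _ 1]) (use h01 in auto)
  have "emeasure (sampleM P n \<Otimes>\<^sub>M Q) A = (\<integral>\<^sup>+a. emeasure (sampleM P n) ((\<lambda>\<omega>. (\<omega>, a)) -` A) \<partial>Q)"
    by (rule PQ.emeasure_pair_measure_alt2[OF A])
  also have "\<dots> = (\<integral>\<^sup>+a. ennreal (h a) \<partial>Q)"
    by (rule nn_integral_cong) (simp add: sec h_def S.emeasure_eq_measure)
  also have "\<dots> = ennreal (\<integral>a. h a \<partial>Q)"
    by (rule nn_integral_eq_integral[OF hi]) (use h01 in auto)
  finally have "measure (sampleM P n \<Otimes>\<^sub>M Q) A = (\<integral>a. h a \<partial>Q)"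
    using h01 by (simp add: measure_def Bochner_Integration.integral_nonneg)
  then have pT: "probT P Q fh gh w n t = (\<integral>a. h a \<partial>Q)"
    unfolding probT_def A_def by (simp add: case_prod_beta')
  have "\<bar>(\<integral>a. h a \<partial>Q) - Phi t\<bar> = \<bar>\<integral>a. (h a - Phi t) \<partial>Q\<bar>"
    using hi by (simp add: Q.prob_space)
  also have "\<dots> \<le> (\<integral>a. \<bar>h a - Phi t\<bar> \<partial>Q)" by (rule integral_abs_bound)
  also have "\<dots> \<le> (\<integral>a. \<epsilon>1 + indicator B a \<partial>Q)"
  proof (rule integral_mono)
    show "integrable Q (\<lambda>a. \<bar>h a - Phi t\<bar>)" using hi by simp
    show "integrable Q (\<lambda>a. \<epsilon>1 + indicator B a :: real)"
      using bad(1) by (intro Bochner_Integration.integrable_add Q.integrable_const integrable_real_indicator) (auto simp: Q.emeasure_eq_measure)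
    fix a assume a: "a \<in> space Q"
    show "\<bar>h a - Phi t\<bar> \<le> \<epsilon>1 + indicator B a"
    proof (cases "a \<in> B")
      case True
      then show ?thesis using h01[of a] Phi_bounds[of t] \<epsilon>1 by (auto simp: abs_le_iff)
    next
      case False
      then show ?thesis using good[OF a False] by (simp add: h_def)
    qed
  qed
  also have "\<dots> = \<epsilon>1 + measure Q B"
    using bad(1) by (subst Bochner_Integration.integral_add) (auto simp: Q.prob_space Q.emeasure_eq_measure)
  finally show ?thesis unfolding pT using bad(2) by linarith
qed

text \<open>The common source of both halves. The probability of a small conditional variance is
  left in the bound: in the uniform half it is 0, in the pointwise half, applied to a one-element
  family, it is made small through the choice of \<open>c\<close>.\<close>

lemma gcm_family:
  fixes \<P> :: "'z::euclidean_space obs measure set" and Q :: "'z obs measure \<Rightarrow> 'a measure" and \<eta> K C c \<epsilon> :: real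
    and w :: "nat \<Rightarrow> 'a \<Rightarrow> 'z \<Rightarrow> real"
  assumes set: "\<And>P. P \<in> \<P> \<Longrightarrow> gcm_setting P (f P) (g P) (u P) (v P) fh gh" and Q: "\<And>P. P \<in> \<P> \<Longrightarrow> prob_space (Q P)"
    and w: "\<And>P n. P \<in> \<P> \<Longrightarrow> (\<lambda>(a, z). w n a z) \<in> borel_measurable (Q P \<Otimes>\<^sub>M borel)"
    and C: "0 < C" and wC: "\<And>n a z. \<bar>w n a z\<bar> \<le> C"
    and err: "\<And>\<delta>. 0 < \<delta> \<Longrightarrow> eventually (\<lambda>n. \<forall>P\<in>\<P>. errors_small P (f P) (g P) (u P) (v P) fh gh n \<delta>) sequentially"
    and \<eta>: "0 < \<eta>" and mom: "\<And>P. P \<in> \<P> \<Longrightarrow> moment_epsxi P (f P) (g P) \<eta> \<le> ennreal K"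
    and c: "0 < c" and \<epsilon>: "0 < \<epsilon>"
  shows "eventually (\<lambda>n. \<forall>P\<in>\<P>. \<forall>t. \<bar>probT P (Q P) fh gh w n t - Phi t\<bar>
     \<le> \<epsilon> + measure (Q P) {a \<in> space (Q P). sigma_bar2 P (f P) (g P) w n a < ennreal c}) sequentially"
proof -
  obtain N \<delta> where \<delta>: "0 < \<delta>" and main: "\<forall>n\<ge>N. \<forall>(P :: 'z obs measure) f g u v fh gh w t.
     gcm_setting P f g u v fh gh \<longrightarrow> w \<in> borel_measurable borel \<longrightarrow> (\<forall>z. \<bar>w z\<bar> \<le> C) \<longrightarrow>
     moment_epsxi P f g \<eta> \<le> ennreal K \<longrightarrow>
     ennreal c \<le> (\<integral>\<^sup>+ \<omega>. ennreal ((w (Zc \<omega>))\<^sup>2 * (Xc \<omega> - f (Zc \<omega>))\<^sup>2 * (Yc \<omega> - g (Zc \<omega>))\<^sup>2) \<partial>P) \<longrightarrow>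
     errors_small P f g u v fh gh n \<delta> \<longrightarrow>
     \<bar>measure (sampleM P n) {\<omega> \<in> space (sampleM P n). studentized (\<lambda>i. (Xc (\<omega> i) - fh n (XZdata n \<omega>) (Zc (\<omega> i)))
        * (Yc (\<omega> i) - gh n (YZdata n \<omega>) (Zc (\<omega> i))) * w (Zc (\<omega> i))) n \<le> t} - Phi t\<bar> \<le> \<epsilon>"
    using gcm_uniform_fixed_weight[OF \<eta> C c \<epsilon>, of K] by (elim exE conjE) (rule that)
  show ?thesis
    using err[OF \<delta>] eventually_ge_at_top[of N]
  proof eventually_elim
    fix n assume err_n: "\<forall>P\<in>\<P>. errors_small P (f P) (g P) (u P) (v P) fh gh n \<delta>" and n: "N \<le> n"
    show "\<forall>P\<in>\<P>. \<forall>t. \<bar>probT P (Q P) fh gh w n t - Phi t\<bar>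
     \<le> \<epsilon> + measure (Q P) {a \<in> space (Q P). sigma_bar2 P (f P) (g P) w n a < ennreal c}"
    proof (intro ballI allI)
      fix P t assume P: "P \<in> \<P>"
      note set = set[OF P] and w = w[OF P, of n]
      show "\<bar>probT P (Q P) fh gh w n t - Phi t\<bar> \<le> \<epsilon> + measure (Q P) {a \<in> space (Q P). sigma_bar2 P (f P) (g P) w n a < ennreal c}"
      proof (rule probT_close[where w = w and n = n, OF set Q[OF P] w _ order_refl less_imp_le[OF \<epsilon>]])
        have "(\<lambda>a. sigma_bar2 P (f P) (g P) w n a) \<in> borel_measurable (Q P)"
          using set Q[OF P] w by (intro sigma_bar2_measurable) (auto simp: gcm_setting_def cond_mean_version_def)
        then show "{a \<in> space (Q P). sigma_bar2 P (f P) (g P) w n a < ennreal c} \<in> sets (Q P)" by measurable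
      next
        fix a assume a: "a \<in> space (Q P)" "a \<notin> {a \<in> space (Q P). sigma_bar2 P (f P) (g P) w n a < ennreal c}"
        have "w n a \<in> borel_measurable borel"
          using measurable_compose[OF measurable_Pair1'[OF a(1)] w] by simp
        moreover have "ennreal c \<le> (\<integral>\<^sup>+ \<omega>. ennreal ((w n a (Zc \<omega>))\<^sup>2 * (Xc \<omega> - f P (Zc \<omega>))\<^sup>2 * (Yc \<omega> - g P (Zc \<omega>))\<^sup>2) \<partial>P)"
          using a by (simp add: sigma_bar2_def not_less)
        ultimately show "\<bar>measure (sampleM P n) {\<omega> \<in> space (sampleM P n). Tstat fh gh w n \<omega> a \<le> t} - Phi t\<bar> \<le> \<epsilon>"
          unfolding Tstat_eq_studentized Rres_def[abs_def]
          using main[rule_format, OF n set _ _ mom[OF P] _ err_n[rule_format, OF P], of "w n a" t] wC by simp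
      qed
    qed
  qed
qed

lemma eventually_errors_small:
  assumes "\<forall>\<delta>>0. \<forall>\<epsilon>>0. eventually (\<lambda>n. \<forall>P\<in>\<P>. measure (sampleM P n) {\<omega> \<in> space (sampleM P n).
           \<bar>real n * (Aerr (f P) (fh n (XZdata n \<omega>)) n \<omega> * Aerr (g P) (gh n (YZdata n \<omega>)) n \<omega>)\<bar> > \<delta>} \<le> \<epsilon>) sequentially"
    and "\<forall>\<delta>>0. \<forall>\<epsilon>>0. eventually (\<lambda>n. \<forall>P\<in>\<P>. measure (sampleM P n) {\<omega> \<in> space (sampleM P n).
           Berr (f P) (fh n (XZdata n \<omega>)) (v P) n \<omega> > ennreal \<delta>} \<le> \<epsilon>) sequentially"
    and "\<forall>\<delta>>0. \<forall>\<epsilon>>0. eventually (\<lambda>n. \<forall>P\<in>\<P>. measure (sampleM P n) {\<omega> \<in> space (sampleM P n).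
           Berr (g P) (gh n (YZdata n \<omega>)) (u P) n \<omega> > ennreal \<delta>} \<le> \<epsilon>) sequentially"
    and \<delta>: "0 < \<delta>"
  shows "eventually (\<lambda>n. \<forall>P\<in>\<P>. errors_small P (f P) (g P) (u P) (v P) fh gh n \<delta>) sequentially"
  using assms(1)[rule_format, OF \<delta> \<delta>] assms(2)[rule_format, OF \<delta> \<delta>] assms(3)[rule_format, OF \<delta> \<delta>]
  by eventually_elim (simp add: errors_small_def)

text \<open>The lower variance bound depends on the realisation. Sets of realisations on which
  1/(k+1) fails decrease to a null set, so some fixed k fails with probability below \<epsilon>/2,
  and \<open>gcm_family\<close> runs with c = 1/(k+1).\<close>

lemma gcm_asymptotic_pointwise:
  fixes P :: "'z::euclidean_space obs measure" and Q :: "'a measure" and w :: "nat \<Rightarrow> 'a \<Rightarrow> 'z \<Rightarrow> real"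
  assumes set: "gcm_setting P f g u v fh gh" and Q: "prob_space Q"
    and w: "\<And>n. (\<lambda>(a, z). w n a z) \<in> borel_measurable (Q \<Otimes>\<^sub>M borel)"
    and C: "0 < C" "\<And>n a z. \<bar>w n a z\<bar> \<le> C"
    and err: "\<And>\<delta>. 0 < \<delta> \<Longrightarrow> eventually (\<lambda>n. errors_small P f g u v fh gh n \<delta>) sequentially"
    and \<eta>: "0 < \<eta>" and mom: "moment_epsxi P f g \<eta> < \<infinity>"
    and var: "AE a in Q. \<exists>c>0. \<forall>n. sigma_bar2 P f g w n a \<ge> ennreal c"
  shows "(\<lambda>n. SUP t. \<bar>probT P Q fh gh w n t - Phi t\<bar>) \<longlonglongrightarrow> 0"
proof -
  interpret Q: prob_space Q by (rule Q)
  have [measurable]: "(\<lambda>a. sigma_bar2 P f g w n a) \<in> borel_measurable Q" for n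
    using set w by (intro sigma_bar2_measurable) (auto simp: gcm_setting_def cond_mean_version_def)
  \<comment> \<open>The existential over \<open>n\<close> sits inside the set, so that k can be
    chosen once for all sample sizes.\<close>
  define B where "B k = {a \<in> space Q. \<exists>n. sigma_bar2 P f g w n a < ennreal (1 / real (Suc k))}" for k
  have B [measurable]: "B k \<in> sets Q" for k unfolding B_def by measurable
  have "decseq B"
  proof (rule decseq_SucI, rule subsetI)
    fix k a assume "a \<in> B (Suc k)"
    then obtain n where "a \<in> space Q" "sigma_bar2 P f g w n a < ennreal (1 / real (Suc (Suc k)))"
      by (auto simp: B_def)
    moreover have "ennreal (1 / real (Suc (Suc k))) \<le> ennreal (1 / real (Suc k))"
      by (intro ennreal_leI divide_left_mono) auto
    ultimately show "a \<in> B k" unfolding B_def using less_le_trans by blast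
  qed
  then have "(\<lambda>k. measure Q (B k)) \<longlonglongrightarrow> measure Q (\<Inter>k. B k)"
    by (intro Q.finite_Lim_measure_decseq) auto
  moreover have "measure Q (\<Inter>k. B k) = 0"
  proof -
    have "AE a in Q. a \<notin> (\<Inter>k. B k)"
      using var
    proof eventually_elim
      case (elim a)
      then obtain c where c: "0 < c" "\<And>n. ennreal c \<le> sigma_bar2 P f g w n a" by auto
      obtain k where "inverse (real (Suc k)) < c" using reals_Archimedean[OF c(1)] by auto
      then have "ennreal (1 / real (Suc k)) \<le> ennreal c" by (intro ennreal_leI) (simp add: inverse_eq_divide)
      then have "\<not> sigma_bar2 P f g w n a < ennreal (1 / real (Suc k))" for n
        using c(2)[of n] by (meson le_less_trans not_less_iff_gr_or_eq order.trans not_le)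
      then have "a \<notin> B k" by (simp add: B_def)
      then show ?case by blast
    qed
    moreover have "(\<Inter>k. B k) \<in> sets Q" by (intro sets.countable_INT) auto
    ultimately have "emeasure Q (\<Inter>k. B k) = 0"
      using AE_iff_null_sets[of "\<Inter>k. B k" Q] by auto
    then show ?thesis by (simp add: measure_def)
  qed
  ultimately have B_lim: "(\<lambda>k. measure Q (B k)) \<longlonglongrightarrow> 0" by simp
  have ev: "eventually (\<lambda>n. \<forall>t. \<bar>probT P Q fh gh w n t - Phi t\<bar> \<le> \<epsilon>) sequentially" if \<epsilon>: "0 < \<epsilon>" for \<epsilon>
  proof -
    have \<epsilon>2: "0 < \<epsilon> / 2" using \<epsilon> by simp
    have "eventually (\<lambda>k. measure Q (B k) < \<epsilon> / 2) sequentially"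
      by (rule order_tendstoD(2)[OF B_lim \<epsilon>2])
    then obtain k where k: "measure Q (B k) < \<epsilon> / 2" by (auto simp: eventually_sequentially)
    have "eventually (\<lambda>n. \<forall>P'\<in>{P}. \<forall>t. \<bar>probT P' Q fh gh w n t - Phi t\<bar>
        \<le> \<epsilon> / 2 + measure Q {a \<in> space Q. sigma_bar2 P' f g w n a < ennreal (1 / real (Suc k))}) sequentially"
      by (rule gcm_family[where K = "enn2real (moment_epsxi P f g \<eta>)" and f = "\<lambda>_. f" and g = "\<lambda>_. g" and u = "\<lambda>_. u"
            and v = "\<lambda>_. v" and Q = "\<lambda>_. Q" and C = C and \<eta> = \<eta>])
         (use set Q w C err \<eta> mom \<epsilon> in auto)
    then show ?thesis
    proof eventually_elim
      case (elim n)
      show ?case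
      proof
        fix t
        have "\<bar>probT P Q fh gh w n t - Phi t\<bar> \<le> \<epsilon> / 2 + measure Q {a \<in> space Q. sigma_bar2 P f g w n a < ennreal (1 / real (Suc k))}"
          using elim by simp
        also have "measure Q {a \<in> space Q. sigma_bar2 P f g w n a < ennreal (1 / real (Suc k))} \<le> measure Q (B k)"
          by (rule Q.finite_measure_mono[OF _ B]) (auto simp: B_def)
        finally show "\<bar>probT P Q fh gh w n t - Phi t\<bar> \<le> \<epsilon>" using k by linarith
      qed
    qed
  qed
  show ?thesis
  proof (rule LIMSEQ_I)
    fix r :: real assume r: "0 < r"
    then have "0 < r / 2" by simp
    from ev[OF this] obtain N where N: "\<And>n t. N \<le> n \<Longrightarrow> \<bar>probT P Q fh gh w n t - Phi t\<bar> \<le> r / 2"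
      by (auto simp: eventually_sequentially)
    have "norm ((SUP t. \<bar>probT P Q fh gh w n t - Phi t\<bar>) - 0) < r" if n: "N \<le> n" for n
    proof -
      have "(SUP t. \<bar>probT P Q fh gh w n t - Phi t\<bar>) \<le> r / 2"
        by (rule cSUP_least) (use N[OF n] in auto)
      \<comment> \<open>The term at t = 0 shows that the supremum is nonnegative; the uniform bound
        r / 2 supplies the boundedness that a real supremum requires.\<close>
      moreover have "\<bar>probT P Q fh gh w n 0 - Phi 0\<bar> \<le> (SUP t. \<bar>probT P Q fh gh w n t - Phi t\<bar>)"
        by (rule cSUP_upper) (use N[OF n] in \<open>auto intro!: bdd_aboveI2[where M = "r / 2"]\<close>)
      ultimately show ?thesis using r by simp
    qed
    then show "\<exists>no. \<forall>n\<ge>no. norm ((SUP t. \<bar>probT P Q fh gh w n t - Phi t\<bar>) - 0) < r" by blast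
  qed
qed

theorem theorem3:
  shows
  "(\<forall>(P :: ('z::euclidean_space) obs measure) (Q :: 'a measure) (fh :: 'z regr) (gh :: 'z regr)
       (w :: nat \<Rightarrow> 'a \<Rightarrow> 'z \<Rightarrow> real) (C :: real) f g u v.
      in_P0 P \<and> prob_space Q \<and>
      regr_measurable fh \<and> regr_measurable gh \<and>
      (\<forall>n. (\<lambda>(a, z). w n a z) \<in> borel_measurable (Q \<Otimes>\<^sub>M borel)) \<and>
      C > 0 \<and> (\<forall>n a z. \<bar>w n a z\<bar> \<le> C) \<and>
      cond_mean_version P Xc f \<and> cond_mean_version P Yc g \<and>
      cond_mean_version_nn P (\<lambda>\<omega>. ennreal ((Xc \<omega> - f (Zc \<omega>))\<^sup>2)) u \<and>
      cond_mean_version_nn P (\<lambda>\<omega>. ennreal ((Yc \<omega> - g (Zc \<omega>))\<^sup>2)) v \<and>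
      (\<forall>\<delta>>0. (\<lambda>n. measure (sampleM P n) {\<omega> \<in> space (sampleM P n).
           \<bar>real n * (Aerr f (fh n (XZdata n \<omega>)) n \<omega> * Aerr g (gh n (YZdata n \<omega>)) n \<omega>)\<bar> > \<delta>})
         \<longlonglongrightarrow> 0) \<and>
      (\<forall>\<delta>>0. (\<lambda>n. measure (sampleM P n) {\<omega> \<in> space (sampleM P n).
           Berr f (fh n (XZdata n \<omega>)) v n \<omega> > ennreal \<delta>}) \<longlonglongrightarrow> 0) \<and>
      (\<forall>\<delta>>0. (\<lambda>n. measure (sampleM P n) {\<omega> \<in> space (sampleM P n).
           Berr g (gh n (YZdata n \<omega>)) u n \<omega> > ennreal \<delta>}) \<longlonglongrightarrow> 0) \<and>
      (\<exists>\<eta>>0. moment_epsxi P f g \<eta> < \<infinity>) \<and>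
      (AE a in Q. \<exists>c>0. \<forall>n. sigma_bar2 P f g w n a \<ge> ennreal c)
    \<longrightarrow> (\<lambda>n. SUP t. \<bar>probT P Q fh gh w n t - Phi t\<bar>) \<longlonglongrightarrow> 0)
  \<and>
   (\<forall>(\<P> :: ('z::euclidean_space) obs measure set) (SA :: 'a measure) (Q :: 'z obs measure \<Rightarrow> 'a measure)
       (fh :: 'z regr) (gh :: 'z regr) (w :: nat \<Rightarrow> 'a \<Rightarrow> 'z \<Rightarrow> real) (C :: real) f g u v.
      (\<forall>P\<in>\<P>. in_P0 P \<and> prob_space (Q P) \<and> sets (Q P) = sets SA) \<and>
      regr_measurable fh \<and> regr_measurable gh \<and>
      (\<forall>n. (\<lambda>(a, z). w n a z) \<in> borel_measurable (SA \<Otimes>\<^sub>M borel)) \<and>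
      C > 0 \<and> (\<forall>n a z. \<bar>w n a z\<bar> \<le> C) \<and>
      (\<forall>P\<in>\<P>. cond_mean_version P Xc (f P) \<and> cond_mean_version P Yc (g P) \<and>
         cond_mean_version_nn P (\<lambda>\<omega>. ennreal ((Xc \<omega> - f P (Zc \<omega>))\<^sup>2)) (u P) \<and>
         cond_mean_version_nn P (\<lambda>\<omega>. ennreal ((Yc \<omega> - g P (Zc \<omega>))\<^sup>2)) (v P)) \<and>
      (\<forall>\<delta>>0. \<forall>\<epsilon>>0. eventually (\<lambda>n. \<forall>P\<in>\<P>. measure (sampleM P n) {\<omega> \<in> space (sampleM P n).
           \<bar>real n * (Aerr (f P) (fh n (XZdata n \<omega>)) n \<omega> * Aerr (g P) (gh n (YZdata n \<omega>)) n \<omega>)\<bar> > \<delta>}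
           \<le> \<epsilon>) sequentially) \<and>
      (\<forall>\<delta>>0. \<forall>\<epsilon>>0. eventually (\<lambda>n. \<forall>P\<in>\<P>. measure (sampleM P n) {\<omega> \<in> space (sampleM P n).
           Berr (f P) (fh n (XZdata n \<omega>)) (v P) n \<omega> > ennreal \<delta>} \<le> \<epsilon>) sequentially) \<and>
      (\<forall>\<delta>>0. \<forall>\<epsilon>>0. eventually (\<lambda>n. \<forall>P\<in>\<P>. measure (sampleM P n) {\<omega> \<in> space (sampleM P n).
           Berr (g P) (gh n (YZdata n \<omega>)) (u P) n \<omega> > ennreal \<delta>} \<le> \<epsilon>) sequentially) \<and>
      (\<exists>\<eta>>0. \<exists>K::real. \<forall>P\<in>\<P>. moment_epsxi P (f P) (g P) \<eta> \<le> ennreal K) \<and>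
      (\<exists>c>0. \<forall>P\<in>\<P>. AE a in Q P. \<forall>n. sigma_bar2 P (f P) (g P) w n a \<ge> ennreal c)
    \<longrightarrow> (\<forall>\<epsilon>>0. eventually (\<lambda>n. \<forall>P\<in>\<P>. \<forall>t. \<bar>probT P (Q P) fh gh w n t - Phi t\<bar> \<le> \<epsilon>) sequentially))"
proof (intro conjI allI impI)
  fix P :: "'z obs measure" and Q :: "'a measure" and fh gh :: "'z regr" and w :: "nat \<Rightarrow> 'a \<Rightarrow> 'z \<Rightarrow> real"
    and C :: real and f g u v
  assume A: "in_P0 P \<and> prob_space Q \<and>
      regr_measurable fh \<and> regr_measurable gh \<and>
      (\<forall>n. (\<lambda>(a, z). w n a z) \<in> borel_measurable (Q \<Otimes>\<^sub>M borel)) \<and>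
      C > 0 \<and> (\<forall>n a z. \<bar>w n a z\<bar> \<le> C) \<and>
      cond_mean_version P Xc f \<and> cond_mean_version P Yc g \<and>
      cond_mean_version_nn P (\<lambda>\<omega>. ennreal ((Xc \<omega> - f (Zc \<omega>))\<^sup>2)) u \<and>
      cond_mean_version_nn P (\<lambda>\<omega>. ennreal ((Yc \<omega> - g (Zc \<omega>))\<^sup>2)) v \<and>
      (\<forall>\<delta>>0. (\<lambda>n. measure (sampleM P n) {\<omega> \<in> space (sampleM P n).
           \<bar>real n * (Aerr f (fh n (XZdata n \<omega>)) n \<omega> * Aerr g (gh n (YZdata n \<omega>)) n \<omega>)\<bar> > \<delta>})
         \<longlonglongrightarrow> 0) \<and>
      (\<forall>\<delta>>0. (\<lambda>n. measure (sampleM P n) {\<omega> \<in> space (sampleM P n).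
           Berr f (fh n (XZdata n \<omega>)) v n \<omega> > ennreal \<delta>}) \<longlonglongrightarrow> 0) \<and>
      (\<forall>\<delta>>0. (\<lambda>n. measure (sampleM P n) {\<omega> \<in> space (sampleM P n).
           Berr g (gh n (YZdata n \<omega>)) u n \<omega> > ennreal \<delta>}) \<longlonglongrightarrow> 0) \<and>
      (\<exists>\<eta>>0. moment_epsxi P f g \<eta> < \<infinity>) \<and>
      (AE a in Q. \<exists>c>0. \<forall>n. sigma_bar2 P f g w n a \<ge> ennreal c)"
  then obtain \<eta> where \<eta>: "0 < \<eta>" "moment_epsxi P f g \<eta> < \<infinity>" by (elim conjE exE) (rule that)
  show "(\<lambda>n. SUP t. \<bar>probT P Q fh gh w n t - Phi t\<bar>) \<longlonglongrightarrow> 0"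
  proof (rule gcm_asymptotic_pointwise[where C = C, OF _ _ _ _ _ _ \<eta>])
    show "gcm_setting P f g u v fh gh" using A by (simp add: gcm_setting_def)
    fix \<delta> :: real assume \<delta>: "0 < \<delta>"
    have lim: "eventually (\<lambda>n. h n \<le> \<delta>) sequentially" if "h \<longlonglongrightarrow> 0" for h :: "nat \<Rightarrow> real"
      using order_tendstoD(2)[OF that \<delta>] by eventually_elim simp
    from A have "(\<lambda>n. measure (sampleM P n) {\<omega> \<in> space (sampleM P n).
           \<bar>real n * (Aerr f (fh n (XZdata n \<omega>)) n \<omega> * Aerr g (gh n (YZdata n \<omega>)) n \<omega>)\<bar> > \<delta>}) \<longlonglongrightarrow> 0"
      "(\<lambda>n. measure (sampleM P n) {\<omega> \<in> space (sampleM P n). Berr f (fh n (XZdata n \<omega>)) v n \<omega> > ennreal \<delta>}) \<longlonglongrightarrow> 0"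
      "(\<lambda>n. measure (sampleM P n) {\<omega> \<in> space (sampleM P n). Berr g (gh n (YZdata n \<omega>)) u n \<omega> > ennreal \<delta>}) \<longlonglongrightarrow> 0"
      using \<delta> by simp_all
    from this[THEN lim] show "eventually (\<lambda>n. errors_small P f g u v fh gh n \<delta>) sequentially"
      by eventually_elim (simp add: errors_small_def)
  qed (use A in simp_all)
next
  fix \<P> :: "'z obs measure set" and SA :: "'a measure" and Q :: "'z obs measure \<Rightarrow> 'a measure" and fh gh :: "'z regr"
    and w :: "nat \<Rightarrow> 'a \<Rightarrow> 'z \<Rightarrow> real" and C :: real and f g u v and \<epsilon> :: real
  assume A: "(\<forall>P\<in>\<P>. in_P0 P \<and> prob_space (Q P) \<and> sets (Q P) = sets SA) \<and>
      regr_measurable fh \<and> regr_measurable gh \<and>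
      (\<forall>n. (\<lambda>(a, z). w n a z) \<in> borel_measurable (SA \<Otimes>\<^sub>M borel)) \<and>
      C > 0 \<and> (\<forall>n a z. \<bar>w n a z\<bar> \<le> C) \<and>
      (\<forall>P\<in>\<P>. cond_mean_version P Xc (f P) \<and> cond_mean_version P Yc (g P) \<and>
         cond_mean_version_nn P (\<lambda>\<omega>. ennreal ((Xc \<omega> - f P (Zc \<omega>))\<^sup>2)) (u P) \<and>
         cond_mean_version_nn P (\<lambda>\<omega>. ennreal ((Yc \<omega> - g P (Zc \<omega>))\<^sup>2)) (v P)) \<and>
      (\<forall>\<delta>>0. \<forall>\<epsilon>>0. eventually (\<lambda>n. \<forall>P\<in>\<P>. measure (sampleM P n) {\<omega> \<in> space (sampleM P n).
           \<bar>real n * (Aerr (f P) (fh n (XZdata n \<omega>)) n \<omega> * Aerr (g P) (gh n (YZdata n \<omega>)) n \<omega>)\<bar> > \<delta>}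
           \<le> \<epsilon>) sequentially) \<and>
      (\<forall>\<delta>>0. \<forall>\<epsilon>>0. eventually (\<lambda>n. \<forall>P\<in>\<P>. measure (sampleM P n) {\<omega> \<in> space (sampleM P n).
           Berr (f P) (fh n (XZdata n \<omega>)) (v P) n \<omega> > ennreal \<delta>} \<le> \<epsilon>) sequentially) \<and>
      (\<forall>\<delta>>0. \<forall>\<epsilon>>0. eventually (\<lambda>n. \<forall>P\<in>\<P>. measure (sampleM P n) {\<omega> \<in> space (sampleM P n).
           Berr (g P) (gh n (YZdata n \<omega>)) (u P) n \<omega> > ennreal \<delta>} \<le> \<epsilon>) sequentially) \<and>
      (\<exists>\<eta>>0. \<exists>K::real. \<forall>P\<in>\<P>. moment_epsxi P (f P) (g P) \<eta> \<le> ennreal K) \<and>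
      (\<exists>c>0. \<forall>P\<in>\<P>. AE a in Q P. \<forall>n. sigma_bar2 P (f P) (g P) w n a \<ge> ennreal c)"
    and \<epsilon>: "\<epsilon> > 0"
  from A obtain \<eta> K where \<eta>: "0 < \<eta>" and K: "\<forall>P\<in>\<P>. moment_epsxi P (f P) (g P) \<eta> \<le> ennreal K"
    by (elim conjE exE) (rule that)
  from A obtain c where c: "0 < c" and var: "\<forall>P\<in>\<P>. AE a in Q P. \<forall>n. sigma_bar2 P (f P) (g P) w n a \<ge> ennreal c"
    by (elim conjE exE) (rule that)
  \<comment> \<open>Measurability depends on the sigma-algebra only, and \<open>SA\<close> fixes one
    shared by all the laws \<open>Q P\<close>.\<close>
  have w: "(\<lambda>(a, z). w n a z) \<in> borel_measurable (Q P \<Otimes>\<^sub>M borel)" if "P \<in> \<P>" for P n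
  proof -
    have "sets (Q P \<Otimes>\<^sub>M (borel :: 'z measure)) = sets (SA \<Otimes>\<^sub>M borel)"
      using A that by (intro sets_pair_measure_cong) simp_all
    then show ?thesis using A by (simp cong: measurable_cong_sets)
  qed
  have "eventually (\<lambda>n. \<forall>P\<in>\<P>. \<forall>t. \<bar>probT P (Q P) fh gh w n t - Phi t\<bar>
     \<le> \<epsilon> + measure (Q P) {a \<in> space (Q P). sigma_bar2 P (f P) (g P) w n a < ennreal c}) sequentially"
  proof (rule gcm_family[where C = C and K = K, OF _ _ w _ _ _ \<eta> _ c \<epsilon>])
    show "gcm_setting P (f P) (g P) (u P) (v P) fh gh" if "P \<in> \<P>" for P
      using A that by (simp add: gcm_setting_def)
    show "eventually (\<lambda>n. \<forall>P\<in>\<P>. errors_small P (f P) (g P) (u P) (v P) fh gh n \<delta>) sequentially" if "0 < \<delta>" for \<delta>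
      by (rule eventually_errors_small[OF _ _ _ that]) (insert A, elim conjE, assumption)+
    show "moment_epsxi P (f P) (g P) \<eta> \<le> ennreal K" if "P \<in> \<P>" for P
      using K that by (rule bspec)
  qed (use A in simp_all)
  \<comment> \<open>The almost sure bound with a common \<open>c\<close> makes the exceptional term
    vanish for every law and every n, leaving \<epsilon> alone.\<close>
  moreover have "measure (Q P) {a \<in> space (Q P). sigma_bar2 P (f P) (g P) w n a < ennreal c} = 0" if P: "P \<in> \<P>" for P n
  proof -
    have "AE a in Q P. \<not> sigma_bar2 P (f P) (g P) w n a < ennreal c"
      using bspec[OF var P] by eventually_elim (simp add: not_less)
    then have "emeasure (Q P) {a \<in> space (Q P). sigma_bar2 P (f P) (g P) w n a < ennreal c} = 0"
      by (rule emeasure_eq_0_AE)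
    then show ?thesis by (simp add: measure_def)
  qed
  ultimately show "eventually (\<lambda>n. \<forall>P\<in>\<P>. \<forall>t. \<bar>probT P (Q P) fh gh w n t - Phi t\<bar> \<le> \<epsilon>) sequentially"
    by (elim eventually_mono) simp
qed

end
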